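(* Let $G$ be a Lie group whose Lie algebra $\mathfrak g$ carries an invariant inner product $B$, let $D=G\times G$ and $\mathfrak d=\mathfrak g\oplus\overline{\mathfrak g}$. The map $\mathsf s:\mathfrak d\to\Gamma(\mathbb{T}G)$ is $D$-equivariant, and satisfies \[\langle\mathsf s(\zeta_1),\mathsf s(\zeta_2)\rangle=B_{\mathfrak d}(\zeta_1,\zeta_2),\qquad [\![\mathsf s(\zeta_1),\mathsf s(\zeta_2)]\!]_\eta=\mathsf s([\zeta_1,\zeta_2])\] for all $\zeta_1,\zeta_2\in\mathfrak d$. Furthermore, \[\Upsilon(\mathsf s(\zeta_1),\mathsf s(\zeta_2),\mathsf s(\zeta_3))=B_{\mathfrak d}(\zeta_1,[\zeta_2,\zeta_3])\] for all $\zeta_1,\zeta_2,\zeta_3\in\mathfrak d$.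
   Context: $B$ is an $\mathrm{Ad}$-invariant non-degenerate symmetric bilinear form on $\mathfrak g$. $\xi^L,\xi^R$ are the left-/right-invariant vector fields equal to $\xi$ at the unit; $\theta^L,\theta^R\in\Omega^1(G)\otimes\mathfrak g$ are the left-/right-Maurer–Cartan forms ($\iota(\xi^L)\theta^L=\iota(\xi^R)\theta^R=\xi$); $\eta=\frac1{12}B(\theta^L,[\theta^L,\theta^L])\in\Omega^3(G)$, a closed bi-invariant 3-form. $\mathbb{T}G=TG\oplus T^*G$ with $\langle v_1\oplus\alpha_1,v_2\oplus\alpha_2\rangle=\alpha_1(v_2)+\alpha_2(v_1)$, acting on $\Omega(G)$ by $\varrho(v\oplus\alpha)=\alpha\wedge\cdot+\iota(v)$. The $\eta$-twisted Courant bracket on $\Gamma(\mathbb{T}G)$ is defined by $\varrho([\![x_1,x_2]\!]_\eta)=[[\mathrm d+\eta,\varrho(x_1)],\varrho(x_2)]$ (graded commutators of operators on $\Omega(G)$), and $\Upsilon(x_1,x_2,x_3)\in C^\infty(G)$ is the function such that $[\varrho(x_1),[\varrho(x_2),[\varrho(x_3),\mathrm d+\eta]]]$ is multiplication by it (equivalently $\Upsilon(x_1,x_2,x_3)=-\langle[\![x_3,x_2]\!]_\eta,x_1\rangle$). $\mathfrak d=\mathfrak g\oplus\overline{\mathfrak g}$ is the direct sum Lie algebra with bilinear form $B_{\mathfrak d}$ equal to $B$ on the first summand and $-B$ on the second. $D=G\times G$ acts on $G$ by $\mathcal A(a,a')(g)=a'ga^{-1}$, hence on $\Gamma(\mathbb{T}G)$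 by push-forward, and on $\mathfrak d$ by the adjoint action. The map $\mathsf s$ is $\mathsf s(\xi,\xi')=\mathsf s^L(\xi)+\mathsf s^R(\xi')$ with \[\mathsf s^L(\xi)=\xi^L\oplus\tfrac12B(\theta^L,\xi),\qquad \mathsf s^R(\xi')=-(\xi')^R\oplus\tfrac12B(\theta^R,\xi').\] *)

theory Defs
  imports
    "HOL-Analysis.Analysis"
    "HOL-Algebra.Group"
    "HOL-Library.Function_Algebras"
begin

text \<open>
  Tangent vectors, vector fields and differential forms are represented by functions below;
  this instance (with \<^theory>\<open>HOL-Library.Function_Algebras\<close>) supplies the pointwise
  vector space operations on them.
\<close>

instantiation "fun" :: (type, real_vector) real_vector
begin

definition scaleR_fun :: "real \<Rightarrow> ('a \<Rightarrow> 'b) \<Rightarrow> 'a \<Rightarrow> 'b"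
  where "scaleR_fun c f = (\<lambda>x. c *\<^sub>R f x)"

instance
  by standard (simp_all add: scaleR_fun_def fun_eq_iff scaleR_add_right scaleR_add_left)

end

lemma scaleR_fun_apply [simp]: "(c *\<^sub>R f) x = c *\<^sub>R f x"
  by (simp add: scaleR_fun_def)


section \<open>Smooth manifolds\<close>

primrec Ck_on ::
    "nat \<Rightarrow> ('a::real_normed_vector \<Rightarrow> 'b::real_normed_vector) \<Rightarrow> 'a set \<Rightarrow> bool"
  where
    "Ck_on 0 f S \<longleftrightarrow> continuous_on S f"
  | "Ck_on (Suc k) f S \<longleftrightarrow> (\<forall>x\<in>S. f differentiable (at x)) \<and>
       (\<forall>v. Ck_on k (\<lambda>x. frechet_derivative f (at x) v) S)"

text \<open>Meaningful for open sets in finite-dimensional spaces, the only case used here.\<close>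

definition smooth_on ::
    "('a::real_normed_vector \<Rightarrow> 'b::real_normed_vector) \<Rightarrow> 'a set \<Rightarrow> bool"
  where "smooth_on f S \<longleftrightarrow> (\<forall>k. Ck_on k f S)"

text \<open>A chart is a pair of its domain and its coordinate map; only the values of the coordinate
  map on the domain matter.\<close>

type_synonym ('m, 'e) chart = "'m set \<times> ('m \<Rightarrow> 'e)"

definition smooth_atlas ::
    "('m::topological_space, 'e::real_normed_vector) chart set \<Rightarrow> bool"
  where
    "smooth_atlas A \<longleftrightarrow>
       (\<forall>(U, \<phi>)\<in>A. open U \<and> open (\<phi> ` U) \<and> (\<exists>\<psi>. homeomorphism U (\<phi> ` U) \<phi> \<psi>)) \<and>
       \<Union> (fst ` A) = UNIV \<and>
       (\<forall>(U, \<phi>)\<in>A. \<forall>(V, \<psi>)\<in>A. smooth_on (\<psi> \<circ> inv_into U \<phi>) (\<phi> ` (U \<inter> V)))"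

definition product_atlas ::
    "('m, 'e) chart set \<Rightarrow> ('n, 'f) chart set \<Rightarrow> ('m \<times> 'n, 'e \<times> 'f) chart set"
  where "product_atlas A A' = {(U \<times> V, map_prod \<phi> \<psi>) | U \<phi> V \<psi>. (U, \<phi>) \<in> A \<and> (V, \<psi>) \<in> A'}"

definition smooth_map ::
    "('m::topological_space, 'e::real_normed_vector) chart set \<Rightarrow>
     ('n::topological_space, 'f::real_normed_vector) chart set \<Rightarrow> ('m \<Rightarrow> 'n) \<Rightarrow> bool"
  where
    "smooth_map A A' F \<longleftrightarrow> continuous_on UNIV F \<and>
       (\<forall>(U, \<phi>)\<in>A. \<forall>(V, \<psi>)\<in>A'. smooth_on (\<psi> \<circ> F \<circ> inv_into U \<phi>) (\<phi> ` (U \<inter> F -` V)))"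

definition smooth_functions ::
    "('m::topological_space, 'e::real_normed_vector) chart set \<Rightarrow> ('m \<Rightarrow> real) set"
  where
    "smooth_functions A = {f. \<forall>(U, \<phi>)\<in>A. smooth_on (f \<circ> inv_into U \<phi>) (\<phi> ` U)}"


section \<open>Tangent vectors and vector fields\<close>

text \<open>
  A tangent vector at \<open>p\<close> is a derivation at \<open>p\<close> of the algebra of smooth functions.  It is given
  the value \<open>0\<close> on functions that are not smooth, so that equality of tangent vectors is equality
  in HOL.
\<close>

type_synonym 'm tvec = "('m \<Rightarrow> real) \<Rightarrow> real"

definition tangent_space ::
    "('m::topological_space, 'e::real_normed_vector) chart set \<Rightarrow> 'm \<Rightarrow> 'm tvec set"
  where
    "tangent_space A p = {v.
       (\<forall>f. f \<notin> smooth_functions A \<longrightarrow> v f = 0) \<and>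
       (\<forall>f\<in>smooth_functions A. \<forall>h\<in>smooth_functions A.
          (\<forall>a b. v (\<lambda>x. a * f x + b * h x) = a * v f + b * v h) \<and>
          v (\<lambda>x. f x * h x) = f p * v h + h p * v f)}"

definition push_tvec ::
    "('n::topological_space, 'f::real_normed_vector) chart set \<Rightarrow> ('m \<Rightarrow> 'n) \<Rightarrow>
     'm tvec \<Rightarrow> 'n tvec"
  where "push_tvec A' \<phi> v = (\<lambda>f. if f \<in> smooth_functions A' then v (f \<circ> \<phi>) else 0)"

type_synonym 'm vfield = "'m \<Rightarrow> 'm tvec"

definition vector_fields ::
    "('m::topological_space, 'e::real_normed_vector) chart set \<Rightarrow> 'm vfield set"
  where
    "vector_fields A = {X. (\<forall>p. X p \<in> tangent_space A p) \<and>
       (\<forall>f\<in>smooth_functions A. (\<lambda>p. X p f) \<in> smooth_functions A)}"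

definition vf_bracket :: "'m vfield \<Rightarrow> 'm vfield \<Rightarrow> 'm vfield"
  where "vf_bracket X Y = (\<lambda>p f. X p (\<lambda>q. Y q f) - Y p (\<lambda>q. X q f))"

text \<open>Push-forward along a diffeomorphism \<open>\<phi>\<close> of the manifold.\<close>

definition push_vf ::
    "('m::topological_space, 'e::real_normed_vector) chart set \<Rightarrow> ('m \<Rightarrow> 'm) \<Rightarrow>
     'm vfield \<Rightarrow> 'm vfield"
  where "push_vf A \<phi> X = (\<lambda>q. push_tvec A \<phi> (X (the_inv \<phi> q)))"


section \<open>Differential forms\<close>

text \<open>
  A form of degree \<open>k\<close> is an alternating \<open>C\<^sup>\<infinity>(M)\<close>-multilinear map taking \<open>k\<close> vector fields to a
  smooth function.  A form of mixed degree is represented by a single function on lists of vector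
  fields, whose degree \<open>k\<close> component is the restriction to lists of length \<open>k\<close>; by alternation the
  components above the dimension vanish.  The value on lists containing something that is not a
  smooth vector field is \<open>0\<close>.
\<close>

type_synonym ('m, 'a) vform = "'m vfield list \<Rightarrow> 'm \<Rightarrow> 'a"
type_synonym 'm form = "('m, real) vform"

definition forms ::
    "('m::topological_space, 'e::real_normed_vector) chart set \<Rightarrow> 'm form set"
  where
    "forms A = {\<omega>.
       (\<forall>Xs. \<not> set Xs \<subseteq> vector_fields A \<longrightarrow> \<omega> Xs = 0) \<and>
       (\<forall>Xs. set Xs \<subseteq> vector_fields A \<longrightarrow> \<omega> Xs \<in> smooth_functions A) \<and>
       (\<forall>Xs X Y Ys f h. set (Xs @ X # Y # Ys) \<subseteq> vector_fields A \<longrightarrow>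
          f \<in> smooth_functions A \<longrightarrow> h \<in> smooth_functions A \<longrightarrow>
          \<omega> (Xs @ (\<lambda>p. f p *\<^sub>R X p + h p *\<^sub>R Y p) # Ys) =
            (\<lambda>p. f p * \<omega> (Xs @ X # Ys) p + h p * \<omega> (Xs @ Y # Ys) p)) \<and>
       (\<forall>Xs X Ys Zs. set (Xs @ X # Ys @ Zs) \<subseteq> vector_fields A \<longrightarrow>
          \<omega> (Xs @ X # Ys @ X # Zs) = 0)}"

definition k_forms ::
    "('m::topological_space, 'e::real_normed_vector) chart set \<Rightarrow> nat \<Rightarrow> 'm form set"
  where "k_forms A k = {\<omega> \<in> forms A. \<forall>Xs. length Xs \<noteq> k \<longrightarrow> \<omega> Xs = 0}"

text \<open>
  The wedge product of vector-valued forms with respect to a bilinear pairing \<open>m\<close> of the values,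
  as a sum over shuffles without normalising factors: \<open>S\<close> is the set of positions of the arguments
  given to the first factor.
\<close>

definition shuffle_sign :: "nat set \<Rightarrow> real"
  where "shuffle_sign S = (- 1) ^ card {(i, j). i \<in> S \<and> j \<notin> S \<and> j < i}"

definition wedge_with ::
    "('a \<Rightarrow> 'b \<Rightarrow> 'c::real_vector) \<Rightarrow> ('m, 'a) vform \<Rightarrow> ('m, 'b) vform \<Rightarrow> ('m, 'c) vform"
  where
    "wedge_with m \<omega> \<omega>' = (\<lambda>Xs p. \<Sum>S\<in>Pow {..<length Xs}.
       shuffle_sign S *\<^sub>R m (\<omega> (nths Xs S) p) (\<omega>' (nths Xs (- S)) p))"

abbreviation wedge :: "'m form \<Rightarrow> 'm form \<Rightarrow> 'm form"
  where "wedge \<equiv> wedge_with (*)"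

definition contraction :: "'m vfield \<Rightarrow> 'm form \<Rightarrow> 'm form"
  where "contraction X \<omega> = (\<lambda>Xs. \<omega> (X # Xs))"

text \<open>The exterior derivative, by Koszul's formula.\<close>

definition ext_deriv ::
    "('m::topological_space, 'e::real_normed_vector) chart set \<Rightarrow> 'm form \<Rightarrow> 'm form"
  where
    "ext_deriv A \<omega> = (\<lambda>Xs p. if set Xs \<subseteq> vector_fields A then
       (\<Sum>i<length Xs. (- 1) ^ i * (Xs ! i) p (\<omega> (nths Xs (- {i})))) +
       (\<Sum>j<length Xs. \<Sum>i<j. (- 1) ^ (i + j) *
          \<omega> (vf_bracket (Xs ! i) (Xs ! j) # nths Xs (- {i, j})) p)
     else 0)"

definition push_form ::
    "('m::topological_space, 'e::real_normed_vector) chart set \<Rightarrow> ('m \<Rightarrow> 'm) \<Rightarrow>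
     'm form \<Rightarrow> 'm form"
  where
    "push_form A \<phi> \<omega> = (\<lambda>Xs p. if set Xs \<subseteq> vector_fields A
       then \<omega> (map (push_vf A (the_inv \<phi>)) Xs) (the_inv \<phi> p) else 0)"


section \<open>The twisted Courant bracket\<close>

type_synonym 'm gsection = "'m vfield \<times> 'm form"

text \<open>The space \<open>\<Gamma>(\<bbbT>M)\<close> of sections of \<open>\<bbbT>M = TM \<oplus> T\<^sup>*M\<close>.\<close>

definition gsections ::
    "('m::topological_space, 'e::real_normed_vector) chart set \<Rightarrow> 'm gsection set"
  where "gsections A = vector_fields A \<times> k_forms A 1"

definition pairing :: "'m gsection \<Rightarrow> 'm gsection \<Rightarrow> 'm \<Rightarrow> real"
  where "pairing = (\<lambda>(v\<^sub>1, \<alpha>\<^sub>1) (v\<^sub>2, \<alpha>\<^sub>2). \<alpha>\<^sub>1 [v\<^sub>2] + \<alpha>\<^sub>2 [v\<^sub>1])"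

definition push_gsection ::
    "('m::topological_space, 'e::real_normed_vector) chart set \<Rightarrow> ('m \<Rightarrow> 'm) \<Rightarrow>
     'm gsection \<Rightarrow> 'm gsection"
  where "push_gsection A \<phi> = map_prod (push_vf A \<phi>) (push_form A \<phi>)"

definition clifford_action :: "'m gsection \<Rightarrow> 'm form \<Rightarrow> 'm form"
  where "clifford_action = (\<lambda>(v, \<alpha>) \<omega>. wedge \<alpha> \<omega> + contraction v \<omega>)"

text \<open>The graded commutator of operators of the parities \<open>k\<close> and \<open>l\<close>.\<close>

definition graded_commutator ::
    "nat \<Rightarrow> nat \<Rightarrow> ('m form \<Rightarrow> 'm form) \<Rightarrow> ('m form \<Rightarrow> 'm form) \<Rightarrow> 'm form \<Rightarrow> 'm form"
  where "graded_commutator k l P Q = (\<lambda>\<omega>. P (Q \<omega>) - (- 1) ^ (k * l) *\<^sub>R Q (P \<omega>))"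

definition twisted_d ::
    "('m::topological_space, 'e::real_normed_vector) chart set \<Rightarrow> 'm form \<Rightarrow> 'm form \<Rightarrow> 'm form"
  where "twisted_d A \<eta> \<omega> = ext_deriv A \<omega> + wedge \<eta> \<omega>"

definition courant_bracket ::
    "('m::topological_space, 'e::real_normed_vector) chart set \<Rightarrow> 'm form \<Rightarrow>
     'm gsection \<Rightarrow> 'm gsection \<Rightarrow> 'm gsection"
  where
    "courant_bracket A \<eta> x\<^sub>1 x\<^sub>2 = (THE x. x \<in> gsections A \<and>
       (\<forall>\<omega>\<in>forms A. clifford_action x \<omega> =
          graded_commutator 0 1
            (graded_commutator 1 1 (twisted_d A \<eta>) (clifford_action x\<^sub>1)) (clifford_action x\<^sub>2) \<omega>))"

definition Upsilon ::
    "('m::topological_space, 'e::real_normed_vector) chart set \<Rightarrow> 'm form \<Rightarrow>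
     'm gsection \<Rightarrow> 'm gsection \<Rightarrow> 'm gsection \<Rightarrow> 'm \<Rightarrow> real"
  where
    "Upsilon A \<eta> x\<^sub>1 x\<^sub>2 x\<^sub>3 = (THE f. f \<in> smooth_functions A \<and>
       (\<forall>\<omega>\<in>forms A.
          graded_commutator 1 1 (clifford_action x\<^sub>1)
            (graded_commutator 1 0 (clifford_action x\<^sub>2)
              (graded_commutator 1 1 (clifford_action x\<^sub>3) (twisted_d A \<eta>))) \<omega> =
          (\<lambda>Xs p. f p * \<omega> Xs p)))"


section \<open>Lie groups\<close>

record ('g, 'e) lie_data = "'g monoid" +
  charts :: "('g, 'e) chart set"

text \<open>
  The model space is a finite-dimensional real inner product space; the class
  \<^class>\<open>euclidean_space\<close> would exclude groups of dimension \<open>0\<close>.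
\<close>

definition lie_group ::
    "('g::{t2_space, second_countable_topology}, 'e::real_inner) lie_data \<Rightarrow> bool"
  where
    "lie_group G \<longleftrightarrow> group G \<and> carrier G = UNIV \<and>
       (\<exists>E::'e set. finite E \<and> span E = UNIV) \<and>
       smooth_atlas (charts G) \<and>
       smooth_map (product_atlas (charts G) (charts G)) (charts G) (\<lambda>(g, h). g \<otimes>\<^bsub>G\<^esub> h) \<and>
       smooth_map (charts G) (charts G) (\<lambda>g. inv\<^bsub>G\<^esub> g)"

definition lie_algebra ::
    "('g::topological_space, 'e::real_normed_vector) lie_data \<Rightarrow> 'g tvec set"
  where "lie_algebra G = tangent_space (charts G) \<one>\<^bsub>G\<^esub>"

definition left_field ::
    "('g::topological_space, 'e::real_normed_vector) lie_data \<Rightarrow> 'g tvec \<Rightarrow> 'g vfield"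
  where
    "left_field G \<xi> = (THE X. X \<in> vector_fields (charts G) \<and>
       (\<forall>a\<in>carrier G. push_vf (charts G) (\<lambda>g. a \<otimes>\<^bsub>G\<^esub> g) X = X) \<and> X \<one>\<^bsub>G\<^esub> = \<xi>)"

definition right_field ::
    "('g::topological_space, 'e::real_normed_vector) lie_data \<Rightarrow> 'g tvec \<Rightarrow> 'g vfield"
  where
    "right_field G \<xi> = (THE X. X \<in> vector_fields (charts G) \<and>
       (\<forall>a\<in>carrier G. push_vf (charts G) (\<lambda>g. g \<otimes>\<^bsub>G\<^esub> a) X = X) \<and> X \<one>\<^bsub>G\<^esub> = \<xi>)"

definition lie_bracket ::
    "('g::topological_space, 'e::real_normed_vector) lie_data \<Rightarrow>
     'g tvec \<Rightarrow> 'g tvec \<Rightarrow> 'g tvec"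
  where "lie_bracket G \<xi> \<zeta> = vf_bracket (left_field G \<xi>) (left_field G \<zeta>) \<one>\<^bsub>G\<^esub>"

definition Ad ::
    "('g::topological_space, 'e::real_normed_vector) lie_data \<Rightarrow> 'g \<Rightarrow> 'g tvec \<Rightarrow> 'g tvec"
  where "Ad G a = push_tvec (charts G) (\<lambda>g. a \<otimes>\<^bsub>G\<^esub> g \<otimes>\<^bsub>G\<^esub> inv\<^bsub>G\<^esub> a)"

definition invariant_inner_product ::
    "('g::topological_space, 'e::real_normed_vector) lie_data \<Rightarrow>
     ('g tvec \<Rightarrow> 'g tvec \<Rightarrow> real) \<Rightarrow> bool"
  where
    "invariant_inner_product G B \<longleftrightarrow>
       (\<forall>\<xi>\<in>lie_algebra G. \<forall>\<xi>'\<in>lie_algebra G. \<forall>\<zeta>\<in>lie_algebra G. \<forall>a b.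
          B (a *\<^sub>R \<xi> + b *\<^sub>R \<xi>') \<zeta> = a * B \<xi> \<zeta> + b * B \<xi>' \<zeta>) \<and>
       (\<forall>\<xi>\<in>lie_algebra G. \<forall>\<zeta>\<in>lie_algebra G. B \<xi> \<zeta> = B \<zeta> \<xi>) \<and>
       (\<forall>\<xi>\<in>lie_algebra G. (\<forall>\<zeta>\<in>lie_algebra G. B \<xi> \<zeta> = 0) \<longrightarrow> \<xi> = 0) \<and>
       (\<forall>a\<in>carrier G. \<forall>\<xi>\<in>lie_algebra G. \<forall>\<zeta>\<in>lie_algebra G. B (Ad G a \<xi>) (Ad G a \<zeta>) = B \<xi> \<zeta>)"

text \<open>
  The Maurer-Cartan forms, with values in the Lie algebra: a tangent vector at \<open>g\<close> is sent to the
  unique \<open>\<xi>\<close> whose left-invariant (right-invariant) vector field takes that value at \<open>g\<close>.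
\<close>

definition MC_left ::
    "('g::topological_space, 'e::real_normed_vector) lie_data \<Rightarrow> ('g, 'g tvec) vform"
  where
    "MC_left G = (\<lambda>Xs g. case Xs of
       [X] \<Rightarrow> if X \<in> vector_fields (charts G)
              then THE \<xi>. \<xi> \<in> lie_algebra G \<and> left_field G \<xi> g = X g else 0
     | _ \<Rightarrow> 0)"

definition MC_right ::
    "('g::topological_space, 'e::real_normed_vector) lie_data \<Rightarrow> ('g, 'g tvec) vform"
  where
    "MC_right G = (\<lambda>Xs g. case Xs of
       [X] \<Rightarrow> if X \<in> vector_fields (charts G)
              then THE \<xi>. \<xi> \<in> lie_algebra G \<and> right_field G \<xi> g = X g else 0
     | _ \<Rightarrow> 0)"

definition eta_form ::
    "('g::topological_space, 'e::real_normed_vector) lie_data \<Rightarrow>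
     ('g tvec \<Rightarrow> 'g tvec \<Rightarrow> real) \<Rightarrow> 'g form"
  where
    "eta_form G B = (1 / 12) *\<^sub>R
       wedge_with B (MC_left G) (wedge_with (lie_bracket G) (MC_left G) (MC_left G))"


section \<open>The double and the map \<open>s\<close>\<close>

definition double_algebra ::
    "('g::topological_space, 'e::real_normed_vector) lie_data \<Rightarrow> ('g tvec \<times> 'g tvec) set"
  where "double_algebra G = lie_algebra G \<times> lie_algebra G"

definition double_bracket ::
    "('g::topological_space, 'e::real_normed_vector) lie_data \<Rightarrow>
     'g tvec \<times> 'g tvec \<Rightarrow> 'g tvec \<times> 'g tvec \<Rightarrow> 'g tvec \<times> 'g tvec"
  where "double_bracket G = (\<lambda>(\<xi>, \<xi>') (\<zeta>, \<zeta>'). (lie_bracket G \<xi> \<zeta>, lie_bracket G \<xi>' \<zeta>'))"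

definition double_form ::
    "('g tvec \<Rightarrow> 'g tvec \<Rightarrow> real) \<Rightarrow> 'g tvec \<times> 'g tvec \<Rightarrow> 'g tvec \<times> 'g tvec \<Rightarrow> real"
  where "double_form B = (\<lambda>(\<xi>, \<xi>') (\<zeta>, \<zeta>'). B \<xi> \<zeta> - B \<xi>' \<zeta>')"

definition double_Ad ::
    "('g::topological_space, 'e::real_normed_vector) lie_data \<Rightarrow> 'g \<times> 'g \<Rightarrow>
     'g tvec \<times> 'g tvec \<Rightarrow> 'g tvec \<times> 'g tvec"
  where "double_Ad G = (\<lambda>(a, a'). map_prod (Ad G a) (Ad G a'))"

definition double_act :: "('g, 'e) lie_data \<Rightarrow> 'g \<times> 'g \<Rightarrow> 'g \<Rightarrow> 'g"
  where "double_act G = (\<lambda>(a, a') g. a' \<otimes>\<^bsub>G\<^esub> g \<otimes>\<^bsub>G\<^esub> inv\<^bsub>G\<^esub> a)"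

definition s_left ::
    "('g::topological_space, 'e::real_normed_vector) lie_data \<Rightarrow>
     ('g tvec \<Rightarrow> 'g tvec \<Rightarrow> real) \<Rightarrow> 'g tvec \<Rightarrow> 'g gsection"
  where "s_left G B \<xi> = (left_field G \<xi>, \<lambda>Xs g. 1 / 2 * B (MC_left G Xs g) \<xi>)"

definition s_right ::
    "('g::topological_space, 'e::real_normed_vector) lie_data \<Rightarrow>
     ('g tvec \<Rightarrow> 'g tvec \<Rightarrow> real) \<Rightarrow> 'g tvec \<Rightarrow> 'g gsection"
  where "s_right G B \<xi> = (- right_field G \<xi>, \<lambda>Xs g. 1 / 2 * B (MC_right G Xs g) \<xi>)"

definition s_map ::
    "('g::topological_space, 'e::real_normed_vector) lie_data \<Rightarrow>
     ('g tvec \<Rightarrow> 'g tvec \<Rightarrow> real) \<Rightarrow> 'g tvec \<times> 'g tvec \<Rightarrow> 'g gsection"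
  where "s_map G B = (\<lambda>(\<xi>, \<xi>'). s_left G B \<xi> + s_right G B \<xi>')"

end

theory Submission
  imports Defs
begin

text \<open>
  The commutator \<open>[[d + \<eta>, \<rho>(v, \<alpha>)], \<rho>(w, \<beta>)]\<close> is computed by Cartan calculus to be the Clifford action of
  \<open>([v, w], L\<^sub>v \<beta> - \<iota>\<^sub>w d\<alpha> - \<iota>\<^sub>w \<iota>\<^sub>v \<eta>)\<close>, and a section is determined by its Clifford action on the constant
  form \<open>1\<close> and on differentials.  The form component is \<open>C\<^sup>\<infinity>\<close>-linear in its argument, so it suffices to
  evaluate it on invariant vector fields, where everything reduces to \<open>[\<xi>\<^sup>L, \<zeta>\<^sup>L] = [\<xi>, \<zeta>]\<^sup>L\<close>,
  \<open>[\<xi>\<^sup>R, \<zeta>\<^sup>R] = - [\<xi>, \<zeta>]\<^sup>R\<close>, \<open>[\<xi>\<^sup>L, \<zeta>\<^sup>R] = 0\<close> and the invariance of \<open>B\<close>.  The mixed case in one order follows from the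
  other one, because the symmetric part of the bracket is the differential of the pairing.

  Since tangent vectors are derivations of the global smooth functions, invariant vector fields are
  smooth by Hadamard's lemma, and left- and right-invariant ones commute by the symmetry of second
  derivatives.
\<close>

section \<open>Finite-dimensional inner product spaces: orthonormal bases and compact balls\<close>

section \<open>Smooth functions on open sets\<close>

text \<open>Vector fields and forms are global objects here: tangent vectors act on globally smooth
  functions, and forms on lists of global vector fields. Local information has to be made global
  each time. On a manifold this is done with bump functions supported in compact coordinate balls,
  which are closed because the space is Hausdorff. On the group the invariant fields are a global
  frame, which replaces the evaluation of forms at points.

  The normalisations of \<eta> and s fit together on invariant fields: there \<eta> takes the values
  c B \<xi> [\<zeta>, \<kappa>] with the same c (1/2 on the left, -1/2 on the right) as the values
  of the one-forms on the fields. So \<eta> cancels one of the two bracket terms, and the other one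
  is the one-form of [\<xi>, \<zeta>]. In the mixed case \<theta> is not constant on the fields of
  the other kind; its derivative along a left field is again a bracket, and one such derivative
  cancels against \<eta>.

  The bracket and \<Upsilon> are definite descriptions, so every value requires existence and
  uniqueness.\<close>

definition findim :: "'a::real_inner itself \<Rightarrow> bool"
  where "findim _ \<longleftrightarrow> (\<exists>E::'a set. finite E \<and> span E = UNIV)"

text \<open>Completeness is the expansion formula, in the form in which it is applied; it covers
  dimension 0, where E is empty.\<close>

definition onb :: "'a::real_inner set \<Rightarrow> bool"
  where "onb E \<longleftrightarrow> finite E \<and> (\<forall>b\<in>E. \<forall>c\<in>E. b \<bullet> c = (if b = c then 1 else 0)) \<and>
    (\<forall>x. (\<Sum>b\<in>E. (x \<bullet> b) *\<^sub>R b) = x)"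

lemma onbD:
  assumes "onb E"
  shows "finite E" "b \<in> E \<Longrightarrow> c \<in> E \<Longrightarrow> b \<bullet> c = (if b = c then 1 else 0)"
    "(\<Sum>b\<in>E. (y \<bullet> b) *\<^sub>R b) = y"
  using assms unfolding onb_def by blast+

text \<open>Gram-Schmidt (\<open>basis_orthogonal\<close>) gives an orthogonal spanning set;
  omitting 0 and normalising makes it orthonormal. The vectors with the expansion property form a
  subspace that contains this set, so they are all vectors.\<close>

lemma findim_onb:
  assumes "findim TYPE('a::real_inner)"
  obtains E :: "'a::real_inner set" where "onb E"
proof -
  obtain S :: "'a set" where S: "finite S" "span S = UNIV"
    using assms unfolding findim_def by auto
  obtain C where C: "finite C" "span C = span S" "pairwise orthogonal C"
    using basis_orthogonal[OF S(1)] by blast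
  define E where "E = (\<lambda>x. x /\<^sub>R norm x) ` (C - {0})"
  have fin: "finite E" unfolding E_def using C by auto
  have on: "b \<bullet> c = (if b = c then 1 else 0)" if "b \<in> E" "c \<in> E" for b c
  proof -
    obtain b' where b': "b' \<in> C" "b' \<noteq> 0" "b = b' /\<^sub>R norm b'"
      using \<open>b \<in> E\<close> unfolding E_def by blast
    obtain c' where c': "c' \<in> C" "c' \<noteq> 0" "c = c' /\<^sub>R norm c'"
      using \<open>c \<in> E\<close> unfolding E_def by blast
    note bc = b' c'
    have "b \<bullet> c = 0" if "b' \<noteq> c'"
      using C(3) that bc unfolding pairwise_def orthogonal_def by auto
    moreover have "b \<bullet> b = 1"
      using bc by (simp add: power2_norm_eq_inner[symmetric] power2_eq_square)
    ultimately show ?thesis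
      using bc by (cases "b' = c'") (metis, metis zero_neq_one)
  qed
  let ?S = "{x. (\<Sum>b\<in>E. (x \<bullet> b) *\<^sub>R b) = x}"
  have "subspace ?S"
    unfolding subspace_def
    by (auto simp: inner_add_left scaleR_add_left sum.distrib scaleR_sum_right[symmetric]
        scaleR_scaleR[symmetric] simp del: scaleR_scaleR)
  moreover have "C \<subseteq> ?S"
  proof
    fix c assume c: "c \<in> C"
    show "c \<in> ?S"
    proof (cases "c = 0")
      case False
      let ?b = "c /\<^sub>R norm c"
      have b: "?b \<in> E" unfolding E_def using c False by auto
      have ce: "c = norm c *\<^sub>R ?b" using False by simp
      have "(\<Sum>b\<in>E. (c \<bullet> b) *\<^sub>R b) = (\<Sum>b\<in>E. if b = ?b then norm c *\<^sub>R b else 0)"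
      proof (rule sum.cong[OF refl])
        fix b assume "b \<in> E"
        have "c \<bullet> b = (norm c *\<^sub>R ?b) \<bullet> b" using ce by simp
        also have "\<dots> = norm c * (?b \<bullet> b)" by (rule inner_scaleR_left)
        finally have "c \<bullet> b = norm c * (?b \<bullet> b)" .
        then show "(c \<bullet> b) *\<^sub>R b = (if b = ?b then norm c *\<^sub>R b else 0)"
          using on[OF b \<open>b \<in> E\<close>]
          by (cases "b = ?b") (metis mult.right_neutral, metis mult_zero_right scaleR_zero_left)
      qed
      also have "\<dots> = c" using b fin ce by (simp add: sum.delta)
      finally show ?thesis by simp
    qed simp
  qed
  ultimately have "span C \<subseteq> ?S" by (rule span_minimal[rotated])
  then have "onb E" unfolding onb_def using fin on C(2) S(2) by auto
  then show ?thesis using that by blast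
qed

lemma findim_real: "findim TYPE(real)"
  unfolding findim_def
proof (intro exI conjI)
  show "span {1::real} = UNIV" by (simp add: span_singleton)
qed simp

lemma findim_prod:
  assumes "findim TYPE('a::real_inner)" "findim TYPE('b::real_inner)"
  shows "findim TYPE('a \<times> 'b)"
proof -
  obtain S :: "'a set" where S: "finite S" "span S = UNIV"
    using assms unfolding findim_def by auto
  obtain T :: "'b set" where T: "finite T" "span T = UNIV"
    using assms unfolding findim_def by auto
  let ?f = "\<lambda>x::'a. (x, 0::'b)" and ?g = "\<lambda>y::'b. (0::'a, y)"
  have f: "linear ?f" and g: "linear ?g" by (auto intro!: linearI)
  have "(x, y) \<in> span (?f ` S \<union> ?g ` T)" for x y
  proof -
    have "?f x \<in> span (?f ` S)" using linear_span_image[OF f, of S] S by auto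
    moreover have "?g y \<in> span (?g ` T)" using linear_span_image[OF g, of T] T by auto
    ultimately have "?f x + ?g y \<in> span (?f ` S \<union> ?g ` T)"
      using span_mono[of "?f ` S" "?f ` S \<union> ?g ` T"] span_mono[of "?g ` T" "?f ` S \<union> ?g ` T"]
      by (intro span_add) auto
    then show ?thesis by simp
  qed
  then have "span (?f ` S \<union> ?g ` T) = UNIV" by auto
  then show ?thesis unfolding findim_def using S T by (intro exI[of _ "?f ` S \<union> ?g ` T"]) auto
qed

lemma onb_inner_le:
  assumes "onb E" "b \<in> E"
  shows "\<bar>x \<bullet> b\<bar> \<le> norm x"
  using Cauchy_Schwarz_ineq2[of x b] onbD(2)[OF assms assms(2)]
  by (simp add: norm_eq_sqrt_inner[of b])

text \<open>In orthonormal coordinates a box is a finite sum of compact segments, hence compact by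
  induction on the basis. A closed ball is a closed subset of such a box.\<close>

lemma compact_cball_findim:
  assumes "findim TYPE('a::real_inner)"
  shows "compact (cball (a::'a) r)"
proof -
  obtain E :: "'a set" where E: "onb E" using findim_onb[OF assms] .
  have box: "compact {x. \<exists>c. (\<forall>b\<in>F. c b \<in> {-R..R}) \<and> x = (\<Sum>b\<in>F. c b *\<^sub>R b)}"
    if "finite F" for F :: "'a set" and R
    using that
  proof (induction F rule: finite_induct)
    case empty
    then show ?case by simp
  next
    case (insert e F)
    let ?K = "{x. \<exists>c. (\<forall>b\<in>F. c b \<in> {-R..R}) \<and> x = (\<Sum>b\<in>F. c b *\<^sub>R b)}"
    let ?L = "(\<lambda>t. t *\<^sub>R e) ` {-R..R}"
    have "compact ?L" by (intro compact_continuous_image continuous_intros) auto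
    then have "compact {x + y | x y. x \<in> ?L \<and> y \<in> ?K}"
      by (intro compact_sums insert.IH)
    also have "{x + y | x y. x \<in> ?L \<and> y \<in> ?K} =
      {x. \<exists>c. (\<forall>b\<in>insert e F. c b \<in> {-R..R}) \<and> x = (\<Sum>b\<in>insert e F. c b *\<^sub>R b)}"
      (is "?A = ?B")
    proof (intro equalityI subsetI)
      fix z assume "z \<in> ?A"
      then obtain t c where tc: "t \<in> {-R..R}" "\<forall>b\<in>F. c b \<in> {-R..R}" "z = t *\<^sub>R e + (\<Sum>b\<in>F. c b *\<^sub>R b)"
        by blast
      have "(\<Sum>b\<in>F. (c(e:=t)) b *\<^sub>R b) = (\<Sum>b\<in>F. c b *\<^sub>R b)"
        using insert.hyps by (intro sum.cong) auto
      then show "z \<in> ?B" using tc insert.hyps by (intro CollectI exI[of _ "c(e:=t)"]) auto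
    next
      fix z assume "z \<in> ?B"
      then obtain c where c: "\<forall>b\<in>insert e F. c b \<in> {-R..R}" "z = (\<Sum>b\<in>insert e F. c b *\<^sub>R b)" by blast
      have "z = c e *\<^sub>R e + (\<Sum>b\<in>F. c b *\<^sub>R b)" using c insert.hyps by simp
      then show "z \<in> ?A" using c(1) by blast
    qed
    finally show ?case .
  qed
  \<comment> \<open>Points of the ball have norm at most R, and coordinates in an orthonormal basis
    are bounded by the norm.\<close>
  define R where "R = norm a + \<bar>r\<bar>"
  have sub: "cball a r \<subseteq> {x. \<exists>c. (\<forall>b\<in>E. c b \<in> {-R..R}) \<and> x = (\<Sum>b\<in>E. c b *\<^sub>R b)}"
  proof
    fix x assume "x \<in> cball a r"
    then have "norm x \<le> R" unfolding R_def using norm_triangle_sub[of x a]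
      by (auto simp: dist_norm norm_minus_commute)
    then have "x \<bullet> b \<in> {-R..R}" if "b \<in> E" for b
      using onb_inner_le[OF E that, of x] by auto
    then show "x \<in> {x. \<exists>c. (\<forall>b\<in>E. c b \<in> {-R..R}) \<and> x = (\<Sum>b\<in>E. c b *\<^sub>R b)}"
      using onbD(3)[OF E, of x] by (intro CollectI exI[of _ "\<lambda>b. x \<bullet> b"]) auto
  qed
  have "cball a r = {x. \<exists>c. (\<forall>b\<in>E. c b \<in> {-R..R}) \<and> x = (\<Sum>b\<in>E. c b *\<^sub>R b)} \<inter> cball a r"
    using sub by blast
  then show ?thesis
    using compact_Int_closed[OF box[OF onbD(1)[OF E], of R] closed_cball[of a r]] by simp
qed

section \<open>Functions of class C^k: local nature and closure properties\<close>

lemma Ck_on_cong: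
  assumes "open S" "\<And>x. x \<in> S \<Longrightarrow> f x = g x"
  shows "Ck_on k f S \<longleftrightarrow> Ck_on k g S"
  using assms(2)
proof (induction k arbitrary: f g)
  case 0
  then show ?case by (simp cong: continuous_on_cong)
next
  case (Suc k)
  have hd: "(f has_derivative D) (at x) \<longleftrightarrow> (g has_derivative D) (at x)" if "x \<in> S" for x D
    using has_derivative_transform_within_open[of f D x UNIV S g]
      has_derivative_transform_within_open[of g D x UNIV S f] that assms(1) Suc.prems by auto
  then have "frechet_derivative f (at x) = frechet_derivative g (at x)" if "x \<in> S" for x
    using that unfolding frechet_derivative_def by simp
  then have "Ck_on k (\<lambda>x. frechet_derivative f (at x) v) S \<longleftrightarrow>
     Ck_on k (\<lambda>x. frechet_derivative g (at x) v) S" for v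
    by (intro Suc.IH) simp
  moreover have "(\<forall>x\<in>S. f differentiable at x) \<longleftrightarrow> (\<forall>x\<in>S. g differentiable at x)"
    using hd unfolding differentiable_def by blast
  ultimately show ?case by simp
qed

lemma Ck_on_subset: "Ck_on k f S \<Longrightarrow> T \<subseteq> S \<Longrightarrow> Ck_on k f T"
  by (induction k arbitrary: f) (auto intro: continuous_on_subset)

lemma Ck_on_local:
  assumes "\<And>x. x \<in> S \<Longrightarrow> \<exists>T. open T \<and> x \<in> T \<and> Ck_on k f T"
  shows "Ck_on k f S"
  using assms
proof (induction k arbitrary: f)
  case 0
  then show ?case
    by (metis Ck_on.simps(1) continuous_at_imp_continuous_on continuous_on_eq_continuous_at)
next
  case (Suc k)
  show ?case unfolding Ck_on.simps
  proof (intro conjI ballI allI)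
    fix x assume "x \<in> S"
    then show "f differentiable at x" using Suc.prems[of x] by auto
  next
    fix v
    show "Ck_on k (\<lambda>x. frechet_derivative f (at x) v) S"
      by (rule Suc.IH) (use Suc.prems in fastforce)
  qed
qed

text \<open>The closure lemmas below know a derivative in closed form; uniqueness of derivatives on
  an open set lets it stand for \<open>frechet_derivative\<close>.\<close>

lemma Ck_on_SucI:
  assumes "open S" "\<And>x. x \<in> S \<Longrightarrow> (f has_derivative f' x) (at x)"
    "\<And>v. Ck_on k (\<lambda>x. f' x v) S"
  shows "Ck_on (Suc k) f S"
proof -
  have "f' x = frechet_derivative f (at x)" if "x \<in> S" for x
    using frechet_derivative_at assms(2) that by blast
  then have "Ck_on k (\<lambda>x. frechet_derivative f (at x) v) S" for v
    using assms(3)[of v] Ck_on_cong[OF assms(1), of "\<lambda>x. f' x v"] by auto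
  then show ?thesis using assms(2) by (auto intro: differentiableI)
qed

lemma Ck_on_SucD:
  assumes "Ck_on (Suc k) f S"
  shows "x \<in> S \<Longrightarrow> (f has_derivative frechet_derivative f (at x)) (at x)"
    "Ck_on k (\<lambda>x. frechet_derivative f (at x) v) S"
  using assms frechet_derivative_works by auto

text \<open>\<open>Ck_on (Suc k)\<close> does not mention continuity of f itself, so the base case
  takes it from differentiability; for larger k the claim passes to the partial derivatives.\<close>

lemma Ck_on_Suc_imp: "Ck_on (Suc k) f S \<Longrightarrow> Ck_on k f S"
proof (induction k arbitrary: f)
  case 0
  then show ?case
    by (auto intro!: continuous_at_imp_continuous_on differentiable_imp_continuous_within)
next
  case (Suc k)
  from Suc.prems have "f differentiable at x" if "x \<in> S" for x using that by simp
  moreover have "Ck_on k (\<lambda>x. frechet_derivative f (at x) v) S" for v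
    by (rule Suc.IH) (use Ck_on_SucD(2)[OF Suc.prems] in blast)
  ultimately show ?case by simp
qed

lemma Ck_on_const: "open S \<Longrightarrow> Ck_on k (\<lambda>x. c) S"
proof (induction k arbitrary: c)
  case (Suc k)
  show ?case by (rule Ck_on_SucI[where f'="\<lambda>x v. 0"]) (use Suc in auto)
qed simp

lemma Ck_on_bounded_linear:
  assumes "open S" "bounded_linear T"
  shows "Ck_on k T S"
proof (cases k)
  case 0
  then show ?thesis using assms by (simp add: linear_continuous_on)
next
  case (Suc j)
  show ?thesis unfolding Suc
    by (rule Ck_on_SucI[where f'="\<lambda>x. T"])
      (use assms bounded_linear_imp_has_derivative Ck_on_const in auto)
qed

lemma Ck_on_compose_linear:
  assumes "open S" "bounded_linear T" "Ck_on k f S"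
  shows "Ck_on k (\<lambda>x. T (f x)) S"
  using assms(3)
proof (induction k arbitrary: f)
  case 0
  then show ?case using assms(2)
    by (auto intro: bounded_linear.continuous_on)
next
  case (Suc k)
  show ?case
    by (rule Ck_on_SucI[where f'="\<lambda>x v. T (frechet_derivative f (at x) v)", OF assms(1)])
      (use Ck_on_SucD[OF Suc.prems] Suc.IH in \<open>auto intro!: bounded_linear.has_derivative[OF assms(2)]\<close>)
qed

lemma Ck_on_add:
  assumes "open S" "Ck_on k f S" "Ck_on k g S"
  shows "Ck_on k (\<lambda>x. f x + g x) S"
  using assms(2,3)
proof (induction k arbitrary: f g)
  case 0
  then show ?case by (auto intro: continuous_on_add)
next
  case (Suc k)
  show ?case
    by (rule Ck_on_SucI[where f'="\<lambda>x v. frechet_derivative f (at x) v + frechet_derivative g (at x) v",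
          OF assms(1)])
      (use Ck_on_SucD[OF Suc.prems(1)] Ck_on_SucD[OF Suc.prems(2)] Suc.IH in \<open>auto intro!: has_derivative_add\<close>)
qed

lemma Ck_on_sum:
  assumes "open S" "\<And>i. i \<in> I \<Longrightarrow> Ck_on k (f i) S"
  shows "Ck_on k (\<lambda>x. \<Sum>i\<in>I. f i x) S"
  using assms(2)
  by (induction I rule: infinite_finite_induct) (auto intro: Ck_on_add Ck_on_const assms(1))

lemma Ck_on_bilinear:
  assumes "open S" "bounded_bilinear m" "Ck_on k f S" "Ck_on k g S"
  shows "Ck_on k (\<lambda>x. m (f x) (g x)) S"
  using assms(3,4)
proof (induction k arbitrary: f g)
  case 0
  then show ?case using bounded_bilinear.continuous_on[OF assms(2)] by auto
next
  case (Suc k)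
  note D = Ck_on_SucD[OF Suc.prems(1)] Ck_on_SucD[OF Suc.prems(2)]
  show ?case
  proof (rule Ck_on_SucI[OF assms(1)])
    show "((\<lambda>x. m (f x) (g x)) has_derivative
      (\<lambda>v. m (f x) (frechet_derivative g (at x) v) + m (frechet_derivative f (at x) v) (g x))) (at x)"
      if "x \<in> S" for x
      by (rule bounded_bilinear.FDERIV[OF assms(2) D(1)[OF that] D(3)[OF that]])
    show "Ck_on k (\<lambda>x. m (f x) (frechet_derivative g (at x) v) + m (frechet_derivative f (at x) v) (g x)) S"
      for v
      using Ck_on_Suc_imp[OF Suc.prems(1)] Ck_on_Suc_imp[OF Suc.prems(2)] D(2,4)
      by (simp add: Ck_on_add[OF assms(1)] Suc.IH)
  qed
qed

lemma Ck_on_Pair: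
  assumes "open S" "Ck_on k f S" "Ck_on k g S"
  shows "Ck_on k (\<lambda>x. (f x, g x)) S"
  using assms(2,3)
proof (induction k arbitrary: f g)
  case 0
  then show ?case by (auto intro: continuous_on_Pair)
next
  case (Suc k)
  show ?case
    by (rule Ck_on_SucI[where f'="\<lambda>x v. (frechet_derivative f (at x) v, frechet_derivative g (at x) v)",
          OF assms(1)])
      (use Ck_on_SucD[OF Suc.prems(1)] Ck_on_SucD[OF Suc.prems(2)] Suc.IH in \<open>auto intro!: has_derivative_Pair\<close>)
qed

text \<open>In the chain rule the direction in which g is differentiated moves with x. Expanding it
  in an orthonormal basis leaves finitely many derivatives of g in fixed directions b, composed with
  f, to which the induction hypothesis applies.\<close>

lemma Ck_on_compose:
  fixes f :: "'a::real_normed_vector \<Rightarrow> 'b::real_inner" and g :: "'b \<Rightarrow> 'c::real_normed_vector"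
  assumes fd: "findim TYPE('b)" and op: "open S" and "f ` S \<subseteq> T"
    and "Ck_on k f S" "Ck_on k g T"
  shows "Ck_on k (\<lambda>x. g (f x)) S"
  using assms(3-)
proof (induction k arbitrary: f g)
  case 0
  then show ?case using continuous_on_compose2 by auto
next
  case (Suc k)
  obtain E :: "'b set" where E: "onb E" using findim_onb[OF fd] .
  note D = Ck_on_SucD[OF Suc.prems(2)] Ck_on_SucD[OF Suc.prems(3)]
  let ?f = "\<lambda>x. frechet_derivative f (at x)" and ?g = "\<lambda>x. frechet_derivative g (at x)"
  show ?case
  proof (rule Ck_on_SucI[OF op])
    show "((\<lambda>x. g (f x)) has_derivative (\<lambda>v. \<Sum>b\<in>E. (?f x v \<bullet> b) *\<^sub>R ?g (f x) b)) (at x)"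
      if x: "x \<in> S" for x
    proof -
      have g: "(g has_derivative ?g (f x)) (at (f x))" using D x Suc.prems(1) by auto
      then have lin: "linear (?g (f x))" by (simp add: has_derivative_linear)
      have eq: "?g (f x) w = (\<Sum>b\<in>E. (w \<bullet> b) *\<^sub>R ?g (f x) b)" for w
        by (subst onbD(3)[OF E, of w, symmetric]) (simp add: linear_sum[OF lin] linear_scale[OF lin])
      have "(\<lambda>v. ?g (f x) (?f x v)) = (\<lambda>v. \<Sum>b\<in>E. (?f x v \<bullet> b) *\<^sub>R ?g (f x) b)"
        by (rule ext) (rule eq)
      with has_derivative_compose[OF D(1)[OF x] g] show ?thesis by argo
    qed
    have "Ck_on k f S" using Ck_on_Suc_imp Suc.prems by blast
    then have "Ck_on k (\<lambda>x. ?g (f x) b) S" for b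
      by (intro Suc.IH[where g="\<lambda>y. ?g y b"] Suc.prems(1) D)
    then show "Ck_on k (\<lambda>x. \<Sum>b\<in>E. (?f x v \<bullet> b) *\<^sub>R ?g (f x) b) S" for v
      by (intro Ck_on_sum op Ck_on_bilinear[OF op bounded_bilinear_scaleR]
          Ck_on_compose_linear[OF op bounded_linear_inner_left] D)
  qed
qed

lemma smooth_on_cong:
  "open S \<Longrightarrow> (\<And>x. x \<in> S \<Longrightarrow> f x = g x) \<Longrightarrow> smooth_on f S \<longleftrightarrow> smooth_on g S"
  unfolding smooth_on_def using Ck_on_cong[of S f g] by auto

lemma smooth_on_subset: "smooth_on f S \<Longrightarrow> T \<subseteq> S \<Longrightarrow> smooth_on f T"
  unfolding smooth_on_def by (auto intro: Ck_on_subset)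

lemma smooth_on_local:
  "(\<And>x. x \<in> S \<Longrightarrow> \<exists>T. open T \<and> x \<in> T \<and> smooth_on f T) \<Longrightarrow> smooth_on f S"
  unfolding smooth_on_def by (intro allI Ck_on_local) blast

lemma smooth_on_const: "open S \<Longrightarrow> smooth_on (\<lambda>x. c) S"
  unfolding smooth_on_def using Ck_on_const by blast

lemma smooth_on_linear: "open S \<Longrightarrow> bounded_linear T \<Longrightarrow> smooth_on T S"
  unfolding smooth_on_def using Ck_on_bounded_linear by blast

lemma smooth_on_id: "open S \<Longrightarrow> smooth_on (\<lambda>x. x) S"
  by (intro smooth_on_linear bounded_linear_ident)

lemma smooth_on_add: "open S \<Longrightarrow> smooth_on f S \<Longrightarrow> smooth_on g S \<Longrightarrow> smooth_on (\<lambda>x. f x + g x) S"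
  unfolding smooth_on_def by (simp add: Ck_on_add)

lemma smooth_on_sum:
  "open S \<Longrightarrow> (\<And>i. i \<in> I \<Longrightarrow> smooth_on (f i) S) \<Longrightarrow> smooth_on (\<lambda>x. \<Sum>i\<in>I. f i x) S"
  unfolding smooth_on_def by (auto intro: Ck_on_sum)

lemma smooth_on_bilinear:
  assumes "open S" "bounded_bilinear m" "smooth_on f S" "smooth_on g S"
  shows "smooth_on (\<lambda>x. m (f x) (g x)) S"
  using Ck_on_bilinear[OF assms(1,2)] assms(3,4) unfolding smooth_on_def by simp

lemmas smooth_on_mult = smooth_on_bilinear[OF _ bounded_bilinear_mult]

lemma smooth_on_Pair:
  "open S \<Longrightarrow> smooth_on f S \<Longrightarrow> smooth_on g S \<Longrightarrow> smooth_on (\<lambda>x. (f x, g x)) S"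
  unfolding smooth_on_def by (simp add: Ck_on_Pair)

lemma smooth_on_compose:
  fixes f :: "'a::real_normed_vector \<Rightarrow> 'b::real_inner" and g :: "'b \<Rightarrow> 'c::real_normed_vector"
  assumes "findim TYPE('b)" "open S" "f ` S \<subseteq> T" "smooth_on f S" "smooth_on g T"
  shows "smooth_on (\<lambda>x. g (f x)) S"
  using assms(4,5) unfolding smooth_on_def by (auto intro: Ck_on_compose[OF assms(1-3)])

lemma smooth_on_diff:
  "open S \<Longrightarrow> smooth_on f S \<Longrightarrow> smooth_on g S \<Longrightarrow> smooth_on (\<lambda>x. f x - g x) S"
  using smooth_on_add[of S f "\<lambda>x. - g x"]
    Ck_on_compose_linear[OF _ bounded_linear_minus[OF bounded_linear_ident], of S _ g]
  by (simp add: smooth_on_def)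

lemma smooth_on_imp_continuous: "smooth_on f S \<Longrightarrow> continuous_on S f"
  unfolding smooth_on_def using Ck_on.simps(1) by blast

lemma smooth_on_has_derivative:
  "smooth_on f S \<Longrightarrow> x \<in> S \<Longrightarrow> (f has_derivative frechet_derivative f (at x)) (at x)"
  unfolding smooth_on_def by (rule Ck_on_SucD(1)[of 0]) auto

lemma smooth_on_derivative:
  "smooth_on f S \<Longrightarrow> smooth_on (\<lambda>x. frechet_derivative f (at x) v) S"
  unfolding smooth_on_def by (auto intro: Ck_on_SucD(2))


subsection \<open>Bump functions\<close>

text \<open>The powers of 1/x make the family closed under differentiation up to linear
  combinations, so that smoothness becomes an induction. The bump function is built from the case n
  = 0.\<close>

definition flat :: "nat \<Rightarrow> real \<Rightarrow> real"
  where "flat n x = (if x > 0 then exp (- (1 / x)) / x ^ n else 0)"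

lemma flat_tendsto_0: "(flat n \<longlongrightarrow> 0) (at 0)"
proof -
  have "((\<lambda>x. (inverse x) ^ n / exp (inverse x)) \<longlongrightarrow> 0) (at_right (0::real))"
    by (rule filterlim_compose[OF tendsto_power_div_exp_0 filterlim_inverse_at_top_right])
  then have "(flat n \<longlongrightarrow> 0) (at_right 0)"
    by (rule Lim_transform_eventually)
      (auto simp: eventually_at_filter flat_def exp_minus field_simps)
  moreover have "(flat n \<longlongrightarrow> 0) (at_left 0)"
    by (rule tendsto_eventually) (auto simp: eventually_at_filter flat_def)
  ultimately show ?thesis by (simp add: filterlim_split_at)
qed

lemma DERIV_flat: "(flat n has_real_derivative (flat (n + 2) x - n * flat (n + 1) x)) (at x)"
proof (cases "x = 0")
  case True
  \<comment> \<open>The difference quotient of \<open>flat n\<close> at 0 is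
    \<open>flat (Suc n)\<close>.\<close>
  have "((\<lambda>y. (flat n y - flat n 0) / (y - 0)) \<longlongrightarrow> 0) (at 0)"
    by (rule Lim_transform_eventually[OF flat_tendsto_0[of "Suc n"]])
      (auto simp: eventually_at_filter flat_def)
  then show ?thesis using True by (simp add: has_field_derivative_iff flat_def)
next
  case False
  show ?thesis
  proof (cases "x > 0")
    case True
    have "((\<lambda>x. exp (- (1 / x)) / x ^ n) has_real_derivative
       (exp (- (1 / x)) * (1 / x\<^sup>2) * x ^ n - exp (- (1 / x)) * (n * x ^ (n - 1))) / (x ^ n * x ^ n)) (at x)"
      using True by (auto intro!: derivative_eq_intros simp: power2_eq_square)
    moreover have "(exp (- (1 / x)) * (1 / x\<^sup>2) * x ^ n - exp (- (1 / x)) * (n * x ^ (n - 1))) / (x ^ n * x ^ n)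
       = flat (n + 2) x - n * flat (n + 1) x"
      using True by (cases n) (auto simp: flat_def field_simps power2_eq_square)
    ultimately show ?thesis
      using has_field_derivative_transform_within_open[of "\<lambda>x. exp (- (1 / x)) / x ^ n" _ x "{0<..}" "flat n"]
        True by (auto simp: flat_def)
  next
    case False
    then have "x < 0" using \<open>x \<noteq> 0\<close> by simp
    then show ?thesis
      using has_field_derivative_transform_within_open[of "\<lambda>x. 0" 0 x "{..<0}" "flat n"]
      by (auto simp: flat_def)
  qed
qed

lemma smooth_on_flat: "smooth_on (flat n) UNIV"
proof -
  have "Ck_on k (flat n) UNIV" for k n
  proof (induction k arbitrary: n)
    case 0
    then show ?case
      using DERIV_flat by (auto intro!: continuous_at_imp_continuous_on DERIV_isCont)
  next
    case (Suc k)
    show ?case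
    proof (rule Ck_on_SucI[where f'="\<lambda>x v. (flat (n + 2) x + (- real n) * flat (n + 1) x) * v"])
      show "(flat n has_derivative (\<lambda>v. (flat (n + 2) x + (- real n) * flat (n + 1) x) * v)) (at x)" for x
        using DERIV_flat[of n x] by (simp add: has_field_derivative_def)
      show "Ck_on k (\<lambda>x. (flat (n + 2) x + (- real n) * flat (n + 1) x) * v) UNIV" for v
        by (intro Ck_on_bilinear[OF _ bounded_bilinear_mult] Ck_on_add Ck_on_const Suc.IH) auto
    qed simp
  qed
  then show ?thesis unfolding smooth_on_def by blast
qed

lemma flat_mono: "x \<le> y \<Longrightarrow> flat 0 x \<le> flat 0 y"
  by (auto simp: flat_def field_simps)

text \<open>The outer \<open>flat 0\<close> is constant as soon as the inner one vanishes, which makes the plateau.\<close>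

lemma bump_function:
  fixes a :: "'a::real_inner"
  assumes "r > 0"
  obtains \<rho> :: "'a \<Rightarrow> real" where "smooth_on \<rho> UNIV" "\<And>x. dist a x \<le> r \<Longrightarrow> \<rho> x = 1"
    "\<And>x. dist a x \<ge> 2 * r \<Longrightarrow> \<rho> x = 0"
proof -
  \<comment> \<open>At distance 2 r the value of \<open>s\<close> is 3 r^2. From there on the inner
    function is at least c, so the argument of the outer one is not positive; up to distance r the
    inner one is 0 and the outer one has its value at c.\<close>
  define c where "c = flat 0 (3 * r\<^sup>2)"
  define s where "s x = (x - a) \<bullet> (x - a) + (- r\<^sup>2)" for x
  define \<rho> where "\<rho> x = flat 0 (c - flat 0 (s x)) * (1 / flat 0 c)" for x
  have c: "c > 0" using assms by (simp add: c_def flat_def)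
  then have fc: "flat 0 c > 0" by (simp add: flat_def)
  have s_norm: "s x = (dist a x)\<^sup>2 - r\<^sup>2" for x
    by (simp add: s_def dist_norm norm_minus_commute[of a] power2_norm_eq_inner)
  have s: "smooth_on s UNIV" unfolding s_def
    by (intro smooth_on_add smooth_on_bilinear[OF _ bounded_bilinear_inner] smooth_on_diff
        smooth_on_id smooth_on_const) auto
  have "smooth_on (\<lambda>x. flat 0 (s x)) UNIV"
    by (rule smooth_on_compose[OF findim_real _ _ s smooth_on_flat]) auto
  then have "smooth_on (\<lambda>x. c - flat 0 (s x)) UNIV"
    by (intro smooth_on_diff smooth_on_const) auto
  then have "smooth_on (\<lambda>x. flat 0 (c - flat 0 (s x))) UNIV"
    by (rule smooth_on_compose[OF findim_real _ _ _ smooth_on_flat, rotated 2]) auto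
  then have "smooth_on \<rho> UNIV" unfolding \<rho>_def
    by (intro smooth_on_mult smooth_on_const) auto
  moreover have "\<rho> x = 1" if "dist a x \<le> r" for x
  proof -
    have "s x \<le> 0" using that power_mono[of "dist a x" r 2] by (simp add: s_norm)
    then have "flat 0 (s x) = 0" by (simp add: flat_def)
    then show ?thesis using fc by (simp add: \<rho>_def)
  qed
  moreover have "\<rho> x = 0" if "dist a x \<ge> 2 * r" for x
  proof -
    have "3 * r\<^sup>2 \<le> s x" using that power_mono[of "2 * r" "dist a x" 2] assms
      by (simp add: s_norm power_mult_distrib)
    then have "c \<le> flat 0 (s x)" unfolding c_def by (rule flat_mono)
    then show ?thesis by (simp add: \<rho>_def flat_def)
  qed
  ultimately show ?thesis using that by blast
qed


subsection \<open>Hadamard's lemma\<close>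

lemma DERIV_along_line:
  assumes "smooth_on f S" "p + s *\<^sub>R u \<in> S"
  shows "((\<lambda>s. f (p + s *\<^sub>R u)) has_real_derivative frechet_derivative f (at (p + s *\<^sub>R u)) u) (at s)"
proof -
  let ?D = "frechet_derivative f (at (p + s *\<^sub>R u))"
  have f: "(f has_derivative ?D) (at (p + s *\<^sub>R u))"
    using smooth_on_has_derivative[OF assms] .
  have "((\<lambda>s. p + s *\<^sub>R u) has_derivative (\<lambda>h. h *\<^sub>R u)) (at s)"
    by (auto intro!: derivative_eq_intros)
  from has_derivative_compose[OF this f]
  have "((\<lambda>s. f (p + s *\<^sub>R u)) has_derivative (\<lambda>h. ?D (h *\<^sub>R u))) (at s)" .
  moreover have "?D (h *\<^sub>R u) = ?D u * h" for h
    using linear_scale[OF has_derivative_linear[OF f], of h u] by simp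
  ultimately show ?thesis unfolding has_field_derivative_def by simp
qed

text \<open>On the segment from x to y the mean value theorem yields f y - f x = D z (y - x), and by
  continuity D z is close to D x on each basis vector. This promotes the one-variable Leibniz rule
  for integrals to a Frechet derivative.\<close>

lemma has_derivative_directional:
  fixes f :: "'a::real_inner \<Rightarrow> real" and E :: "'a set"
  assumes E: "onb E" and S: "open S" "convex S" and x: "x \<in> S"
    and lin: "\<And>y. y \<in> S \<Longrightarrow> linear (D y)"
    and cont: "\<And>v. continuous_on S (\<lambda>y. D y v)"
    and dir: "\<And>y v s. y + s *\<^sub>R v \<in> S \<Longrightarrow>
      ((\<lambda>s. f (y + s *\<^sub>R v)) has_real_derivative D (y + s *\<^sub>R v) v) (at s)"
  shows "(f has_derivative D x) (at x)"
  unfolding has_derivative_at_alt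
proof (intro conjI allI impI)
  have expand: "D y v = (\<Sum>b\<in>E. (v \<bullet> b) * D y b)" if "y \<in> S" for y v
  proof -
    have "D y v = D y (\<Sum>b\<in>E. (v \<bullet> b) *\<^sub>R b)" using onbD(3)[OF E] by simp
    then show ?thesis by (simp add: linear_sum[OF lin[OF that]] linear_scale[OF lin[OF that]])
  qed
  show "bounded_linear (D x)"
  proof (rule bounded_linear_intro)
    show "D x (y + z) = D x y + D x z" "D x (r *\<^sub>R y) = r *\<^sub>R D x y" for y z r
      using lin[OF x] by (auto simp: linear_add linear_scale)
    show "norm (D x v) \<le> norm v * (\<Sum>b\<in>E. \<bar>D x b\<bar>)" for v
    proof -
      have "norm (D x v) \<le> (\<Sum>b\<in>E. \<bar>(v \<bullet> b) * D x b\<bar>)"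
        using expand[OF x, of v] by (simp add: sum_abs)
      also have "\<dots> \<le> (\<Sum>b\<in>E. norm v * \<bar>D x b\<bar>)"
        by (intro sum_mono) (auto simp: abs_mult intro!: mult_right_mono onb_inner_le[OF E])
      finally show ?thesis by (simp add: sum_distrib_left)
    qed
  qed
  fix e :: real assume e: "e > 0"
  \<comment> \<open>The summand 1 keeps e' positive when the basis is empty.\<close>
  define e' where "e' = e / (card E + 1)"
  have e': "e' > 0" using e by (simp add: e'_def)
  have "\<forall>\<^sub>F y in nhds x. \<forall>b\<in>E. \<bar>D y b - D x b\<bar> < e'"
  proof (intro eventually_ball_finite onbD(1)[OF E] ballI)
    fix b
    have "isCont (\<lambda>y. D y b) x" using cont S x by (simp add: continuous_on_eq_continuous_at)
    then have "((\<lambda>y. D y b) \<longlongrightarrow> D x b) (nhds x)"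
      by (simp add: isCont_def tendsto_at_iff_tendsto_nhds[of "\<lambda>y. D y b" x])
    then show "\<forall>\<^sub>F y in nhds x. \<bar>D y b - D x b\<bar> < e'"
      using e' by (auto dest: tendstoD simp: dist_real_def)
  qed
  then obtain d1 where d1: "d1 > 0" "\<And>y b. dist y x < d1 \<Longrightarrow> b \<in> E \<Longrightarrow> \<bar>D y b - D x b\<bar> < e'"
    unfolding eventually_nhds_metric by blast
  obtain d2 where d2: "d2 > 0" "ball x d2 \<subseteq> S" using S x open_contains_ball by blast
  show "\<exists>d>0. \<forall>y. norm (y - x) < d \<longrightarrow> norm (f y - f x - D x (y - x)) \<le> e * norm (y - x)"
  proof (intro exI[of _ "min d1 d2"] conjI allI impI)
    fix y assume y: "norm (y - x) < min d1 d2"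
    define v where "v = y - x"
    have dst: "dist (x + s *\<^sub>R v) x < min d1 d2" if "0 \<le> s" "s \<le> 1" for s
    proof -
      have "dist (x + s *\<^sub>R v) x \<le> 1 * norm v"
        using that by (simp add: dist_norm mult_left_le_one_le)
      then show ?thesis using y by (simp add: v_def)
    qed
    then have inS: "x + s *\<^sub>R v \<in> S" if "0 \<le> s" "s \<le> 1" for s
      using d2 that by (force simp: dist_commute)
    obtain \<theta> where \<theta>: "0 < \<theta>" "\<theta> < 1" "f (x + 1 *\<^sub>R v) - f (x + 0 *\<^sub>R v) = (1 - 0) * D (x + \<theta> *\<^sub>R v) v"
      using MVT2[of 0 1 "\<lambda>s. f (x + s *\<^sub>R v)" "\<lambda>s. D (x + s *\<^sub>R v) v"] dir inS by auto
    let ?z = "x + \<theta> *\<^sub>R v"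
    have "f y - f x - D x (y - x) = D ?z v - D x v" using \<theta> by (simp add: v_def)
    also have "\<dots> = (\<Sum>b\<in>E. (v \<bullet> b) * (D ?z b - D x b))"
      using expand[OF x, of v] expand[OF inS[of \<theta>], of v] \<theta> by (simp add: right_diff_distrib sum_subtractf)
    also have "norm \<dots> \<le> (\<Sum>b\<in>E. norm v * e')"
    proof (intro sum_norm_le)
      fix b assume b: "b \<in> E"
      have "\<bar>D ?z b - D x b\<bar> < e'" using d1(2)[of ?z b] dst[of \<theta>] \<theta> b by auto
      then show "norm ((v \<bullet> b) * (D ?z b - D x b)) \<le> norm v * e'"
        using onb_inner_le[OF E b, of v] by (auto simp: abs_mult intro!: mult_mono)
    qed
    also have "\<dots> = (card E * e') * norm v" by simp
    also have "\<dots> \<le> e * norm v"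
      using e by (intro mult_right_mono) (auto simp: e'_def field_simps)
    finally show "norm (f y - f x - D x (y - x)) \<le> e * norm (y - x)" by (simp add: v_def)
  qed (use d1 d2 in auto)
qed

lemma ball_segment:
  fixes a :: "'a::real_normed_vector"
  assumes "x \<in> ball a r" "0 \<le> t" "t \<le> 1"
  shows "a + t *\<^sub>R (x - a) \<in> ball a r"
proof -
  have "norm (t *\<^sub>R (x - a)) \<le> 1 * norm (x - a)" using assms by (simp add: mult_left_le_one_le)
  then show ?thesis using assms by (simp add: dist_norm norm_minus_commute)
qed

lemma continuous_on_radial:
  assumes h: "continuous_on S h" and p: "continuous_on T p" "p ` T \<subseteq> S"
    and q: "continuous_on T (q::_ \<Rightarrow> real)"
  shows "continuous_on T (\<lambda>z. q z ^ n * (h (p z)::real))"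
  by (rule continuous_on_mult[OF continuous_on_power[OF q] continuous_on_compose2[OF h p]])

text \<open>Differentiating under the integral sign produces a factor t from the inner derivative.
  With the weight t^n in the statement, the derivative in direction v has the same shape, with n + 1
  and the partial derivative of F, so the induction on k closes.\<close>

lemma Ck_on_radial_integral:
  fixes F :: "'a::real_inner \<Rightarrow> real"
  assumes fd: "findim TYPE('a)" and "smooth_on F (ball a r)"
  shows "Ck_on k (\<lambda>x. integral {0..1} (\<lambda>t. t ^ n * F (a + t *\<^sub>R (x - a)))) (ball a r)"
  using assms(2)
proof (induction k arbitrary: n F)
  case 0
  have F: "continuous_on (ball a r) F" using smooth_on_imp_continuous[OF 0] .
  have "continuous_on (ball a r \<times> cbox 0 1) (\<lambda>(x, t). t ^ n * F (a + t *\<^sub>R (x - a)))"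
    unfolding split_beta
    by (rule continuous_on_radial[OF F]; (intro continuous_intros)?)
      (auto simp del: mem_ball intro: ball_segment)
  from integral_continuous_on_param[OF this] show ?case by simp
next
  case (Suc k)
  obtain E :: "'a set" where E: "onb E" using findim_onb[OF fd] .
  define G where "G v y = frechet_derivative F (at y) v" for v y
  have G: "smooth_on (G v) (ball a r)" for v
    unfolding G_def by (rule smooth_on_derivative[OF Suc.prems])
  define J where "J x v = integral {0..1} (\<lambda>t. t ^ Suc n * G v (a + t *\<^sub>R (x - a)))" for x v
  have J: "Ck_on k (\<lambda>x. J x v) (ball a r)" for v
    unfolding J_def by (rule Suc.IH[OF G])
  have contJ: "continuous_on (ball a r) (\<lambda>x. J x v)" for v
  proof (cases k)
    case 0
    then show ?thesis using J by simp
  next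
    case (Suc j)
    then show ?thesis using J[of v]
      by (auto intro!: continuous_at_imp_continuous_on differentiable_imp_continuous_within)
  qed
  have contG: "continuous_on {0..1} (\<lambda>t. t ^ m * G v (a + t *\<^sub>R (x - a)))" if "x \<in> ball a r" for x v m
    by (rule continuous_on_radial[OF smooth_on_imp_continuous[OF G]]; (intro continuous_intros)?)
      (use that in \<open>auto simp del: mem_ball intro: ball_segment\<close>)
  have contF: "continuous_on {0..1} (\<lambda>t. t ^ m * F (a + t *\<^sub>R (x - a)))" if "x \<in> ball a r" for x m
    by (rule continuous_on_radial[OF smooth_on_imp_continuous[OF Suc.prems]]; (intro continuous_intros)?)
      (use that in \<open>auto simp del: mem_ball intro: ball_segment\<close>)
  have linG: "linear (\<lambda>v. G v y)" if "y \<in> ball a r" for y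
    unfolding G_def using has_derivative_linear[OF smooth_on_has_derivative[OF Suc.prems that]] .
  show ?case
  proof (rule Ck_on_SucI[OF open_ball _ J])
    fix x assume x: "x \<in> ball a r"
    show "((\<lambda>x. integral {0..1} (\<lambda>t. t ^ n * F (a + t *\<^sub>R (x - a)))) has_derivative J x) (at x)"
    proof (rule has_derivative_directional[OF E open_ball convex_ball x _ contJ])
      fix y assume y: "y \<in> ball a r"
      note int = integrable_continuous_real[OF contG[OF y]]
      show "linear (J y)"
      proof (rule linearI)
        fix v w c
        have "J y (v + w) = integral {0..1} (\<lambda>t. t ^ Suc n * G v (a + t *\<^sub>R (y - a)) + t ^ Suc n * G w (a + t *\<^sub>R (y - a)))"
          unfolding J_def
          using linear_add[OF linG[OF ball_segment[OF y]]] by (intro integral_cong) (auto simp: distrib_left)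
        also have "\<dots> = J y v + J y w" unfolding J_def by (rule integral_add[OF int int])
        finally show "J y (v + w) = J y v + J y w" .
        have "J y (c *\<^sub>R v) = integral {0..1} (\<lambda>t. c * (t ^ Suc n * G v (a + t *\<^sub>R (y - a))))"
          unfolding J_def
          using linear_scale[OF linG[OF ball_segment[OF y]]] by (intro integral_cong) auto
        also have "\<dots> = c *\<^sub>R J y v" unfolding J_def by simp
        finally show "J y (c *\<^sub>R v) = c *\<^sub>R J y v" .
      qed
    next
      fix y v s assume ys: "y + s *\<^sub>R v \<in> ball a r"
      \<comment> \<open>The parameters for which the line stays in the ball: convex, as the Leibniz
        rule requires, and open, so that the restriction to \<open>?U\<close> disappears at the
        end.\<close>
      let ?U = "(\<lambda>s. y + s *\<^sub>R v) -` ball a r"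
      have opU: "open ?U"
        by (intro open_vimage continuous_intros) auto
      have "?U = {s. s *\<^sub>R v \<in> (+) (- y) ` ball a r}" by (auto simp: image_iff algebra_simps)
      then have cvU: "convex ?U"
      proof -
        have "linear (\<lambda>s. s *\<^sub>R v)" by (auto intro!: linearI simp: scaleR_add_left)
        from convex_linear_vimage[OF this, of "(+) (- y) ` ball a r"]
        show ?thesis unfolding \<open>?U = _\<close> by (simp add: vimage_def convex_translation)
      qed
      have "((\<lambda>s. integral (cbox 0 1) (\<lambda>t. t ^ n * F (a + t *\<^sub>R (y + s *\<^sub>R v - a)))) has_real_derivative
        integral (cbox 0 1) (\<lambda>t. t ^ Suc n * G v (a + t *\<^sub>R (y + s *\<^sub>R v - a)))) (at s within ?U)"
      proof (rule leibniz_rule_field_derivative)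
        fix s' t :: real assume st: "s' \<in> ?U" "t \<in> cbox 0 1"
        let ?p = "a + t *\<^sub>R (y - a)"
        have eq: "a + t *\<^sub>R (y + s *\<^sub>R v - a) = ?p + s *\<^sub>R (t *\<^sub>R v)" for s
          by (simp add: algebra_simps)
        have inb: "?p + s' *\<^sub>R (t *\<^sub>R v) \<in> ball a r"
          using ball_segment[of "y + s' *\<^sub>R v" a r t] st unfolding eq by auto
        have "((\<lambda>s. F (?p + s *\<^sub>R (t *\<^sub>R v))) has_real_derivative G (t *\<^sub>R v) (?p + s' *\<^sub>R (t *\<^sub>R v))) (at s')"
          using DERIV_along_line[OF Suc.prems inb] by (simp add: G_def)
        then have "((\<lambda>s. t ^ n * F (?p + s *\<^sub>R (t *\<^sub>R v))) has_real_derivative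
            t ^ n * G (t *\<^sub>R v) (?p + s' *\<^sub>R (t *\<^sub>R v))) (at s' within ?U)"
          by (intro DERIV_cmult) (rule has_field_derivative_at_within)
        moreover have "G (t *\<^sub>R v) (?p + s' *\<^sub>R (t *\<^sub>R v)) = t * G v (?p + s' *\<^sub>R (t *\<^sub>R v))"
          using linear_scale[OF linG[OF inb], of t v] by simp
        ultimately show "((\<lambda>s. t ^ n * F (a + t *\<^sub>R (y + s *\<^sub>R v - a))) has_real_derivative
            t ^ Suc n * G v (a + t *\<^sub>R (y + s' *\<^sub>R v - a))) (at s' within ?U)"
          unfolding eq by (simp add: algebra_simps)
      next
        fix s' assume "s' \<in> ?U"
        then have "y + s' *\<^sub>R v \<in> ball a r" by simp
        from integrable_continuous_real[OF contF[OF this]]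
        show "(\<lambda>t. t ^ n * F (a + t *\<^sub>R (y + s' *\<^sub>R v - a))) integrable_on cbox 0 1" by simp
      next
        show "continuous_on (?U \<times> cbox 0 1) (\<lambda>(s, t). t ^ Suc n * G v (a + t *\<^sub>R (y + s *\<^sub>R v - a)))"
          unfolding split_beta
          by (rule continuous_on_radial[OF smooth_on_imp_continuous[OF G]]; (intro continuous_intros)?)
            (auto simp del: mem_ball intro: ball_segment)
      qed (use ys cvU in auto)
      then show "((\<lambda>s. integral {0..1} (\<lambda>t. t ^ n * F (a + t *\<^sub>R (y + s *\<^sub>R v - a)))) has_real_derivative
         J (y + s *\<^sub>R v) v) (at s)"
        using at_within_open[OF _ opU, of s] ys by (simp add: J_def)
    qed
  qed
qed

text \<open>The difference f x - f a is the integral over t in [0, 1] of the derivative along the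
  segment a + t (x - a). Splitting the direction x - a in the basis E leaves the integrals of the
  partial derivatives as the coefficients g b; the trivial weight t ^ 0 puts them into the form of
  \<open>Ck_on_radial_integral\<close>.\<close>

lemma Hadamard:
  fixes f :: "'a::real_inner \<Rightarrow> real"
  assumes fd: "findim TYPE('a)" and E: "onb E" and f: "smooth_on f (ball a r)"
  obtains g where "\<And>b. smooth_on (g b) (ball a r)" "\<And>b. g b a = frechet_derivative f (at a) b"
    "\<And>x. x \<in> ball a r \<Longrightarrow> f x = f a + (\<Sum>b\<in>E. ((x - a) \<bullet> b) * g b x)"
proof
  let ?D = "\<lambda>b x. frechet_derivative f (at x) b"
  let ?g = "\<lambda>b x. integral {0..1} (\<lambda>t. t ^ 0 * ?D b (a + t *\<^sub>R (x - a)))"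
  show "smooth_on (?g b) (ball a r)" for b
    unfolding smooth_on_def
    using Ck_on_radial_integral[OF fd smooth_on_derivative[OF f]] by blast
  show "?g b a = frechet_derivative f (at a) b" for b by simp
  fix x assume x: "x \<in> ball a r"
  have "((\<lambda>t. ?D (x - a) (a + t *\<^sub>R (x - a))) has_integral f (a + 1 *\<^sub>R (x - a)) - f (a + 0 *\<^sub>R (x - a))) {0..1}"
  proof (rule fundamental_theorem_of_calculus)
    fix t :: real assume "t \<in> {0..1}"
    then have "a + t *\<^sub>R (x - a) \<in> ball a r" using ball_segment[OF x] by auto
    from DERIV_along_line[OF f this]
    show "((\<lambda>t. f (a + t *\<^sub>R (x - a))) has_vector_derivative ?D (x - a) (a + t *\<^sub>R (x - a))) (at t within {0..1})"
      by (simp add: has_real_derivative_iff_has_vector_derivative[symmetric] has_field_derivative_at_within)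
  qed simp
  then have "f x - f a = integral {0..1} (\<lambda>t. ?D (x - a) (a + t *\<^sub>R (x - a)))"
    by (simp add: integral_unique)
  also have "\<dots> = integral {0..1} (\<lambda>t. \<Sum>b\<in>E. ((x - a) \<bullet> b) * (t ^ 0 * ?D b (a + t *\<^sub>R (x - a))))"
  proof (rule integral_cong)
    fix t :: real assume "t \<in> {0..1}"
    then have y: "a + t *\<^sub>R (x - a) \<in> ball a r" (is "?y \<in> _") using ball_segment[OF x] by auto
    have lin: "linear (frechet_derivative f (at ?y))"
      using has_derivative_linear[OF smooth_on_has_derivative[OF f y]] .
    have "?D (x - a) ?y = frechet_derivative f (at ?y) (\<Sum>b\<in>E. ((x - a) \<bullet> b) *\<^sub>R b)"
      using onbD(3)[OF E, of "x - a"] by simp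
    then show "?D (x - a) ?y = (\<Sum>b\<in>E. ((x - a) \<bullet> b) * (t ^ 0 * ?D b ?y))"
      by (simp add: linear_sum[OF lin] linear_scale[OF lin])
  qed
  also have "\<dots> = (\<Sum>b\<in>E. ((x - a) \<bullet> b) * ?g b x)"
  proof (subst integral_sum)
    show "finite E" using onbD(1)[OF E] .
    fix b
    have "continuous_on {0..1} (\<lambda>t. a + t *\<^sub>R (x - a))" by (intro continuous_intros)
    then have "continuous_on {0..1} (\<lambda>t. ?D b (a + t *\<^sub>R (x - a)))"
      by (rule continuous_on_compose2[OF smooth_on_imp_continuous[OF smooth_on_derivative[OF f, of b]]])
        (use x in \<open>auto simp del: mem_ball intro: ball_segment\<close>)
    then have "continuous_on {0..1} (\<lambda>t. ((x - a) \<bullet> b) * (t ^ 0 * ?D b (a + t *\<^sub>R (x - a))))"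
      by (simp add: continuous_on_mult_left)
    then show "(\<lambda>t. ((x - a) \<bullet> b) * (t ^ 0 * ?D b (a + t *\<^sub>R (x - a)))) integrable_on {0..1}"
      by (rule integrable_continuous_real)
  qed simp
  finally show "f x = f a + (\<Sum>b\<in>E. ((x - a) \<bullet> b) * ?g b x)" by simp
qed


subsection \<open>Symmetry of second derivatives\<close>

text \<open>One mean value theorem in direction u, applied to the difference of F along two parallel
  segments, and a second one in direction v.\<close>

lemma second_difference_MVT:
  fixes F :: "'a::real_normed_vector \<Rightarrow> real"
  assumes F: "smooth_on F S" and h: "h > 0"
    and inS: "\<And>s t. 0 \<le> s \<Longrightarrow> s \<le> h \<Longrightarrow> 0 \<le> t \<Longrightarrow> t \<le> h \<Longrightarrow> x + s *\<^sub>R u + t *\<^sub>R v \<in> S"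
  obtains s t where "0 < s" "s < h" "0 < t" "t < h"
    "F (x + h *\<^sub>R u + h *\<^sub>R v) - F (x + h *\<^sub>R u) - F (x + h *\<^sub>R v) + F x =
      h * h * frechet_derivative (\<lambda>y. frechet_derivative F (at y) u) (at (x + s *\<^sub>R u + t *\<^sub>R v)) v"
proof -
  let ?D = "\<lambda>y. frechet_derivative F (at y) u"
  define G where "G s = F ((x + h *\<^sub>R v) + s *\<^sub>R u) - F (x + s *\<^sub>R u)" for s
  have "(G has_real_derivative ?D ((x + h *\<^sub>R v) + s *\<^sub>R u) - ?D (x + s *\<^sub>R u)) (at s)"
    if "0 \<le> s" "s \<le> h" for s
    unfolding G_def
    by (intro DERIV_diff DERIV_along_line[OF F])
      (use inS[of s h] inS[of s 0] that h in \<open>auto simp: algebra_simps\<close>)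
  from MVT2[OF h this] obtain s where s: "0 < s" "s < h"
    "G h - G 0 = (h - 0) * (?D ((x + h *\<^sub>R v) + s *\<^sub>R u) - ?D (x + s *\<^sub>R u))" by blast
  have "((\<lambda>t. ?D ((x + s *\<^sub>R u) + t *\<^sub>R v)) has_real_derivative
      frechet_derivative ?D (at ((x + s *\<^sub>R u) + t *\<^sub>R v)) v) (at t)" if "0 \<le> t" "t \<le> h" for t
    by (rule DERIV_along_line[OF smooth_on_derivative[OF F]]) (use inS[of s t] that s in auto)
  from MVT2[OF h this] obtain t where t: "0 < t" "t < h"
    "?D ((x + s *\<^sub>R u) + h *\<^sub>R v) - ?D ((x + s *\<^sub>R u) + 0 *\<^sub>R v) =
      (h - 0) * frechet_derivative ?D (at ((x + s *\<^sub>R u) + t *\<^sub>R v)) v" by blast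
  have "(x + h *\<^sub>R v) + s *\<^sub>R u = (x + s *\<^sub>R u) + h *\<^sub>R v" by (simp add: algebra_simps)
  from s(3)[unfolded this] have "G h - G 0 = h * h * frechet_derivative ?D (at ((x + s *\<^sub>R u) + t *\<^sub>R v)) v"
    using t(3) by simp
  then show ?thesis using that[OF s(1,2) t(1,2)] by (simp add: G_def algebra_simps)
qed

text \<open>The second difference is symmetric in u and v, so by
  \<open>second_difference_MVT\<close> the two mixed derivatives share a value, each at its own
  point near x. If they differed at x, this would contradict their continuity.\<close>

lemma second_derivative_symmetric:
  fixes F :: "'a::real_normed_vector \<Rightarrow> real"
  assumes S: "open S" and F: "smooth_on F S" and x: "x \<in> S"
  shows "frechet_derivative (\<lambda>y. frechet_derivative F (at y) u) (at x) v =
    frechet_derivative (\<lambda>y. frechet_derivative F (at y) v) (at x) u"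
proof (rule ccontr)
  let ?A = "\<lambda>u v y. frechet_derivative (\<lambda>y. frechet_derivative F (at y) u) (at y) v"
  assume ne: "?A u v x \<noteq> ?A v u x"
  define e where "e = dist (?A u v x) (?A v u x) / 2"
  have e: "e > 0" using ne by (simp add: e_def)
  have "isCont (?A u v) x" for u v
    using smooth_on_imp_continuous[OF smooth_on_derivative[OF smooth_on_derivative[OF F]]] S x
    by (simp add: continuous_on_eq_continuous_at)
  then have ev: "\<exists>d>0. \<forall>y. dist y x < d \<longrightarrow> dist (?A u v y) (?A u v x) < e" for u v
    using e unfolding continuous_at_eps_delta by blast
  obtain d1 where d1: "d1 > 0" "\<And>y. dist y x < d1 \<Longrightarrow> dist (?A u v y) (?A u v x) < e" using ev by blast
  obtain d2 where d2: "d2 > 0" "\<And>y. dist y x < d2 \<Longrightarrow> dist (?A v u y) (?A v u x) < e" using ev by blast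
  obtain d3 where d3: "d3 > 0" "ball x d3 \<subseteq> S" using S x open_contains_ball by blast
  define d where "d = min d1 (min d2 d3)"
  have d: "d > 0" using d1 d2 d3 by (simp add: d_def)
  \<comment> \<open>With this side length the whole parallelogram stays within distance d of x; the
    summand 1 covers u = v = 0.\<close>
  define h where "h = d / (norm u + norm v + 1)"
  have nn: "norm u + norm v + 1 > 0" by (simp add: add_nonneg_pos)
  have h: "h > 0" using d nn by (simp add: h_def)
  have dst: "dist (x + s *\<^sub>R u + t *\<^sub>R v) x < d" if "0 \<le> s" "s \<le> h" "0 \<le> t" "t \<le> h" for s t
  proof -
    have "dist (x + s *\<^sub>R u + t *\<^sub>R v) x = norm (s *\<^sub>R u + t *\<^sub>R v)" by (simp add: dist_norm add.assoc)
    also have "\<dots> \<le> s * norm u + t * norm v" using norm_triangle_ineq[of "s *\<^sub>R u" "t *\<^sub>R v"] that by simp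
    also have "\<dots> \<le> h * norm u + h * norm v" using that by (intro add_mono mult_right_mono) auto
    also have "\<dots> < h * (norm u + norm v + 1)" using h by (simp add: algebra_simps)
    also have "\<dots> = d" using nn by (simp add: h_def)
    finally show ?thesis .
  qed
  then have inS: "x + s *\<^sub>R u + t *\<^sub>R v \<in> S" if "0 \<le> s" "s \<le> h" "0 \<le> t" "t \<le> h" for s t
    using d3 that by (force simp: dist_commute d_def)
  obtain s t where st: "0 < s" "s < h" "0 < t" "t < h"
    "F (x + h *\<^sub>R u + h *\<^sub>R v) - F (x + h *\<^sub>R u) - F (x + h *\<^sub>R v) + F x = h * h * ?A u v (x + s *\<^sub>R u + t *\<^sub>R v)"
    using second_difference_MVT[OF F h inS] by blast
  have inS': "x + s *\<^sub>R v + t *\<^sub>R u \<in> S" if "0 \<le> s" "s \<le> h" "0 \<le> t" "t \<le> h" for s t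
    using inS[of t s] that by (simp add: algebra_simps)
  obtain s' t' where st': "0 < s'" "s' < h" "0 < t'" "t' < h"
    "F (x + h *\<^sub>R v + h *\<^sub>R u) - F (x + h *\<^sub>R v) - F (x + h *\<^sub>R u) + F x = h * h * ?A v u (x + s' *\<^sub>R v + t' *\<^sub>R u)"
    using second_difference_MVT[OF F h inS'] by blast
  have "h * h * ?A u v (x + s *\<^sub>R u + t *\<^sub>R v) = h * h * ?A v u (x + s' *\<^sub>R v + t' *\<^sub>R u)"
    using st(5) st'(5) by (simp add: algebra_simps)
  then have eq: "?A u v (x + s *\<^sub>R u + t *\<^sub>R v) = ?A v u (x + s' *\<^sub>R v + t' *\<^sub>R u)" using h by simp
  have "dist (?A u v (x + s *\<^sub>R u + t *\<^sub>R v)) (?A u v x) < e"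
    using d1(2) dst[of s t] st by (auto simp: d_def)
  moreover have "dist (?A v u (x + s' *\<^sub>R v + t' *\<^sub>R u)) (?A v u x) < e"
    using d2(2) dst[of t' s'] st' by (auto simp: d_def algebra_simps)
  ultimately show False unfolding eq e_def using dist_triangle_half_r by blast
qed


section \<open>Smooth maps in charts, product atlases, and smooth functions as smooth maps\<close>

section \<open>Smooth maps\<close>

lemma smooth_on_transform:
  "open S \<Longrightarrow> smooth_on f S \<Longrightarrow> (\<And>x. x \<in> S \<Longrightarrow> f x = g x) \<Longrightarrow> smooth_on g S"
  using smooth_on_cong[of S f g] by simp

text \<open>\<open>smooth_atlas\<close> without the condition on transition maps. Composition of
  smooth maps rests on this much, and products inherit it without a computation with transition
  maps.\<close>

definition topological_atlas ::
    "('m::topological_space, 'e::real_normed_vector) chart set \<Rightarrow> bool"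
  where "topological_atlas A \<longleftrightarrow>
    (\<forall>(U, \<phi>)\<in>A. open U \<and> open (\<phi> ` U) \<and> (\<exists>\<psi>. homeomorphism U (\<phi> ` U) \<phi> \<psi>)) \<and> \<Union> (fst ` A) = UNIV"

lemma smooth_atlas_topological: "smooth_atlas A \<Longrightarrow> topological_atlas A"
  unfolding smooth_atlas_def topological_atlas_def by blast

lemma chartD:
  assumes "topological_atlas A" "(U, \<phi>) \<in> A"
  shows "open U" "open (\<phi> ` U)" "continuous_on U \<phi>" "inj_on \<phi> U" "continuous_on (\<phi> ` U) (inv_into U \<phi>)"
    "open W \<Longrightarrow> open (\<phi> ` (U \<inter> W))"
proof -
  obtain \<psi> where o: "open U" "open (\<phi> ` U)" and h: "homeomorphism U (\<phi> ` U) \<phi> \<psi>"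
    using assms unfolding topological_atlas_def by blast
  show "open U" "open (\<phi> ` U)" using o by auto
  show "continuous_on U \<phi>" using h homeomorphism_cont1 by blast
  have inv: "\<psi> (\<phi> x) = x" if "x \<in> U" for x using h homeomorphism_apply1 that by metis
  then show inj: "inj_on \<phi> U" by (metis inj_on_def)
  have "inv_into U \<phi> y = \<psi> y" if "y \<in> \<phi> ` U" for y
    using that inv inj by auto
  then show "continuous_on (\<phi> ` U) (inv_into U \<phi>)"
    using homeomorphism_cont2[OF h] continuous_on_cong by metis
  assume W: "open W"
  have "\<phi> ` (U \<inter> W) = \<phi> ` U \<inter> \<psi> -` W" using inv by force
  then show "open (\<phi> ` (U \<inter> W))"
    using continuous_open_preimage[OF homeomorphism_cont2[OF h] o(2) W] by simp
qed

lemma chart_exists: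
  assumes "topological_atlas A"
  obtains U \<phi> where "(U, \<phi>) \<in> A" "p \<in> U"
proof -
  have "p \<in> \<Union> (fst ` A)" using assms unfolding topological_atlas_def by auto
  then show ?thesis using that by auto
qed

lemma smooth_mapD:
  assumes "smooth_map A B F"
  shows "continuous_on UNIV F"
    "(U, \<phi>) \<in> A \<Longrightarrow> (V, \<psi>) \<in> B \<Longrightarrow> smooth_on (\<lambda>x. \<psi> (F (inv_into U \<phi> x))) (\<phi> ` (U \<inter> F -` V))"
  using assms unfolding smooth_map_def by (auto simp: comp_def)

text \<open>Around each point the composite factors through a chart of the middle manifold; the open
  set T is where this chart and the two outer ones are all defined.\<close>

lemma smooth_map_compose:
  fixes A :: "('m::topological_space, 'e::real_normed_vector) chart set"
    and B :: "('n::topological_space, 'f::real_inner) chart set"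
    and C :: "('k::topological_space, 'g::real_normed_vector) chart set"
  assumes A: "topological_atlas A" and B: "topological_atlas B" and fd: "findim TYPE('f)"
    and C: "topological_atlas C"
    and F: "smooth_map A B F" and H: "smooth_map B C H"
  shows "smooth_map A C (\<lambda>x. H (F x))"
  unfolding smooth_map_def
proof (intro conjI, safe)
  show cont: "continuous_on UNIV (\<lambda>x. H (F x))"
    using continuous_on_compose2[OF smooth_mapD(1)[OF H] smooth_mapD(1)[OF F]] by simp
  fix U \<phi> W \<psi> assume U: "(U, \<phi>) \<in> A" and W: "(W, \<psi>) \<in> C"
  note cU = chartD[OF A U] and cW = chartD[OF C W]
  show "smooth_on (\<psi> \<circ> (\<lambda>x. H (F x)) \<circ> inv_into U \<phi>) (\<phi> ` (U \<inter> (\<lambda>x. H (F x)) -` W))"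
  proof (rule smooth_on_local)
    fix x assume "x \<in> \<phi> ` (U \<inter> (\<lambda>x. H (F x)) -` W)"
    then obtain p where p: "p \<in> U" "H (F p) \<in> W" "x = \<phi> p" by auto
    obtain V \<theta> where V: "(V, \<theta>) \<in> B" "F p \<in> V" using chart_exists[OF B] by blast
    note cV = chartD[OF B V(1)]
    define h where "h x = \<theta> (F (inv_into U \<phi> x))" for x
    have h: "smooth_on h (\<phi> ` (U \<inter> F -` V))" unfolding h_def by (rule smooth_mapD(2)[OF F U V(1)])
    define T where "T = \<phi> ` (U \<inter> (F -` V \<inter> (\<lambda>x. H (F x)) -` W))"
    have opT: "open T" unfolding T_def
      by (intro cU(6) open_Int open_vimage cV(1) smooth_mapD(1)[OF F] cW(1) cont)
    have xT: "x \<in> T" using p V unfolding T_def by auto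
    have hT: "h ` T \<subseteq> \<theta> ` (V \<inter> H -` W)" unfolding h_def T_def using cU(4) by auto
    have "smooth_on h T" by (rule smooth_on_subset[OF h]) (auto simp: T_def)
    from smooth_on_compose[OF fd opT hT this smooth_mapD(2)[OF H V(1) W]]
    have sm: "smooth_on (\<lambda>x. \<psi> (H (inv_into V \<theta> (h x)))) T" .
    have "\<psi> (H (inv_into V \<theta> (h x))) = (\<psi> \<circ> (\<lambda>x. H (F x)) \<circ> inv_into U \<phi>) x" if "x \<in> T" for x
      using that cU(4) cV(4) unfolding T_def h_def by auto
    from smooth_on_transform[OF opT sm this]
    show "\<exists>T. open T \<and> x \<in> T \<and> smooth_on (\<psi> \<circ> (\<lambda>x. H (F x)) \<circ> inv_into U \<phi>) T"
      using opT xT by blast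
  qed
qed

lemma smooth_map_id:
  assumes "smooth_atlas A"
  shows "smooth_map A A (\<lambda>x. x)"
  using assms unfolding smooth_map_def smooth_atlas_def by (auto simp: comp_def Int_def)

lemma smooth_map_const:
  assumes A: "topological_atlas A"
  shows "smooth_map A B (\<lambda>x. c)"
  unfolding smooth_map_def
proof (intro conjI, safe)
  fix U \<phi> V \<psi> assume U: "(U, \<phi>) \<in> A" and V: "(V, \<psi>) \<in> B"
  have "open (\<phi> ` (U \<inter> (\<lambda>x. c) -` V))"
    using chartD(2,6)[OF A U] by (cases "c \<in> V") auto
  from smooth_on_const[OF this, of "\<psi> c"]
  show "smooth_on (\<psi> \<circ> (\<lambda>x. c) \<circ> inv_into U \<phi>) (\<phi> ` (U \<inter> (\<lambda>x. c) -` V))"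
    by (simp add: comp_def del: vimage_const)
qed simp

lemma product_atlasE:
  assumes "(W, \<theta>) \<in> product_atlas A B"
  obtains U \<phi> V \<psi> where "(U, \<phi>) \<in> A" "(V, \<psi>) \<in> B" "W = U \<times> V" "\<theta> = map_prod \<phi> \<psi>"
  using assms unfolding product_atlas_def by auto

lemma product_atlasI: "(U, \<phi>) \<in> A \<Longrightarrow> (V, \<psi>) \<in> B \<Longrightarrow> (U \<times> V, map_prod \<phi> \<psi>) \<in> product_atlas A B"
  unfolding product_atlas_def by auto

lemma inv_into_map_prod:
  assumes "inj_on \<phi> U" "inj_on \<psi> V" "y \<in> \<phi> ` U" "z \<in> \<psi> ` V"
  shows "inv_into (U \<times> V) (map_prod \<phi> \<psi>) (y, z) = (inv_into U \<phi> y, inv_into V \<psi> z)"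
proof (rule inv_into_f_eq)
  show "inj_on (map_prod \<phi> \<psi>) (U \<times> V)" using assms map_prod_inj_on by blast
qed (use assms in \<open>auto simp: inv_into_into f_inv_into_f\<close>)

lemma topological_atlas_product:
  assumes A: "topological_atlas A" and B: "topological_atlas B"
  shows "topological_atlas (product_atlas A B)"
  unfolding topological_atlas_def
proof (intro conjI, safe)
  fix W \<theta> assume "(W, \<theta>) \<in> product_atlas A B"
  then obtain U \<phi> V \<psi> where U: "(U, \<phi>) \<in> A" and V: "(V, \<psi>) \<in> B" and W: "W = U \<times> V" "\<theta> = map_prod \<phi> \<psi>"
    by (rule product_atlasE)
  note cU = chartD[OF A U] and cV = chartD[OF B V]
  have im: "\<theta> ` W = \<phi> ` U \<times> \<psi> ` V" using W by force
  show "open W" "open (\<theta> ` W)" unfolding im using cU cV W by (auto simp: open_Times)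
  have "homeomorphism W (\<theta> ` W) \<theta> (map_prod (inv_into U \<phi>) (inv_into V \<psi>))"
    unfolding W
  proof (rule homeomorphismI)
    show "continuous_on (U \<times> V) (map_prod \<phi> \<psi>)"
      unfolding map_prod_def split_beta
      by (intro continuous_on_Pair continuous_on_compose2[OF cU(3)] continuous_on_compose2[OF cV(3)]
          continuous_intros) auto
    show "continuous_on (map_prod \<phi> \<psi> ` (U \<times> V)) (map_prod (inv_into U \<phi>) (inv_into V \<psi>))"
      unfolding map_prod_def split_beta
      by (intro continuous_on_Pair continuous_on_compose2[OF cU(5)] continuous_on_compose2[OF cV(5)]
          continuous_intros) auto
  qed (use cU cV in auto)
  then show "\<exists>\<psi>. homeomorphism W (\<theta> ` W) \<theta> \<psi>" by blast
next
  fix p :: 'a and q :: 'c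
  obtain U \<phi> V \<psi> where "(U, \<phi>) \<in> A" "p \<in> U" "(V, \<psi>) \<in> B" "q \<in> V"
    using chart_exists[OF A] chart_exists[OF B] by metis
  then show "(p, q) \<in> \<Union> (fst ` product_atlas A B)"
    using product_atlasI[of U \<phi> A V \<psi> B] by force
qed simp

lemma smooth_map_Pair:
  assumes A: "topological_atlas A" and B: "topological_atlas B" and C: "topological_atlas C"
    and f: "smooth_map A B f" and g: "smooth_map A C g"
  shows "smooth_map A (product_atlas B C) (\<lambda>x. (f x, g x))"
  unfolding smooth_map_def
proof (intro conjI, safe)
  show "continuous_on UNIV (\<lambda>x. (f x, g x))"
    using smooth_mapD(1)[OF f] smooth_mapD(1)[OF g] by (rule continuous_on_Pair)
  fix U \<phi> W \<theta> assume U: "(U, \<phi>) \<in> A" and "(W, \<theta>) \<in> product_atlas B C"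
  then obtain V \<psi> V' \<psi>' where V: "(V, \<psi>) \<in> B" and V': "(V', \<psi>') \<in> C"
    and W: "W = V \<times> V'" "\<theta> = map_prod \<psi> \<psi>'"
    by (auto elim: product_atlasE)
  let ?S = "\<phi> ` (U \<inter> (\<lambda>x. (f x, g x)) -` W)"
  have eq: "(\<lambda>x. (f x, g x)) -` W = f -` V \<inter> g -` V'" using W by auto
  have op: "open ?S" unfolding eq
    by (intro chartD(6)[OF A U] open_Int open_vimage smooth_mapD(1)[OF f] smooth_mapD(1)[OF g]
        chartD(1)[OF B V] chartD(1)[OF C V'])
  have "smooth_on (\<lambda>x. (\<psi> (f (inv_into U \<phi> x)), \<psi>' (g (inv_into U \<phi> x)))) ?S"
    by (intro smooth_on_Pair op smooth_on_subset[OF smooth_mapD(2)[OF f U V]]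
        smooth_on_subset[OF smooth_mapD(2)[OF g U V']]) (auto simp: W)
  then show "smooth_on (\<theta> \<circ> (\<lambda>x. (f x, g x)) \<circ> inv_into U \<phi>) ?S"
    by (simp add: W comp_def)
qed

text \<open>In charts this is the linear projection followed by a transition map of A, whose
  smoothness comes from \<open>smooth_map_id\<close>.\<close>

lemma smooth_map_fst:
  fixes A :: "('m::topological_space, 'e::real_inner) chart set"
    and B :: "('n::topological_space, 'f::real_inner) chart set"
  assumes A: "smooth_atlas A" and fd: "findim TYPE('e)" and B: "topological_atlas B"
  shows "smooth_map (product_atlas A B) A fst"
  unfolding smooth_map_def
proof (intro conjI, safe)
  show "continuous_on UNIV (fst :: 'm \<times> 'n \<Rightarrow> 'm)" by (intro continuous_intros)
  fix W \<theta> V' \<psi>' assume "(W, \<theta>) \<in> product_atlas A B" and V': "(V', \<psi>') \<in> A"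
  then obtain U \<phi> V \<psi> where U: "(U, \<phi>) \<in> A" and V: "(V, \<psi>) \<in> B" and W: "W = U \<times> V" "\<theta> = map_prod \<phi> \<psi>"
    by (auto elim: product_atlasE)
  have At: "topological_atlas A" using A by (rule smooth_atlas_topological)
  note cU = chartD[OF At U] and cV = chartD[OF B V]
  have eq: "\<theta> ` (W \<inter> fst -` V') = \<phi> ` (U \<inter> V') \<times> \<psi> ` V" (is "?S = ?T") using W by force
  have op: "open ?T"
    by (intro open_Times cU(6) chartD(1)[OF At V'] cV(2))
  have "smooth_on (\<lambda>x. \<psi>' (inv_into U \<phi> x)) (\<phi> ` (U \<inter> V'))"
    using smooth_mapD(2)[OF smooth_map_id[OF A] U V'] by simp
  then have "smooth_on (\<lambda>z. \<psi>' (inv_into U \<phi> (fst z))) ?T"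
    by (rule smooth_on_compose[OF fd op _ smooth_on_linear[OF op bounded_linear_fst], rotated]) auto
  moreover have "\<psi>' (inv_into U \<phi> (fst z)) = (\<psi>' \<circ> fst \<circ> inv_into W \<theta>) z" if "z \<in> ?T" for z
    using that inv_into_map_prod[OF cU(4) cV(4)] unfolding W by auto
  ultimately show "smooth_on (\<psi>' \<circ> fst \<circ> inv_into W \<theta>) (\<theta> ` (W \<inter> fst -` V'))"
    unfolding eq by (rule smooth_on_transform[OF op])
qed

lemma smooth_map_snd:
  fixes A :: "('m::topological_space, 'e::real_inner) chart set"
    and B :: "('n::topological_space, 'f::real_inner) chart set"
  assumes A: "topological_atlas A" and B: "smooth_atlas B" and fd: "findim TYPE('f)"
  shows "smooth_map (product_atlas A B) B snd"
  unfolding smooth_map_def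
proof (intro conjI, safe)
  show "continuous_on UNIV (snd :: 'm \<times> 'n \<Rightarrow> 'n)" by (intro continuous_intros)
  fix W \<theta> V' \<psi>' assume "(W, \<theta>) \<in> product_atlas A B" and V': "(V', \<psi>') \<in> B"
  then obtain U \<phi> V \<psi> where U: "(U, \<phi>) \<in> A" and V: "(V, \<psi>) \<in> B" and W: "W = U \<times> V" "\<theta> = map_prod \<phi> \<psi>"
    by (auto elim: product_atlasE)
  have Bt: "topological_atlas B" using B by (rule smooth_atlas_topological)
  note cU = chartD[OF A U] and cV = chartD[OF Bt V]
  have eq: "\<theta> ` (W \<inter> snd -` V') = \<phi> ` U \<times> \<psi> ` (V \<inter> V')" (is "?S = ?T") using W by force
  have op: "open ?T"
    by (intro open_Times cV(6) chartD(1)[OF Bt V'] cU(2))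
  have "smooth_on (\<lambda>x. \<psi>' (inv_into V \<psi> x)) (\<psi> ` (V \<inter> V'))"
    using smooth_mapD(2)[OF smooth_map_id[OF B] V V'] by simp
  then have "smooth_on (\<lambda>z. \<psi>' (inv_into V \<psi> (snd z))) ?T"
    by (rule smooth_on_compose[OF fd op _ smooth_on_linear[OF op bounded_linear_snd], rotated]) auto
  moreover have "\<psi>' (inv_into V \<psi> (snd z)) = (\<psi>' \<circ> snd \<circ> inv_into W \<theta>) z" if "z \<in> ?T" for z
    using that inv_into_map_prod[OF cU(4) cV(4)] unfolding W by auto
  ultimately show "smooth_on (\<psi>' \<circ> snd \<circ> inv_into W \<theta>) (\<theta> ` (W \<inter> snd -` V'))"
    unfolding eq by (rule smooth_on_transform[OF op])
qed

text \<open>Makes smooth functions a special case of smooth maps, so that pull-back of functions is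
  an instance of \<open>smooth_map_compose\<close>.\<close>

definition real_atlas :: "(real, real) chart set"
  where "real_atlas = {(UNIV, \<lambda>x. x)}"

lemma topological_atlas_real: "topological_atlas real_atlas"
  unfolding topological_atlas_def real_atlas_def
  by (auto intro!: exI[of _ "\<lambda>x. x"] homeomorphismI)

lemma smooth_functions_iff:
  assumes A: "topological_atlas A"
  shows "f \<in> smooth_functions A \<longleftrightarrow> smooth_map A real_atlas f"
proof
  assume f: "f \<in> smooth_functions A"
  \<comment> \<open>Continuity is part of \<open>smooth_map\<close> but not of
    \<open>smooth_functions\<close>; it is glued from the chart domains.\<close>
  have "continuous_on (\<Union> (fst ` A)) f"
  proof (rule continuous_on_open_Union)
    fix S assume "S \<in> fst ` A"
    then obtain \<phi> where U: "(S, \<phi>) \<in> A" by auto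
    note cU = chartD[OF A U(1)]
    show "open S" by (rule cU(1))
    have "continuous_on (\<phi> ` S) (f \<circ> inv_into S \<phi>)"
      using f U smooth_on_imp_continuous unfolding smooth_functions_def by blast
    then have "continuous_on S (\<lambda>x. (f \<circ> inv_into S \<phi>) (\<phi> x))"
      using cU(3) by (rule continuous_on_compose2) simp
    then show "continuous_on S f"
      by (rule continuous_on_eq) (use cU in auto)
  qed
  then have "continuous_on UNIV f" using A by (simp add: topological_atlas_def)
  then show "smooth_map A real_atlas f"
    using f unfolding smooth_map_def real_atlas_def smooth_functions_def by (auto simp: comp_def)
next
  assume "smooth_map A real_atlas f"
  then show "f \<in> smooth_functions A"
    unfolding smooth_map_def real_atlas_def smooth_functions_def by (auto simp: comp_def)
qed

lemma smooth_functions_compose: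
  fixes B :: "('n::topological_space, 'f::real_inner) chart set"
  assumes "topological_atlas A" "topological_atlas B" "findim TYPE('f)"
    "smooth_map A B F" "f \<in> smooth_functions B"
  shows "(\<lambda>x. f (F x)) \<in> smooth_functions A"
  using assms smooth_map_compose[OF assms(1-3) topological_atlas_real assms(4)]
  by (simp add: smooth_functions_iff)

lemma smooth_functionsD:
  "f \<in> smooth_functions A \<Longrightarrow> (U, \<phi>) \<in> A \<Longrightarrow> smooth_on (\<lambda>x. f (inv_into U \<phi> x)) (\<phi> ` U)"
  unfolding smooth_functions_def by (auto simp: comp_def)

lemma smooth_functionsI:
  "(\<And>U \<phi>. (U, \<phi>) \<in> A \<Longrightarrow> smooth_on (\<lambda>x. f (inv_into U \<phi> x)) (\<phi> ` U)) \<Longrightarrow> f \<in> smooth_functions A"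
  unfolding smooth_functions_def by (auto simp: comp_def)

lemma smooth_functions_const: "topological_atlas A \<Longrightarrow> (\<lambda>x. c) \<in> smooth_functions A"
  by (rule smooth_functionsI) (simp add: smooth_on_const chartD(2))

lemma smooth_functions_add:
  "topological_atlas A \<Longrightarrow> f \<in> smooth_functions A \<Longrightarrow> g \<in> smooth_functions A \<Longrightarrow>
    (\<lambda>x. f x + g x) \<in> smooth_functions A"
  by (rule smooth_functionsI) (simp add: smooth_on_add smooth_functionsD chartD)

lemma smooth_functions_mult:
  "topological_atlas A \<Longrightarrow> f \<in> smooth_functions A \<Longrightarrow> g \<in> smooth_functions A \<Longrightarrow>
    (\<lambda>x. f x * g x) \<in> smooth_functions A"
  by (rule smooth_functionsI) (simp add: smooth_on_mult smooth_functionsD chartD)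


section \<open>Gluing and cut-off: local data on a manifold made global\<close>

subsection \<open>Smooth functions on a manifold\<close>

locale manifold =
  fixes A :: "('m::t2_space, 'e::real_inner) chart set"
  assumes atlas: "smooth_atlas A" and fd: "findim TYPE('e)"
begin

abbreviation "SF \<equiv> smooth_functions A"
abbreviation "SF2 \<equiv> smooth_functions (product_atlas A A)"
abbreviation "VF \<equiv> vector_fields A"
abbreviation "T \<equiv> tangent_space A"

lemma topological: "topological_atlas A"
  using atlas by (rule smooth_atlas_topological)

lemmas chart = chartD[OF topological]

lemma SF_const [simp, intro]: "(\<lambda>x. c) \<in> SF"
  by (rule smooth_functions_const[OF topological])

lemma SF_add [intro]: "f \<in> SF \<Longrightarrow> g \<in> SF \<Longrightarrow> (\<lambda>x. f x + g x) \<in> SF"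
  by (rule smooth_functions_add[OF topological])

lemma SF_mult [intro]: "f \<in> SF \<Longrightarrow> g \<in> SF \<Longrightarrow> (\<lambda>x. f x * g x) \<in> SF"
  by (rule smooth_functions_mult[OF topological])

lemma SF_uminus [intro]: "f \<in> SF \<Longrightarrow> (\<lambda>x. - f x) \<in> SF"
  using SF_mult[OF SF_const[of "-1"], of f] by simp

lemma SF_diff [intro]: "f \<in> SF \<Longrightarrow> g \<in> SF \<Longrightarrow> (\<lambda>x. f x - g x) \<in> SF"
  using SF_add[OF _ SF_uminus, of f g] by simp

lemma SF_sum [intro]: "(\<And>i. i \<in> I \<Longrightarrow> f i \<in> SF) \<Longrightarrow> (\<lambda>x. \<Sum>i\<in>I. f i x) \<in> SF"
  by (induction I rule: infinite_finite_induct) auto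

text \<open>One chart near each point suffices, since the transition maps carry smoothness into
  every other chart.\<close>

lemma SF_local:
  assumes "\<And>p. \<exists>U \<phi> W. (U, \<phi>) \<in> A \<and> open W \<and> p \<in> W \<and> W \<subseteq> U \<and>
    smooth_on (\<lambda>x. f (inv_into U \<phi> x)) (\<phi> ` W)"
  shows "f \<in> SF"
proof (rule smooth_functionsI)
  fix V \<psi> assume V: "(V, \<psi>) \<in> A"
  note cV = chart[OF V]
  show "smooth_on (\<lambda>x. f (inv_into V \<psi> x)) (\<psi> ` V)"
  proof (rule smooth_on_local)
    fix x assume "x \<in> \<psi> ` V"
    then obtain p where p: "p \<in> V" "x = \<psi> p" by auto
    obtain U \<phi> W where U: "(U, \<phi>) \<in> A" "open W" "p \<in> W" "W \<subseteq> U"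
      and sm: "smooth_on (\<lambda>x. f (inv_into U \<phi> x)) (\<phi> ` W)" using assms by blast
    note cU = chart[OF U(1)]
    let ?S = "\<psi> ` (V \<inter> W)"
    have op: "open ?S" using cV(6)[OF U(2)] .
    have "smooth_on (\<lambda>x. \<phi> (inv_into V \<psi> x)) (\<psi> ` (V \<inter> U))"
      using smooth_mapD(2)[OF smooth_map_id[OF atlas] V U(1)] by simp
    then have tr: "smooth_on (\<lambda>x. \<phi> (inv_into V \<psi> x)) ?S"
      by (rule smooth_on_subset) (use U in auto)
    have "(\<lambda>x. \<phi> (inv_into V \<psi> x)) ` ?S \<subseteq> \<phi> ` W" using cV(4) by auto
    from smooth_on_compose[OF fd op this tr sm]
    have "smooth_on (\<lambda>x. f (inv_into U \<phi> (\<phi> (inv_into V \<psi> x)))) ?S" .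
    moreover have "f (inv_into U \<phi> (\<phi> (inv_into V \<psi> x))) = f (inv_into V \<psi> x)" if "x \<in> ?S" for x
      using that cV(4) cU(4) U(4) by (auto simp: inv_into_f_f subset_iff)
    ultimately have "smooth_on (\<lambda>x. f (inv_into V \<psi> x)) ?S"
      by (rule smooth_on_transform[OF op])
    then show "\<exists>T. open T \<and> x \<in> T \<and> smooth_on (\<lambda>x. f (inv_into V \<psi> x)) T"
      using op p U(3) by blast
  qed
qed

text \<open>A function in a chart becomes a global one by multiplication with a bump function and
  extension by 0. The radius is chosen before h, so that one neighbourhood of p serves all the
  functions to be extended.\<close>

lemma extend_smooth:
  assumes U: "(U, \<phi>) \<in> A" and p: "p \<in> U" "p \<in> W" and W: "open W"
  obtains r where "r > 0" "ball (\<phi> p) r \<subseteq> \<phi> ` (U \<inter> W)"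
    "\<And>h. smooth_on h (ball (\<phi> p) r) \<Longrightarrow>
      \<exists>f\<in>SF. (\<forall>q\<in>U. dist (\<phi> p) (\<phi> q) < r / 3 \<longrightarrow> f q = h (\<phi> q)) \<and> (\<forall>q. q \<notin> W \<longrightarrow> f q = 0)"
proof -
  note cU = chart[OF U]
  have "open (\<phi> ` (U \<inter> W))" using cU(6)[OF W] .
  then obtain r where r: "r > 0" "ball (\<phi> p) r \<subseteq> \<phi> ` (U \<inter> W)"
    using p open_contains_ball by blast
  obtain \<rho> :: "'e \<Rightarrow> real" where \<rho>: "smooth_on \<rho> UNIV" "\<And>x. dist (\<phi> p) x \<le> r / 3 \<Longrightarrow> \<rho> x = 1"
    "\<And>x. dist (\<phi> p) x \<ge> 2 * (r / 3) \<Longrightarrow> \<rho> x = 0"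
    using bump_function[of "r / 3" "\<phi> p"] r by auto
  let ?B = "cball (\<phi> p) (2 * (r / 3))"
  have B: "?B \<subseteq> ball (\<phi> p) r" using r by auto
  \<comment> \<open>K contains the support of the extension. It is compact, hence closed in a
    Hausdorff space, and the extension vanishes on its open complement.\<close>
  define K where "K = inv_into U \<phi> ` ?B"
  have "compact K" unfolding K_def
    by (intro compact_continuous_image compact_cball_findim[OF fd] continuous_on_subset[OF cU(5)])
      (use r(2) B in blast)
  then have K: "closed K" by (rule compact_imp_closed)
  have KU: "q \<in> U \<and> dist (\<phi> p) (\<phi> q) < r" if "q \<in> K" for q
  proof -
    obtain x where x: "x \<in> ?B" "q = inv_into U \<phi> x" using \<open>q \<in> K\<close> unfolding K_def by blast
    then have "x \<in> \<phi> ` U" using B r(2) by blast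
    then show ?thesis using x B by (auto simp: inv_into_into f_inv_into_f)
  qed
  have nK: "dist (\<phi> p) (\<phi> q) > 2 * (r / 3)" if "q \<in> U" "q \<notin> K" for q
  proof (rule ccontr)
    assume "\<not> ?thesis"
    then have "\<phi> q \<in> ?B" by simp
    then have "inv_into U \<phi> (\<phi> q) \<in> K" unfolding K_def by blast
    then show False using that cU(4) by simp
  qed
  have "\<exists>f\<in>SF. (\<forall>q\<in>U. dist (\<phi> p) (\<phi> q) < r / 3 \<longrightarrow> f q = h (\<phi> q)) \<and> (\<forall>q. q \<notin> W \<longrightarrow> f q = 0)"
    if h: "smooth_on h (ball (\<phi> p) r)" for h
  proof -
    define f where "f q = (if q \<in> U then \<rho> (\<phi> q) * h (\<phi> q) else 0)" for q
    have f0: "f q = 0" if "q \<notin> K" for q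
      using nK[of q] that \<rho>(3) unfolding f_def by fastforce
    have "f \<in> SF"
    proof (rule SF_local)
      fix q
      show "\<exists>U \<phi> W. (U, \<phi>) \<in> A \<and> open W \<and> q \<in> W \<and> W \<subseteq> U \<and> smooth_on (\<lambda>x. f (inv_into U \<phi> x)) (\<phi> ` W)"
      proof (cases "q \<in> K")
        case True
        let ?W = "U \<inter> \<phi> -` ball (\<phi> p) r"
        have op: "open ?W" using continuous_open_preimage[OF cU(3,1) open_ball] .
        have eq: "\<phi> ` ?W = ball (\<phi> p) r" using r(2) by auto
        have "smooth_on (\<lambda>x. \<rho> x * h x) (ball (\<phi> p) r)"
          by (intro smooth_on_mult h smooth_on_subset[OF \<rho>(1)]) auto
        moreover have "\<rho> x * h x = f (inv_into U \<phi> x)" if "x \<in> ball (\<phi> p) r" for x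
        proof -
          have "x \<in> \<phi> ` U" using that r(2) by blast
          then show ?thesis unfolding f_def by (simp add: inv_into_into f_inv_into_f)
        qed
        ultimately have "smooth_on (\<lambda>x. f (inv_into U \<phi> x)) (\<phi> ` ?W)"
          unfolding eq by (rule smooth_on_transform[OF open_ball])
        then show ?thesis using U op KU[OF True] by (intro exI[of _ U] exI[of _ \<phi>] exI[of _ ?W]) auto
      next
        case False
        obtain V \<psi> where V: "(V, \<psi>) \<in> A" "q \<in> V" using chart_exists[OF topological] .
        note cV = chart[OF V(1)]
        have op: "open (V \<inter> - K)" using K cV(1) by auto
        have op': "open (\<psi> ` (V \<inter> - K))" using cV(6)[of "- K"] K by auto
        have "0 = f (inv_into V \<psi> x)" if "x \<in> \<psi> ` (V \<inter> - K)" for x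
          using that f0 cV(4) by auto
        then have "smooth_on (\<lambda>x. f (inv_into V \<psi> x)) (\<psi> ` (V \<inter> - K))"
          by (rule smooth_on_transform[OF op' smooth_on_const[OF op']])
        then show ?thesis using V op False by (intro exI[of _ V] exI[of _ \<psi>] exI[of _ "V \<inter> - K"]) auto
      qed
    qed
    moreover have "f q = h (\<phi> q)" if "q \<in> U" "dist (\<phi> p) (\<phi> q) < r / 3" for q
      using that \<rho>(2)[of "\<phi> q"] unfolding f_def by simp
    moreover have "f q = 0" if "q \<notin> W" for q
    proof (cases "q \<in> K")
      case True
      then have "\<phi> q \<in> \<phi> ` (U \<inter> W)" using KU[OF True] r(2) by auto
      then have "q \<in> W" using KU[OF True] cU(4) by (auto simp: inj_on_def)
      then show ?thesis using that by simp
    qed (rule f0)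
    ultimately show ?thesis by blast
  qed
  then show ?thesis using that r by blast
qed

end


subsection \<open>Tangent vectors\<close>

context manifold
begin

lemma tangent_not_smooth: "v \<in> T p \<Longrightarrow> f \<notin> SF \<Longrightarrow> v f = 0"
  unfolding tangent_space_def by blast

lemma tangent_lincomb:
  "v \<in> T p \<Longrightarrow> f \<in> SF \<Longrightarrow> h \<in> SF \<Longrightarrow> v (\<lambda>x. a * f x + b * h x) = a * v f + b * v h"
  unfolding tangent_space_def by blast

lemma tangent_mult:
  "v \<in> T p \<Longrightarrow> f \<in> SF \<Longrightarrow> h \<in> SF \<Longrightarrow> v (\<lambda>x. f x * h x) = f p * v h + h p * v f"
  unfolding tangent_space_def by blast

lemma tangent_add: "v \<in> T p \<Longrightarrow> f \<in> SF \<Longrightarrow> h \<in> SF \<Longrightarrow> v (\<lambda>x. f x + h x) = v f + v h"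
  using tangent_lincomb[of v p f h 1 1] by simp

lemma tangent_diff: "v \<in> T p \<Longrightarrow> f \<in> SF \<Longrightarrow> h \<in> SF \<Longrightarrow> v (\<lambda>x. f x - h x) = v f - v h"
  using tangent_lincomb[of v p f h 1 "-1"] by simp

lemma tangent_cmult: "v \<in> T p \<Longrightarrow> f \<in> SF \<Longrightarrow> v (\<lambda>x. a * f x) = a * v f"
  using tangent_lincomb[of v p f f a 0] by simp

lemma tangent_uminus: "v \<in> T p \<Longrightarrow> f \<in> SF \<Longrightarrow> v (\<lambda>x. - f x) = - v f"
  using tangent_cmult[of v p f "-1"] by simp

lemma tangent_const: assumes "v \<in> T p" shows "v (\<lambda>x. c) = 0"
proof -
  have "v (\<lambda>x. 1) = 0" using tangent_mult[OF assms, of "\<lambda>x. 1" "\<lambda>x. 1"] by simp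
  then show ?thesis using tangent_cmult[OF assms, of "\<lambda>x. 1" c] by simp
qed

lemma tangent_sum:
  assumes "v \<in> T p" "\<And>i. i \<in> I \<Longrightarrow> f i \<in> SF"
  shows "v (\<lambda>x. \<Sum>i\<in>I. f i x) = (\<Sum>i\<in>I. v (f i))"
  using assms(2)
proof (induction I rule: infinite_finite_induct)
  case (insert i I)
  then show ?case using tangent_add[OF assms(1), of "f i" "\<lambda>x. \<Sum>i\<in>I. f i x"] by (simp add: SF_sum)
qed (simp_all add: tangent_const[OF assms(1)])

lemma tangent_space_lincomb:
  assumes "v \<in> T p" "w \<in> T p"
  shows "a *\<^sub>R v + b *\<^sub>R w \<in> T p"
  unfolding tangent_space_def
proof (intro CollectI conjI ballI allI impI)
  show "(a *\<^sub>R v + b *\<^sub>R w) f = 0" if "f \<notin> SF" for f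
    using assms that by (simp add: tangent_not_smooth)
  fix f h assume "f \<in> SF" "h \<in> SF"
  note s = tangent_lincomb[OF _ this] tangent_mult[OF _ this]
  show "(a *\<^sub>R v + b *\<^sub>R w) (\<lambda>x. c * f x + d * h x) =
      c * (a *\<^sub>R v + b *\<^sub>R w) f + d * (a *\<^sub>R v + b *\<^sub>R w) h" for c d
    using s(1)[OF assms(1)] s(1)[OF assms(2)] by (simp add: algebra_simps)
  show "(a *\<^sub>R v + b *\<^sub>R w) (\<lambda>x. f x * h x) =
      f p * (a *\<^sub>R v + b *\<^sub>R w) h + h p * (a *\<^sub>R v + b *\<^sub>R w) f"
    using s(2)[OF assms(1)] s(2)[OF assms(2)] by (simp add: algebra_simps)
qed

lemma tangent_space_0: "0 \<in> T p"
  unfolding tangent_space_def by auto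

lemma tangent_space_sum: "(\<And>i. i \<in> I \<Longrightarrow> v i \<in> T p) \<Longrightarrow> (\<Sum>i\<in>I. c i *\<^sub>R v i) \<in> T p"
proof (induction I rule: infinite_finite_induct)
  case (insert i I)
  then have "v i \<in> T p" "(\<Sum>i\<in>I. c i *\<^sub>R v i) \<in> T p" by blast+
  from tangent_space_lincomb[OF this, of "c i" 1] show ?case
    by (simp only: sum.insert[OF insert.hyps] scaleR_one)
qed (simp_all add: tangent_space_0)

text \<open>Multiply f - g by a cut-off function k with k p = 1 that vanishes off W. The product is
  0, while the Leibniz rule at p gives v f - v g because f - g vanishes at p.\<close>

lemma tangent_local:
  assumes v: "v \<in> T p" and f: "f \<in> SF" "g \<in> SF" and W: "open W" "p \<in> W"
    and eq: "\<And>x. x \<in> W \<Longrightarrow> f x = g x"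
  shows "v f = v g"
proof -
  obtain U \<phi> where U: "(U, \<phi>) \<in> A" "p \<in> U" using chart_exists[OF topological] .
  obtain r where r: "r > 0" "ball (\<phi> p) r \<subseteq> \<phi> ` (U \<inter> W)"
    "\<And>h. smooth_on h (ball (\<phi> p) r) \<Longrightarrow>
      \<exists>f\<in>SF. (\<forall>q\<in>U. dist (\<phi> p) (\<phi> q) < r / 3 \<longrightarrow> f q = h (\<phi> q)) \<and> (\<forall>q. q \<notin> W \<longrightarrow> f q = 0)"
    using extend_smooth[OF U W(2,1)] by blast
  obtain k where k: "k \<in> SF" "\<forall>q\<in>U. dist (\<phi> p) (\<phi> q) < r / 3 \<longrightarrow> k q = 1" "\<forall>q. q \<notin> W \<longrightarrow> k q = 0"
    using r(3)[OF smooth_on_const[OF open_ball], of 1] by blast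
  have "k p = 1" using k(2) U(2) r(1) by auto
  have "(\<lambda>x. (f x - g x) * k x) = (\<lambda>x. 0)" using eq k(3) by fastforce
  then have "v (\<lambda>x. (f x - g x) * k x) = 0" using tangent_const[OF v] by simp
  moreover have "v (\<lambda>x. (f x - g x) * k x) = v f - v g"
    using tangent_mult[OF v SF_diff[OF f] k(1)] tangent_diff[OF v f] eq[OF W(2)] \<open>k p = 1\<close> by simp
  ultimately show ?thesis by simp
qed

text \<open>In a chart, a derivation is a combination of partial derivatives, by Hadamard's lemma.  The
  coordinate functions \<open>u b\<close> are globally defined and serve all base points near \<open>p\<close>.\<close>

lemma tangent_coordinates:
  assumes U: "(U, \<phi>) \<in> A" "p \<in> U" and E: "onb E"
  obtains u :: "'e \<Rightarrow> 'm \<Rightarrow> real" and N where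
    "open N" "p \<in> N" "N \<subseteq> U" "\<And>b. u b \<in> SF" "\<And>b q. q \<in> N \<Longrightarrow> u b q = (\<phi> q - \<phi> p) \<bullet> b"
    "\<And>q v f. q \<in> N \<Longrightarrow> v \<in> T q \<Longrightarrow> f \<in> SF \<Longrightarrow>
      v f = (\<Sum>b\<in>E. v (u b) * frechet_derivative (\<lambda>x. f (inv_into U \<phi> x)) (at (\<phi> q)) b)"
proof -
  note cU = chart[OF U(1)]
  obtain r where r: "r > 0" "ball (\<phi> p) r \<subseteq> \<phi> ` (U \<inter> UNIV)"
    "\<And>h. smooth_on h (ball (\<phi> p) r) \<Longrightarrow>
      \<exists>f\<in>SF. (\<forall>q\<in>U. dist (\<phi> p) (\<phi> q) < r / 3 \<longrightarrow> f q = h (\<phi> q)) \<and> (\<forall>q. q \<notin> UNIV \<longrightarrow> f q = 0)"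
    using extend_smooth[OF U UNIV_I open_UNIV] by metis
  have "smooth_on (\<lambda>x. (x - \<phi> p) \<bullet> b) (ball (\<phi> p) r)" for b
    by (intro smooth_on_bilinear[OF _ bounded_bilinear_inner] smooth_on_diff smooth_on_id smooth_on_const)
      auto
  then have "\<exists>f\<in>SF. \<forall>q\<in>U. dist (\<phi> p) (\<phi> q) < r / 3 \<longrightarrow> f q = (\<phi> q - \<phi> p) \<bullet> b" for b
    using r(3)[of "\<lambda>x. (x - \<phi> p) \<bullet> b"] by blast
  then obtain u where u: "\<And>b. u b \<in> SF"
    "\<And>b q. q \<in> U \<Longrightarrow> dist (\<phi> p) (\<phi> q) < r / 3 \<Longrightarrow> u b q = (\<phi> q - \<phi> p) \<bullet> b"
    by metis
  define N where "N = U \<inter> \<phi> -` ball (\<phi> p) (r / 3)"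
  have N: "open N" "p \<in> N" "N \<subseteq> U"
    using continuous_open_preimage[OF cU(3,1) open_ball] U r unfolding N_def by auto
  have uN: "u b q = (\<phi> q - \<phi> p) \<bullet> b" if "q \<in> N" for b q
    using u(2) that unfolding N_def by auto
  have "v f = (\<Sum>b\<in>E. v (u b) * frechet_derivative (\<lambda>x. f (inv_into U \<phi> x)) (at (\<phi> q)) b)"
    if q: "q \<in> N" and v: "v \<in> T q" and f: "f \<in> SF" for q v f
  proof -
    have qU: "q \<in> U" using q N by auto
    let ?f = "\<lambda>x. f (inv_into U \<phi> x)"
    obtain s where s: "s > 0" "ball (\<phi> q) s \<subseteq> \<phi> ` (U \<inter> N)"
      "\<And>h. smooth_on h (ball (\<phi> q) s) \<Longrightarrow>
        \<exists>f\<in>SF. (\<forall>x\<in>U. dist (\<phi> q) (\<phi> x) < s / 3 \<longrightarrow> f x = h (\<phi> x)) \<and> (\<forall>q. q \<notin> N \<longrightarrow> f q = 0)"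
      using extend_smooth[OF U(1) qU q N(1)] by metis
    have "smooth_on ?f (ball (\<phi> q) s)"
      by (rule smooth_on_subset[OF smooth_functionsD[OF f U(1)]]) (use s(2) in auto)
    then obtain g where g: "\<And>b. smooth_on (g b) (ball (\<phi> q) s)" "\<And>b. g b (\<phi> q) = frechet_derivative ?f (at (\<phi> q)) b"
      "\<And>x. x \<in> ball (\<phi> q) s \<Longrightarrow> ?f x = ?f (\<phi> q) + (\<Sum>b\<in>E. ((x - \<phi> q) \<bullet> b) * g b x)"
      by (rule Hadamard[OF fd E]) (rule that)
    \<comment> \<open>Tangent vectors act on global functions, so the Hadamard coefficients have to
      be extended as well; \<open>k b\<close> agrees with them near q.\<close>
    have "\<exists>f\<in>SF. \<forall>x\<in>U. dist (\<phi> q) (\<phi> x) < s / 3 \<longrightarrow> f x = g b (\<phi> x)" for b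
      using s(3)[OF g(1)] by blast
    then obtain k where k: "\<And>b. k b \<in> SF" "\<And>b x. x \<in> U \<Longrightarrow> dist (\<phi> q) (\<phi> x) < s / 3 \<Longrightarrow> k b x = g b (\<phi> x)"
      by metis
    define W where "W = U \<inter> \<phi> -` ball (\<phi> q) (s / 3)"
    have W: "open W" "q \<in> W" "W \<subseteq> U"
      using continuous_open_preimage[OF cU(3,1) open_ball] qU s unfolding W_def by auto
    \<comment> \<open>Coordinate differences do not depend on the base point, so the functions
      \<open>u b\<close> made for p also express the Hadamard expansion at q.\<close>
    have fx: "f x = f q + (\<Sum>b\<in>E. (u b x - u b q) * k b x)" if x: "x \<in> W" for x
    proof -
      have d: "dist (\<phi> q) (\<phi> x) < s / 3" using x unfolding W_def by simp
      then have xb: "\<phi> x \<in> ball (\<phi> q) s" using s(1) by simp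
      have xU: "x \<in> U" using x W by auto
      have "\<phi> x \<in> \<phi> ` (U \<inter> N)" using xb s(2) by blast
      then have xN: "x \<in> N" using xU cU(4) by (auto simp: inj_on_def)
      have "f x = f q + (\<Sum>b\<in>E. ((\<phi> x - \<phi> q) \<bullet> b) * g b (\<phi> x))"
        using g(3)[OF xb] cU(4) xU qU by simp
      also have "(\<Sum>b\<in>E. ((\<phi> x - \<phi> q) \<bullet> b) * g b (\<phi> x)) = (\<Sum>b\<in>E. (u b x - u b q) * k b x)"
        using uN[OF xN] uN[OF q] k(2)[OF xU d] by (intro sum.cong) (auto simp: inner_diff_left)
      finally show ?thesis .
    qed
    have sm: "(\<lambda>x. (u b x - u b q) * k b x) \<in> SF" for b
      by (rule SF_mult[OF SF_diff[OF u(1) SF_const] k(1)])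
    have "v f = v (\<lambda>x. f q + (\<Sum>b\<in>E. (u b x - u b q) * k b x))"
      by (rule tangent_local[OF v f _ W(1,2) fx]) (intro SF_add SF_const SF_sum sm)
    also have "\<dots> = (\<Sum>b\<in>E. v (\<lambda>x. (u b x - u b q) * k b x))"
      by (simp add: tangent_add[OF v] tangent_const[OF v] tangent_sum[OF v] SF_sum sm)
    also have "\<dots> = (\<Sum>b\<in>E. v (u b) * g b (\<phi> q))"
    proof (rule sum.cong[OF refl])
      fix b
      have "v (\<lambda>x. u b x - u b q) = v (u b)"
        using tangent_diff[OF v u(1)[of b] SF_const] tangent_const[OF v] by simp
      then show "v (\<lambda>x. (u b x - u b q) * k b x) = v (u b) * g b (\<phi> q)"
        using tangent_mult[OF v SF_diff[OF u(1)[of b] SF_const] k(1)] k(2)[OF qU] s(1) by simp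
    qed
    finally show ?thesis using g(2) by simp
  qed
  from that[OF N u(1) uN this] show ?thesis .
qed

text \<open>The partial derivative in direction b as an element of \<open>tangent_space\<close>,
  which prescribes the value 0 on non-smooth functions.\<close>

definition coordinate_tangent :: "'m set \<Rightarrow> ('m \<Rightarrow> 'e) \<Rightarrow> 'm \<Rightarrow> 'e \<Rightarrow> 'm tvec"
  where "coordinate_tangent U \<phi> p b = (\<lambda>f. if f \<in> SF
    then frechet_derivative (\<lambda>x. f (inv_into U \<phi> x)) (at (\<phi> p)) b else 0)"

lemma coordinate_tangent:
  assumes U: "(U, \<phi>) \<in> A" "p \<in> U"
  shows "coordinate_tangent U \<phi> p b \<in> T p"
  unfolding tangent_space_def
proof (intro CollectI conjI ballI allI impI)
  fix f assume "f \<notin> SF" then show "coordinate_tangent U \<phi> p b f = 0"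
    by (simp add: coordinate_tangent_def)
next
  fix f h assume fh: "f \<in> SF" "h \<in> SF"
  let ?f = "\<lambda>x. f (inv_into U \<phi> x)" and ?h = "\<lambda>x. h (inv_into U \<phi> x)"
  have x: "\<phi> p \<in> \<phi> ` U" using U by auto
  note d = smooth_on_has_derivative[OF smooth_functionsD[OF fh(1) U(1)] x]
    smooth_on_has_derivative[OF smooth_functionsD[OF fh(2) U(1)] x]
  have p: "inv_into U \<phi> (\<phi> p) = p" using chart(4)[OF U(1)] U(2) by simp
  show "coordinate_tangent U \<phi> p b (\<lambda>x. c * f x + e * h x) =
    c * coordinate_tangent U \<phi> p b f + e * coordinate_tangent U \<phi> p b h" for c e
  proof -
    have "((\<lambda>x. c * ?f x + e * ?h x) has_derivative (\<lambda>v. c * frechet_derivative ?f (at (\<phi> p)) v +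
      e * frechet_derivative ?h (at (\<phi> p)) v)) (at (\<phi> p))"
      by (intro has_derivative_add has_derivative_mult_right d)
    from frechet_derivative_at[OF this, symmetric] show ?thesis
      using fh by (simp add: coordinate_tangent_def SF_add SF_mult)
  qed
  have "((\<lambda>x. ?f x * ?h x) has_derivative (\<lambda>v. ?f (\<phi> p) * frechet_derivative ?h (at (\<phi> p)) v +
      frechet_derivative ?f (at (\<phi> p)) v * ?h (\<phi> p))) (at (\<phi> p))"
    by (intro has_derivative_mult d)
  from frechet_derivative_at[OF this, symmetric]
  show "coordinate_tangent U \<phi> p b (\<lambda>x. f x * h x) =
      f p * coordinate_tangent U \<phi> p b h + h p * coordinate_tangent U \<phi> p b f"
    using fh by (simp add: coordinate_tangent_def SF_mult p)
qed

text \<open>Serves as an expansion formula: expressions that are multilinear in tangent vectors at p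
  become finite sums whose coefficients v (u b) are values of v on fixed smooth functions.\<close>

lemma tangent_dual_basis:
  obtains E :: "'e set" and u :: "'e \<Rightarrow> 'm \<Rightarrow> real" and e :: "'e \<Rightarrow> 'm tvec" where
    "finite E" "\<And>b. u b \<in> SF" "\<And>b. e b \<in> T p" "\<And>v. v \<in> T p \<Longrightarrow> v = (\<Sum>b\<in>E. v (u b) *\<^sub>R e b)"
proof -
  obtain U \<phi> where U: "(U, \<phi>) \<in> A" "p \<in> U" using chart_exists[OF topological] .
  obtain E :: "'e set" where E: "onb E" using findim_onb[OF fd] .
  obtain u N where N: "open N" and u: "p \<in> N" and "N \<subseteq> U" and u2: "\<And>b. u b \<in> SF"
    and "\<And>b q. q \<in> N \<Longrightarrow> u b q = (\<phi> q - \<phi> p) \<bullet> b" and u3: "\<And>q v f. q \<in> N \<Longrightarrow> v \<in> T q \<Longrightarrow> f \<in> SF \<Longrightarrow>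
      v f = (\<Sum>b\<in>E. v (u b) * frechet_derivative (\<lambda>x. f (inv_into U \<phi> x)) (at (\<phi> q)) b)"
    by (rule tangent_coordinates[OF U E]) (rule that)
  have "v = (\<Sum>b\<in>E. v (u b) *\<^sub>R coordinate_tangent U \<phi> p b)" if v: "v \<in> T p" for v
  proof
    fix f
    have apply_sum: "(\<Sum>b\<in>E. v (u b) *\<^sub>R coordinate_tangent U \<phi> p b) f =
      (\<Sum>b\<in>E. v (u b) * coordinate_tangent U \<phi> p b f)"
      using onbD(1)[OF E] by (induction E rule: finite_induct) auto
    show "v f = (\<Sum>b\<in>E. v (u b) *\<^sub>R coordinate_tangent U \<phi> p b) f"
      unfolding apply_sum
      using u3[OF u v, of f] tangent_not_smooth[OF v, of f]
      by (cases "f \<in> SF") (auto simp: coordinate_tangent_def)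
  qed
  from that[OF onbD(1)[OF E] u2 coordinate_tangent[OF U] this] show ?thesis .
qed

end


subsection \<open>Smooth families of functions\<close>

lemma frechet_derivative_slice:
  assumes "smooth_on F S" "(x, y) \<in> S"
  shows "frechet_derivative (\<lambda>y. F (x, y)) (at y) b = frechet_derivative F (at (x, y)) (0, b)"
    "frechet_derivative (\<lambda>x. F (x, y)) (at x) a = frechet_derivative F (at (x, y)) (a, 0)"
proof -
  note d = smooth_on_has_derivative[OF assms]
  have "((\<lambda>y. (x, y)) has_derivative (\<lambda>b. (0, b))) (at y)"
    by (auto intro!: derivative_eq_intros)
  from frechet_derivative_at[OF has_derivative_compose[OF this d], symmetric]
  show "frechet_derivative (\<lambda>y. F (x, y)) (at y) b = frechet_derivative F (at (x, y)) (0, b)" by simp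
  have "((\<lambda>x. (x, y)) has_derivative (\<lambda>a. (a, 0))) (at x)"
    by (auto intro!: derivative_eq_intros)
  from frechet_derivative_at[OF has_derivative_compose[OF this d], symmetric]
  show "frechet_derivative (\<lambda>x. F (x, y)) (at x) a = frechet_derivative F (at (x, y)) (a, 0)" by simp
qed

context manifold
begin

lemma SF2_chart:
  assumes F: "F \<in> SF2" and U: "(U, \<phi>) \<in> A" and V: "(V, \<psi>) \<in> A"
  shows "smooth_on (\<lambda>(x, y). F (inv_into U \<phi> x, inv_into V \<psi> y)) (\<phi> ` U \<times> \<psi> ` V)"
proof (rule smooth_on_transform)
  have im: "map_prod \<phi> \<psi> ` (U \<times> V) = \<phi> ` U \<times> \<psi> ` V" by force
  show "open (\<phi> ` U \<times> \<psi> ` V)" by (intro open_Times chart(2)[OF U] chart(2)[OF V])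
  show "smooth_on (\<lambda>z. F (inv_into (U \<times> V) (map_prod \<phi> \<psi>) z)) (\<phi> ` U \<times> \<psi> ` V)"
    using smooth_functionsD[OF F product_atlasI[OF U V]] unfolding im .
  show "F (inv_into (U \<times> V) (map_prod \<phi> \<psi>) z) = (\<lambda>(x, y). F (inv_into U \<phi> x, inv_into V \<psi> y)) z"
    if "z \<in> \<phi> ` U \<times> \<psi> ` V" for z
    using that inv_into_map_prod[OF chart(4)[OF U] chart(4)[OF V]] by auto
qed

lemma SF_compose: "smooth_map A A a \<Longrightarrow> f \<in> SF \<Longrightarrow> (\<lambda>x. f (a x)) \<in> SF"
  using smooth_functions_compose[OF topological topological fd] by blast

lemma topological2: "topological_atlas (product_atlas A A)"
  by (rule topological_atlas_product[OF topological topological])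

lemma SF2_Pair: "smooth_map A A a \<Longrightarrow> smooth_map A A b \<Longrightarrow> F \<in> SF2 \<Longrightarrow> (\<lambda>x. F (a x, b x)) \<in> SF"
  by (rule smooth_functions_compose[OF topological topological2 findim_prod[OF fd fd]
        smooth_map_Pair[OF topological topological topological]])

lemma SF2_slice: "F \<in> SF2 \<Longrightarrow> (\<lambda>h. F (g, h)) \<in> SF" "F \<in> SF2 \<Longrightarrow> (\<lambda>h. F (h, g)) \<in> SF"
  by (intro SF2_Pair smooth_map_const[OF topological] smooth_map_id[OF atlas]; assumption)+

text \<open>In charts, v g is the combination of partial derivatives at a g with coefficients v g (u
  b), smooth in g by \<open>sm\<close>; the partial derivatives of F in the second variable are
  smooth along (g, a g). A constant a yields smoothness of invariant fields, the identity that of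
  the Maurer-Cartan form.\<close>

lemma tangent_family:
  assumes F: "F \<in> SF2" and a: "smooth_map A A a" and v: "\<And>g. v g \<in> T (a g)"
    and sm: "\<And>u. u \<in> SF \<Longrightarrow> (\<lambda>g. v g u) \<in> SF"
  shows "(\<lambda>g. v g (\<lambda>h. F (g, h))) \<in> SF"
proof (rule SF_local)
  fix p
  obtain U \<phi> where U: "(U, \<phi>) \<in> A" "p \<in> U" using chart_exists[OF topological] .
  obtain V \<psi> where V: "(V, \<psi>) \<in> A" "a p \<in> V" using chart_exists[OF topological] .
  obtain E :: "'e set" where E: "onb E" using findim_onb[OF fd] .
  note cU = chart[OF U(1)] and cV = chart[OF V(1)]
  obtain u N where u: "open N" "a p \<in> N" "N \<subseteq> V" "\<And>b. u b \<in> SF"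
    and "\<And>b x. x \<in> N \<Longrightarrow> u b x = (\<psi> x - \<psi> (a p)) \<bullet> b" and u5: "\<And>q v f. q \<in> N \<Longrightarrow> v \<in> T q \<Longrightarrow> f \<in> SF \<Longrightarrow>
      v f = (\<Sum>b\<in>E. v (u b) * frechet_derivative (\<lambda>x. f (inv_into V \<psi> x)) (at (\<psi> q)) b)"
    by (rule tangent_coordinates[OF V E]) (rule that)
  define F' where "F' = (\<lambda>(x, y). F (inv_into U \<phi> x, inv_into V \<psi> y))"
  have F': "smooth_on F' (\<phi> ` U \<times> \<psi> ` V)" unfolding F'_def by (rule SF2_chart[OF F U(1) V(1)])
  define W where "W = U \<inter> a -` N"
  have opN: "open (a -` N)" by (rule open_vimage[OF u(1) smooth_mapD(1)[OF a]])
  have W: "open W" "p \<in> W" "W \<subseteq> U" unfolding W_def using cU(1) opN U u by auto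
  have opW: "open (\<phi> ` W)" unfolding W_def by (rule cU(6)[OF opN])
  let ?a = "\<lambda>x. \<psi> (a (inv_into U \<phi> x))"
  have "smooth_on ?a (\<phi> ` W)"
    by (rule smooth_on_subset[OF smooth_mapD(2)[OF a U(1) V(1)]]) (use u(3) in \<open>auto simp: W_def\<close>)
  then have xa: "smooth_on (\<lambda>x. (x, ?a x)) (\<phi> ` W)"
    by (intro smooth_on_Pair opW smooth_on_id)
  have xa_in: "(\<lambda>x. (x, ?a x)) ` (\<phi> ` W) \<subseteq> \<phi> ` U \<times> \<psi> ` V"
    using W u(3) cU(4) by (auto simp: W_def)
  have "smooth_on (\<lambda>x. frechet_derivative F' (at (x, ?a x)) (0, b)) (\<phi> ` W)" for b
    by (rule smooth_on_compose[OF findim_prod[OF fd fd] opW xa_in xa smooth_on_derivative[OF F']])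
  moreover have "smooth_on (\<lambda>x. v (inv_into U \<phi> x) (u b)) (\<phi> ` W)" for b
    by (rule smooth_on_subset[OF smooth_functionsD[OF sm[OF u(4)] U(1)]]) (use W in auto)
  ultimately have "smooth_on (\<lambda>x. \<Sum>b\<in>E. v (inv_into U \<phi> x) (u b) * frechet_derivative F' (at (x, ?a x)) (0, b)) (\<phi> ` W)"
    by (intro smooth_on_sum smooth_on_mult opW)
  then have "smooth_on (\<lambda>x. v (inv_into U \<phi> x) (\<lambda>h. F (inv_into U \<phi> x, h))) (\<phi> ` W)"
  proof (rule smooth_on_transform[OF opW])
    fix x assume "x \<in> \<phi> ` W"
    then obtain g where g: "g \<in> W" "x = \<phi> g" by auto
    have gU: "g \<in> U" "inv_into U \<phi> x = g" using g W cU(4) by auto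
    have agN: "a g \<in> N" using g unfolding W_def by auto
    have "(x, \<psi> (a g)) \<in> \<phi> ` U \<times> \<psi> ` V" using gU agN u(3) g by auto
    from frechet_derivative_slice(1)[OF F' this]
    have "frechet_derivative (\<lambda>y. F (g, inv_into V \<psi> y)) (at (\<psi> (a g))) b =
      frechet_derivative F' (at (x, ?a x)) (0, b)" for b
      using gU by (simp add: F'_def)
    then show "(\<Sum>b\<in>E. v (inv_into U \<phi> x) (u b) * frechet_derivative F' (at (x, ?a x)) (0, b)) =
      v (inv_into U \<phi> x) (\<lambda>h. F (inv_into U \<phi> x, h))"
      using u5[OF agN v SF2_slice(1)[OF F]] gU by simp
  qed
  then show "\<exists>U \<phi> W. (U, \<phi>) \<in> A \<and> open W \<and> p \<in> W \<and> W \<subseteq> U \<and>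
      smooth_on (\<lambda>x. v (inv_into U \<phi> x) (\<lambda>h. F (inv_into U \<phi> x, h))) (\<phi> ` W)"
    using U W by blast
qed

lemma SF2_swap:
  assumes "F \<in> SF2"
  shows "(\<lambda>(g, h). F (h, g)) \<in> SF2"
proof -
  have "smooth_map (product_atlas A A) (product_atlas A A) (\<lambda>z. (snd z, fst z))"
    by (intro smooth_map_Pair smooth_map_fst smooth_map_snd topological2 topological atlas fd)
  from smooth_functions_compose[OF topological2 topological2 findim_prod[OF fd fd] this assms]
  show ?thesis by (simp add: case_prod_beta')
qed

lemma tangent_family_const:
  assumes "F \<in> SF2" "v \<in> T p"
  shows "(\<lambda>g. v (\<lambda>h. F (g, h))) \<in> SF" "(\<lambda>g. v (\<lambda>h. F (h, g))) \<in> SF"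
  using tangent_family[OF assms(1) smooth_map_const[OF topological], of "\<lambda>g. v"]
    tangent_family[OF SF2_swap[OF assms(1)] smooth_map_const[OF topological], of "\<lambda>g. v"] assms(2)
  by auto

text \<open>Expanded in coordinates, both sides are sums of mixed second derivatives of F, one
  direction in each factor, taken in opposite orders.\<close>

lemma tangent_commute:
  assumes F: "F \<in> SF2" and v: "v \<in> T p" and w: "w \<in> T q"
  shows "v (\<lambda>g. w (\<lambda>h. F (g, h))) = w (\<lambda>h. v (\<lambda>g. F (g, h)))"
proof -
  obtain E :: "'e set" where E: "onb E" using findim_onb[OF fd] .
  obtain U \<phi> where U: "(U, \<phi>) \<in> A" "p \<in> U" using chart_exists[OF topological] .
  obtain V \<psi> where V: "(V, \<psi>) \<in> A" "q \<in> V" using chart_exists[OF topological] .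
  note cU = chart[OF U(1)] and cV = chart[OF V(1)]
  obtain u N where N: "open N" and u: "p \<in> N" and "N \<subseteq> U" and u2: "\<And>b. u b \<in> SF"
    and "\<And>b q. q \<in> N \<Longrightarrow> u b q = (\<phi> q - \<phi> p) \<bullet> b" and u3: "\<And>q v f. q \<in> N \<Longrightarrow> v \<in> T q \<Longrightarrow> f \<in> SF \<Longrightarrow>
      v f = (\<Sum>b\<in>E. v (u b) * frechet_derivative (\<lambda>x. f (inv_into U \<phi> x)) (at (\<phi> q)) b)"
    by (rule tangent_coordinates[OF U E]) (rule that)
  obtain k M where M: "open M" and k: "q \<in> M" and "M \<subseteq> V" and k2: "\<And>b. k b \<in> SF"
    and "\<And>b x. x \<in> M \<Longrightarrow> k b x = (\<psi> x - \<psi> q) \<bullet> b" and k3: "\<And>q v f. q \<in> M \<Longrightarrow> v \<in> T q \<Longrightarrow> f \<in> SF \<Longrightarrow>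
      v f = (\<Sum>b\<in>E. v (k b) * frechet_derivative (\<lambda>x. f (inv_into V \<psi> x)) (at (\<psi> q)) b)"
    by (rule tangent_coordinates[OF V E]) (rule that)
  define F' where "F' = (\<lambda>(x, y). F (inv_into U \<phi> x, inv_into V \<psi> y))"
  let ?S = "\<phi> ` U \<times> \<psi> ` V"
  have F': "smooth_on F' ?S" unfolding F'_def by (rule SF2_chart[OF F U(1) V(1)])
  let ?D = "\<lambda>a z. frechet_derivative F' (at z) a"
  have S: "open ?S" by (intro open_Times cU(2) cV(2))
  have z: "(\<phi> p, \<psi> q) \<in> ?S" using U V by auto
  have pq: "inv_into U \<phi> (\<phi> p) = p" "inv_into V \<psi> (\<psi> q) = q" using cU(4) cV(4) U V by auto
  have one: "w (\<lambda>h. F (inv_into U \<phi> x, h)) = (\<Sum>c\<in>E. w (k c) * ?D (0, c) (x, \<psi> q))" if "x \<in> \<phi> ` U" for x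
  proof -
    have "(x, \<psi> q) \<in> ?S" using that V by auto
    from frechet_derivative_slice(1)[OF F' this] show ?thesis
      unfolding k3[OF k w SF2_slice(1)[OF F]] by (simp add: F'_def)
  qed
  have two: "v (\<lambda>g. F (g, inv_into V \<psi> y)) = (\<Sum>b\<in>E. v (u b) * ?D (b, 0) (\<phi> p, y))" if "y \<in> \<psi> ` V" for y
  proof -
    have "(\<phi> p, y) \<in> ?S" using that U by auto
    from frechet_derivative_slice(2)[OF F' this] show ?thesis
      unfolding u3[OF u v SF2_slice(2)[OF F]] by (simp add: F'_def)
  qed
  have sliceD: "((\<lambda>x. ?D (0, c) (x, \<psi> q)) has_derivative
      (\<lambda>b. frechet_derivative (?D (0, c)) (at (\<phi> p, \<psi> q)) (b, 0))) (at (\<phi> p))"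
    "((\<lambda>y. ?D (c, 0) (\<phi> p, y)) has_derivative
      (\<lambda>b. frechet_derivative (?D (c, 0)) (at (\<phi> p, \<psi> q)) (0, b))) (at (\<psi> q))" for c
  proof -
    have d: "(?D a has_derivative frechet_derivative (?D a) (at (\<phi> p, \<psi> q))) (at (\<phi> p, \<psi> q))" for a
      by (rule smooth_on_has_derivative[OF smooth_on_derivative[OF F'] z])
    have "((\<lambda>x. (x, \<psi> q)) has_derivative (\<lambda>b. (b, 0))) (at (\<phi> p))"
      "((\<lambda>y. (\<phi> p, y)) has_derivative (\<lambda>b. (0, b))) (at (\<psi> q))"
      by (auto intro!: derivative_eq_intros)
    from has_derivative_compose[OF this(1) d] has_derivative_compose[OF this(2) d]
    show "((\<lambda>x. ?D (0, c) (x, \<psi> q)) has_derivative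
        (\<lambda>b. frechet_derivative (?D (0, c)) (at (\<phi> p, \<psi> q)) (b, 0))) (at (\<phi> p))"
      "((\<lambda>y. ?D (c, 0) (\<phi> p, y)) has_derivative
        (\<lambda>b. frechet_derivative (?D (c, 0)) (at (\<phi> p, \<psi> q)) (0, b))) (at (\<psi> q))" .
  qed
  have "((\<lambda>x. \<Sum>c\<in>E. w (k c) * ?D (0, c) (x, \<psi> q)) has_derivative
     (\<lambda>b. \<Sum>c\<in>E. w (k c) * frechet_derivative (?D (0, c)) (at (\<phi> p, \<psi> q)) (b, 0))) (at (\<phi> p))"
    by (intro has_derivative_sum has_derivative_mult_right sliceD)
  from has_derivative_transform_within_open[OF this cU(2) _ one[symmetric]] U(2)
  have d1: "((\<lambda>x. w (\<lambda>h. F (inv_into U \<phi> x, h))) has_derivative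
     (\<lambda>b. \<Sum>c\<in>E. w (k c) * frechet_derivative (?D (0, c)) (at (\<phi> p, \<psi> q)) (b, 0))) (at (\<phi> p))" by auto
  have "((\<lambda>y. \<Sum>b\<in>E. v (u b) * ?D (b, 0) (\<phi> p, y)) has_derivative
     (\<lambda>c. \<Sum>b\<in>E. v (u b) * frechet_derivative (?D (b, 0)) (at (\<phi> p, \<psi> q)) (0, c))) (at (\<psi> q))"
    by (intro has_derivative_sum has_derivative_mult_right sliceD)
  from has_derivative_transform_within_open[OF this cV(2) _ two[symmetric]] V(2)
  have d2: "((\<lambda>y. v (\<lambda>g. F (g, inv_into V \<psi> y))) has_derivative
     (\<lambda>c. \<Sum>b\<in>E. v (u b) * frechet_derivative (?D (b, 0)) (at (\<phi> p, \<psi> q)) (0, c))) (at (\<psi> q))" by auto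
  have "v (\<lambda>g. w (\<lambda>h. F (g, h))) =
    (\<Sum>b\<in>E. \<Sum>c\<in>E. v (u b) * (w (k c) * frechet_derivative (?D (0, c)) (at (\<phi> p, \<psi> q)) (b, 0)))"
    unfolding u3[OF u v tangent_family_const(1)[OF F w]] frechet_derivative_at[OF d1, symmetric]
    by (simp add: sum_distrib_left)
  also have "\<dots> = (\<Sum>b\<in>E. \<Sum>c\<in>E. w (k c) * (v (u b) * frechet_derivative (?D (b, 0)) (at (\<phi> p, \<psi> q)) (0, c)))"
    using second_derivative_symmetric[OF S F' z]
    by (intro sum.cong refl) simp
  also have "\<dots> = (\<Sum>c\<in>E. \<Sum>b\<in>E. w (k c) * (v (u b) * frechet_derivative (?D (b, 0)) (at (\<phi> p, \<psi> q)) (0, c)))"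
    by (rule sum.swap)
  also have "\<dots> = w (\<lambda>h. v (\<lambda>g. F (g, h)))"
    unfolding k3[OF k w tangent_family_const(2)[OF F v]] frechet_derivative_at[OF d2, symmetric]
    by (simp add: sum_distrib_left)
  finally show ?thesis .
qed

end


section \<open>Wedge product, contraction and parity for arbitrary functions of lists\<close>

section \<open>Exterior algebra\<close>

text \<open>All identities for wedge products are proved by induction on the list of arguments: contraction
  with the first argument is an antiderivation.\<close>

definition parity :: "'m form \<Rightarrow> 'm form"
  where "parity \<omega> = (\<lambda>Xs p. (- 1) ^ length Xs * \<omega> Xs p)"

text \<open>The degree condition of \<open>k_forms\<close> without membership in
  \<open>forms\<close>, so that degrees can be tracked for derivatives as mere functions of
  lists.\<close>

definition homogeneous :: "nat \<Rightarrow> 'm form \<Rightarrow> bool"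
  where "homogeneous k \<omega> \<longleftrightarrow> (\<forall>Xs. length Xs \<noteq> k \<longrightarrow> \<omega> Xs = 0)"

lemma contraction_apply:
  "contraction X \<omega> Xs = \<omega> (X # Xs)"
  by (simp add: contraction_def)

lemma parity_apply: "parity \<omega> Xs p = (- 1) ^ length Xs * \<omega> Xs p"
  by (simp add: parity_def)

lemma nths_Cons_image:
  "nths (x # xs) (insert 0 (Suc ` S)) = x # nths xs S"
  "nths (x # xs) (- insert 0 (Suc ` S)) = nths xs (- S)"
  "nths (x # xs) (Suc ` S) = nths xs S"
  "nths (x # xs) (- (Suc ` S)) = x # nths xs (- S)"
proof -
  have "{j. Suc j \<in> Suc ` S} = S" "{j. Suc j \<notin> Suc ` S} = - S" by auto
  then show "nths (x # xs) (insert 0 (Suc ` S)) = x # nths xs S"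
    "nths (x # xs) (- insert 0 (Suc ` S)) = nths xs (- S)"
    "nths (x # xs) (Suc ` S) = nths xs S"
    "nths (x # xs) (- (Suc ` S)) = x # nths xs (- S)"
    by (simp_all add: nths_Cons)
qed

text \<open>If position 0 belongs to the set, it lies before all others and causes no inversion. If
  not, it forms one inversion with each shifted element of S, whence the factor (-1)^card S.\<close>

lemma shuffle_sign_Suc:
  assumes "finite S"
  shows "shuffle_sign (insert 0 (Suc ` S)) = shuffle_sign S"
    "shuffle_sign (Suc ` S) = (- 1) ^ card S * shuffle_sign S"
proof -
  let ?P = "{(i, j). i \<in> S \<and> j \<notin> S \<and> j < i}"
  have finP: "finite ?P"
    by (rule finite_subset[of _ "S \<times> {..<Suc (Max S)}"])
      (use assms in \<open>auto simp: less_Suc_eq_le intro: order.trans[OF less_imp_le Max_ge]\<close>)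
  have inj: "inj_on (map_prod Suc Suc) ?P" by (auto simp: inj_on_def)
  have "{(i, j). i \<in> insert 0 (Suc ` S) \<and> j \<notin> insert 0 (Suc ` S) \<and> j < i} = map_prod Suc Suc ` ?P"
  proof (intro equalityI subsetI)
    fix z assume "z \<in> {(i, j). i \<in> insert 0 (Suc ` S) \<and> j \<notin> insert 0 (Suc ` S) \<and> j < i}"
    then obtain i j where z: "z = (Suc i, j)" "i \<in> S" "j \<noteq> 0" "j \<notin> Suc ` S" "j < Suc i" by auto
    then obtain j' where "j = Suc j'" by (cases j) auto
    then show "z \<in> map_prod Suc Suc ` ?P" using z by force
  qed auto
  then show "shuffle_sign (insert 0 (Suc ` S)) = shuffle_sign S"
    unfolding shuffle_sign_def by (simp add: card_image[OF inj])
  have "{(i, j). i \<in> Suc ` S \<and> j \<notin> Suc ` S \<and> j < i} = (\<lambda>i. (Suc i, 0)) ` S \<union> map_prod Suc Suc ` ?P"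
  proof (intro equalityI subsetI)
    fix z assume "z \<in> {(i, j). i \<in> Suc ` S \<and> j \<notin> Suc ` S \<and> j < i}"
    then obtain i j where z: "z = (Suc i, j)" "i \<in> S" "j \<notin> Suc ` S" "j < Suc i" by auto
    show "z \<in> (\<lambda>i. (Suc i, 0)) ` S \<union> map_prod Suc Suc ` ?P"
    proof (cases j)
      case (Suc j')
      then show ?thesis using z by force
    qed (use z in auto)
  qed auto
  moreover have "card ((\<lambda>i. (Suc i, 0::nat)) ` S \<union> map_prod Suc Suc ` ?P) = card S + card ?P"
    using assms finP by (subst card_Un_disjoint) (auto simp: card_image[OF inj] card_image inj_on_def)
  ultimately show "shuffle_sign (Suc ` S) = (- 1) ^ card S * shuffle_sign S"
    unfolding shuffle_sign_def by (simp add: power_add)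
qed

lemma wedge_Nil: "wedge \<omega> \<omega>' [] p = \<omega> [] p * \<omega>' [] p"
  by (simp add: wedge_with_def shuffle_sign_def)

text \<open>The position sets split according to whether they contain 0, that is, by the factor that
  receives X. If it is the second one, the sign (-1)^card S is the parity of the number of arguments
  of the first.\<close>

lemma wedge_Cons:
  "wedge \<omega> \<omega>' (X # Xs) p =
    wedge (contraction X \<omega>) \<omega>' Xs p + wedge (parity \<omega>) (contraction X \<omega>') Xs p"
proof -
  let ?n = "length Xs"
  let ?t = "\<lambda>S. shuffle_sign S * (\<omega> (nths (X # Xs) S) p * \<omega>' (nths (X # Xs) (- S)) p)"
  have "Pow {..<Suc ?n} = (`) Suc ` Pow {..<?n} \<union> (\<lambda>S. insert 0 (Suc ` S)) ` Pow {..<?n}"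
    unfolding lessThan_Suc_eq_insert_0 Pow_insert image_Pow_surj[OF refl, symmetric] image_image ..
  moreover have "(`) Suc ` Pow {..<?n} \<inter> (\<lambda>S. insert 0 (Suc ` S)) ` Pow {..<?n} = {}" by auto
  ultimately have "wedge \<omega> \<omega>' (X # Xs) p =
      sum ?t ((`) Suc ` Pow {..<?n}) + sum ?t ((\<lambda>S. insert 0 (Suc ` S)) ` Pow {..<?n})"
    unfolding wedge_with_def by (simp add: sum.union_disjoint)
  also have "sum ?t ((\<lambda>S. insert 0 (Suc ` S)) ` Pow {..<?n}) =
      (\<Sum>S\<in>Pow {..<?n}. ?t (insert 0 (Suc ` S)))"
  proof (rule sum.reindex[unfolded comp_def])
    show "inj_on (\<lambda>S. insert 0 (Suc ` S)) (Pow {..<?n})" by (auto simp: inj_on_def)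
  qed
  also have "\<dots> = wedge (contraction X \<omega>) \<omega>' Xs p"
    unfolding wedge_with_def
    by (intro sum.cong refl)
      (simp add: nths_Cons_image shuffle_sign_Suc finite_subset[OF _ finite_lessThan] contraction_apply)
  also have "sum ?t ((`) Suc ` Pow {..<?n}) = (\<Sum>S\<in>Pow {..<?n}. ?t (Suc ` S))"
  proof (rule sum.reindex[unfolded comp_def])
    show "inj_on ((`) Suc) (Pow {..<?n})" by (auto simp: inj_on_def)
  qed
  also have "\<dots> = wedge (parity \<omega>) (contraction X \<omega>') Xs p"
    unfolding wedge_with_def
  proof (intro sum.cong refl)
    fix S assume "S \<in> Pow {..<?n}"
    then have S: "S \<subseteq> {..<?n}" by simp
    then have "{i. i < ?n \<and> i \<in> S} = S" by auto
    then show "?t (Suc ` S) = shuffle_sign S *\<^sub>R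
        (parity \<omega> (nths Xs S) p * contraction X \<omega>' (nths Xs (- S)) p)"
      by (simp add: nths_Cons_image shuffle_sign_Suc finite_subset[OF S] length_nths contraction_apply parity_apply)
  qed
  finally show ?thesis by simp
qed

lemma contraction_wedge:
  "contraction X (wedge \<omega> \<omega>') = wedge (contraction X \<omega>) \<omega>' + wedge (parity \<omega>) (contraction X \<omega>')"
  by (simp add: fun_eq_iff contraction_apply parity_apply wedge_Cons)

lemma wedge_add_left: "wedge (a + b) c = wedge a c + wedge b c"
  by (simp add: fun_eq_iff wedge_with_def algebra_simps sum.distrib)

lemma wedge_add_right: "wedge a (b + c) = wedge a b + wedge a c"
  by (simp add: fun_eq_iff wedge_with_def algebra_simps sum.distrib)

lemma wedge_0_left [simp]: "wedge 0 a = 0"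
  by (simp add: fun_eq_iff wedge_with_def)

lemma wedge_0_right [simp]: "wedge a 0 = 0"
  by (simp add: fun_eq_iff wedge_with_def)

lemma wedge_uminus_left: "wedge (- a) b = - wedge a b"
  by (simp add: fun_eq_iff wedge_with_def sum_negf)

lemma wedge_uminus_right: "wedge a (- b) = - wedge a b"
  by (simp add: fun_eq_iff wedge_with_def sum_negf)

lemma contraction_add: "contraction X (a + b) = contraction X a + contraction X b"
  by (simp add: fun_eq_iff contraction_apply parity_apply)

lemma contraction_uminus: "contraction X (- a) = - contraction X a"
  by (simp add: fun_eq_iff contraction_apply parity_apply)

lemma contraction_0 [simp]: "contraction X 0 = 0"
  by (simp add: fun_eq_iff contraction_apply parity_apply)

lemma parity_parity [simp]: "parity (parity a) = a"
  by (simp add: fun_eq_iff contraction_apply parity_apply power_add[symmetric] mult.assoc[symmetric])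

lemma contraction_parity: "contraction X (parity a) = - parity (contraction X a)"
  by (simp add: fun_eq_iff contraction_apply parity_apply)

lemma parity_wedge: "parity (wedge a b) = wedge (parity a) (parity b)"
proof -
  have "parity (wedge a b) Xs p = wedge (parity a) (parity b) Xs p" for Xs p
  proof (induction Xs arbitrary: a b)
    case Nil
    then show ?case by (simp add: wedge_Nil parity_apply)
  next
    case (Cons X Xs)
    have "parity (wedge a b) (X # Xs) p =
      - parity (wedge (contraction X a) b) Xs p - parity (wedge (parity a) (contraction X b)) Xs p"
      by (simp add: wedge_Cons parity_apply algebra_simps)
    then show ?case
      unfolding Cons.IH
      by (simp add: wedge_Cons contraction_parity wedge_uminus_left wedge_uminus_right)
  qed
  then show ?thesis by (simp add: fun_eq_iff)
qed

lemma wedge_assoc: "wedge (wedge a b) c = wedge a (wedge b c)"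
proof -
  have "wedge (wedge a b) c Xs p = wedge a (wedge b c) Xs p" for Xs p
  proof (induction Xs arbitrary: a b c)
    case Nil
    then show ?case by (simp add: wedge_Nil)
  next
    case (Cons X Xs)
    then show ?case
      by (simp add: wedge_Cons contraction_wedge parity_wedge wedge_add_left wedge_add_right)
  qed
  then show ?thesis by (simp add: fun_eq_iff)
qed

lemma homogeneousD: "homogeneous k a \<Longrightarrow> length Xs \<noteq> k \<Longrightarrow> a Xs = 0"
  unfolding homogeneous_def by blast

lemma homogeneous_contraction: "homogeneous (Suc k) a \<Longrightarrow> homogeneous k (contraction X a)"
  unfolding homogeneous_def by (metis contraction_apply length_Cons nat.inject)

lemma homogeneous_add: "homogeneous k a \<Longrightarrow> homogeneous k b \<Longrightarrow> homogeneous k (a + b)"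
  unfolding homogeneous_def by simp

lemma contraction_homogeneous_0: "homogeneous 0 a \<Longrightarrow> contraction X a = 0"
  unfolding homogeneous_def by (simp add: fun_eq_iff contraction_apply)

lemma parity_homogeneous: "homogeneous k a \<Longrightarrow> parity a = (- 1) ^ k *\<^sub>R a"
proof -
  assume "homogeneous k a"
  then have "parity a Xs p = (- 1) ^ k * a Xs p" for Xs p
    using homogeneousD[of k a Xs] by (cases "length Xs = k") (auto simp: parity_apply)
  then show ?thesis by (simp add: fun_eq_iff)
qed

lemma wedge_homogeneous_0:
  assumes "homogeneous 0 a"
  shows "wedge a b Xs p = a [] p * b Xs p" "wedge b a Xs p = a [] p * b Xs p"
  by (induction Xs arbitrary: b)
    (simp_all add: wedge_Nil wedge_Cons contraction_homogeneous_0[OF assms]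
      parity_homogeneous[OF assms] contraction_apply)

text \<open>In the induction step the contraction of a with X has degree 0, and wedging with it is
  multiplication by a function. Writing the sign as \<open>parity b\<close> admits b of mixed
  degree.\<close>

lemma wedge_commute_1:
  assumes "homogeneous 1 a"
  shows "wedge a b = wedge (parity b) a"
proof -
  have pa: "parity a = - a" using parity_homogeneous[OF assms] by simp
  have "wedge a b Xs p = wedge (parity b) a Xs p" for Xs p
  proof (induction Xs arbitrary: b)
    case Nil
    then show ?case by (simp add: wedge_Nil parity_apply)
  next
    case (Cons X Xs)
    have h: "homogeneous 0 (contraction X a)" using assms by (simp add: homogeneous_contraction)
    have "wedge a (contraction X b) Xs p = wedge (parity (contraction X b)) a Xs p"
      by (rule Cons.IH)
    then show ?case
      unfolding wedge_Cons
      by (simp add: pa wedge_uminus_left contraction_parity wedge_homogeneous_0[OF h] parity_apply)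
  qed
  then show ?thesis by (simp add: fun_eq_iff)
qed

lemma wedge_commute_1_homogeneous:
  assumes "homogeneous 1 a" "homogeneous k b"
  shows "wedge a (wedge b c) = (- 1) ^ k *\<^sub>R wedge b (wedge a c)"
proof -
  have "wedge a (wedge b c) = wedge (wedge (parity b) a) c"
    by (simp add: wedge_assoc[symmetric] wedge_commute_1[OF assms(1)])
  also have "\<dots> = (- 1) ^ k *\<^sub>R wedge b (wedge a c)"
    unfolding parity_homogeneous[OF assms(2)] wedge_assoc
    by (simp add: fun_eq_iff wedge_with_def sum_distrib_left algebra_simps)
  finally show ?thesis .
qed


section \<open>Vector fields and differential forms\<close>

lemma vf_bracket_self: "vf_bracket X X = 0"
  by (simp add: vf_bracket_def fun_eq_iff)

lemma vf_bracket_uminus_swap: "vf_bracket X Y = - vf_bracket Y X"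
  by (simp add: vf_bracket_def fun_eq_iff)

context manifold
begin

lemma VF_tangent: "X \<in> VF \<Longrightarrow> X p \<in> T p"
  unfolding vector_fields_def by blast

lemma VF_smooth: "X \<in> VF \<Longrightarrow> f \<in> SF \<Longrightarrow> (\<lambda>p. X p f) \<in> SF"
  unfolding vector_fields_def by blast

lemma VF_not_smooth: "X \<in> VF \<Longrightarrow> f \<notin> SF \<Longrightarrow> X p f = 0"
  using tangent_not_smooth[OF VF_tangent] .

lemma VF_lincomb:
  assumes "X \<in> VF" "Y \<in> VF" "f \<in> SF" "h \<in> SF"
  shows "(\<lambda>p. f p *\<^sub>R X p + h p *\<^sub>R Y p) \<in> VF"
  unfolding vector_fields_def
proof (intro CollectI conjI allI ballI)
  show "f p *\<^sub>R X p + h p *\<^sub>R Y p \<in> T p" for p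
    by (rule tangent_space_lincomb[OF VF_tangent[OF assms(1)] VF_tangent[OF assms(2)]])
  fix k assume k: "k \<in> SF"
  have "(\<lambda>p. f p * X p k + h p * Y p k) \<in> SF"
    by (rule SF_add[OF SF_mult[OF assms(3) VF_smooth[OF assms(1) k]] SF_mult[OF assms(4) VF_smooth[OF assms(2) k]]])
  then show "(\<lambda>p. (f p *\<^sub>R X p + h p *\<^sub>R Y p) k) \<in> SF" by simp
qed

lemma VF_0: "0 \<in> VF"
  unfolding vector_fields_def using tangent_space_0 by auto

lemma VF_add: "X \<in> VF \<Longrightarrow> Y \<in> VF \<Longrightarrow> X + Y \<in> VF"
  using VF_lincomb[of X Y "\<lambda>_. 1" "\<lambda>_. 1"] by (simp add: plus_fun_def)

lemma VF_uminus: "X \<in> VF \<Longrightarrow> - X \<in> VF"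
  using VF_lincomb[of X X "\<lambda>_. -1" "\<lambda>_. 0"] by (simp add: fun_Compl_def)

lemma VF_bracket:
  assumes X: "X \<in> VF" and Y: "Y \<in> VF"
  shows "vf_bracket X Y \<in> VF"
  unfolding vector_fields_def
proof (intro CollectI conjI allI ballI)
  note s = VF_smooth[OF X] VF_smooth[OF Y]
  fix p
  note t = VF_tangent[OF X] VF_tangent[OF Y]
  show "vf_bracket X Y p \<in> T p"
    unfolding tangent_space_def
  proof (intro CollectI conjI allI ballI impI)
    fix f assume "f \<notin> SF"
    then show "vf_bracket X Y p f = 0"
      by (simp add: vf_bracket_def VF_not_smooth[OF X] VF_not_smooth[OF Y] tangent_const[OF t(1)]
          tangent_const[OF t(2)])
  next
    fix f h assume fh: "f \<in> SF" "h \<in> SF"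
    show "vf_bracket X Y p (\<lambda>x. a * f x + b * h x) = a * vf_bracket X Y p f + b * vf_bracket X Y p h" for a b
      by (simp add: vf_bracket_def tangent_lincomb[OF t(1)] tangent_lincomb[OF t(2)] fh s algebra_simps)
    have "X p (\<lambda>q. Y q (\<lambda>x. f x * h x)) = X p (\<lambda>q. f q * Y q h + h q * Y q f)"
      by (simp add: tangent_mult[OF t(2) fh])
    also have "\<dots> = f p * X p (\<lambda>q. Y q h) + Y p h * X p f + h p * X p (\<lambda>q. Y q f) + Y p f * X p h"
      by (simp add: tangent_add[OF t(1)] tangent_mult[OF t(1)] SF_mult fh s)
    finally have 1: "X p (\<lambda>q. Y q (\<lambda>x. f x * h x)) =
        f p * X p (\<lambda>q. Y q h) + Y p h * X p f + h p * X p (\<lambda>q. Y q f) + Y p f * X p h" .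
    have "Y p (\<lambda>q. X q (\<lambda>x. f x * h x)) = Y p (\<lambda>q. f q * X q h + h q * X q f)"
      by (simp add: tangent_mult[OF t(1) fh])
    also have "\<dots> = f p * Y p (\<lambda>q. X q h) + X p h * Y p f + h p * Y p (\<lambda>q. X q f) + X p f * Y p h"
      by (simp add: tangent_add[OF t(2)] tangent_mult[OF t(2)] SF_mult fh s)
    finally show "vf_bracket X Y p (\<lambda>x. f x * h x) = f p * vf_bracket X Y p h + h p * vf_bracket X Y p f"
      unfolding vf_bracket_def 1 by (simp add: algebra_simps)
  qed
next
  fix f assume f: "f \<in> SF"
  have "(\<lambda>p. X p (\<lambda>q. Y q f) - Y p (\<lambda>q. X q f)) \<in> SF"
    using VF_smooth[OF X VF_smooth[OF Y f]] VF_smooth[OF Y VF_smooth[OF X f]] by (rule SF_diff)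
  then show "(\<lambda>p. vf_bracket X Y p f) \<in> SF" by (simp add: vf_bracket_def)
qed

text \<open>The factors 1 keep the right-hand side in the pattern f X + h Y at both levels, so that
  the linearity rules for forms apply to it directly.\<close>

lemma vf_bracket_lincomb:
  assumes X: "X \<in> VF" and Y: "Y \<in> VF" and Z: "Z \<in> VF" and f: "f \<in> SF" "h \<in> SF"
  shows "vf_bracket X (\<lambda>p. f p *\<^sub>R Y p + h p *\<^sub>R Z p) =
    (\<lambda>p. 1 *\<^sub>R (f p *\<^sub>R vf_bracket X Y p + h p *\<^sub>R vf_bracket X Z p)
       + 1 *\<^sub>R (X p f *\<^sub>R Y p + X p h *\<^sub>R Z p))"
proof (intro ext)
  fix p k
  note t = VF_tangent[OF X] VF_tangent[OF Y] VF_tangent[OF Z]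
  show "vf_bracket X (\<lambda>p. f p *\<^sub>R Y p + h p *\<^sub>R Z p) p k =
    (1 *\<^sub>R (f p *\<^sub>R vf_bracket X Y p + h p *\<^sub>R vf_bracket X Z p)
       + 1 *\<^sub>R (X p f *\<^sub>R Y p + X p h *\<^sub>R Z p)) k"
  proof (cases "k \<in> SF")
    case True
    note s = VF_smooth[OF X True] VF_smooth[OF Y True] VF_smooth[OF Z True]
    have "X p (\<lambda>q. f q * Y q k + h q * Z q k) =
      f p * X p (\<lambda>q. Y q k) + Y p k * X p f + h p * X p (\<lambda>q. Z q k) + Z p k * X p h"
      by (simp add: tangent_add[OF t(1)] tangent_mult[OF t(1)] SF_mult f s)
    then show ?thesis by (simp add: vf_bracket_def algebra_simps)
  next
    case False
    then show ?thesis
      by (simp add: vf_bracket_def VF_not_smooth[OF X] VF_not_smooth[OF Y] VF_not_smooth[OF Z]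
          tangent_const[OF t(1)] tangent_const[OF t(2)] tangent_const[OF t(3)])
  qed
qed

abbreviation "\<Omega> \<equiv> forms A"

lemma form_vanish: "\<omega> \<in> \<Omega> \<Longrightarrow> \<not> set Xs \<subseteq> VF \<Longrightarrow> \<omega> Xs = 0"
  unfolding forms_def by blast

lemma form_smooth: "\<omega> \<in> \<Omega> \<Longrightarrow> set Xs \<subseteq> VF \<Longrightarrow> \<omega> Xs \<in> SF"
  unfolding forms_def by blast

lemma form_lincomb: "\<omega> \<in> \<Omega> \<Longrightarrow> set (Xs @ X # Y # Ys) \<subseteq> VF \<Longrightarrow> f \<in> SF \<Longrightarrow> h \<in> SF \<Longrightarrow>
    \<omega> (Xs @ (\<lambda>p. f p *\<^sub>R X p + h p *\<^sub>R Y p) # Ys) =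
      (\<lambda>p. f p * \<omega> (Xs @ X # Ys) p + h p * \<omega> (Xs @ Y # Ys) p)"
  unfolding forms_def by blast

lemma form_alternating: "\<omega> \<in> \<Omega> \<Longrightarrow> set (Xs @ X # Ys @ Zs) \<subseteq> VF \<Longrightarrow> \<omega> (Xs @ X # Ys @ X # Zs) = 0"
  unfolding forms_def by blast

text \<open>Polarisation: expand the vanishing value at (X + Y, X + Y). Linearity is a hypothesis
  because \<open>formsI\<close> applies this to a function that is not yet known to be a
  form.\<close>

lemma adjacent_alternating_swap:
  assumes lin: "\<And>X Y Z. X \<in> VF \<Longrightarrow> Y \<in> VF \<Longrightarrow> Z \<in> VF \<Longrightarrow> set Xs \<subseteq> VF \<Longrightarrow> set Ys \<subseteq> VF \<Longrightarrow>
      \<omega> (Xs @ X # (Y + Z) # Ys) = \<omega> (Xs @ X # Y # Ys) + (\<omega> (Xs @ X # Z # Ys) :: 'm \<Rightarrow> real)"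
    and lin': "\<And>X Y Z. X \<in> VF \<Longrightarrow> Y \<in> VF \<Longrightarrow> Z \<in> VF \<Longrightarrow> set Xs \<subseteq> VF \<Longrightarrow> set Ys \<subseteq> VF \<Longrightarrow>
      \<omega> (Xs @ (X + Y) # Z # Ys) = \<omega> (Xs @ X # Z # Ys) + \<omega> (Xs @ Y # Z # Ys)"
    and alt: "\<And>X. X \<in> VF \<Longrightarrow> set Xs \<subseteq> VF \<Longrightarrow> set Ys \<subseteq> VF \<Longrightarrow> \<omega> (Xs @ X # X # Ys) = 0"
    and VF: "X \<in> VF" "Y \<in> VF" "set Xs \<subseteq> VF" "set Ys \<subseteq> VF"
  shows "\<omega> (Xs @ X # Y # Ys) = - \<omega> (Xs @ Y # X # Ys)"
proof -
  have "0 = \<omega> (Xs @ (X + Y) # (X + Y) # Ys)" using alt[OF VF_add] VF by simp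
  also have "\<dots> = \<omega> (Xs @ X # X # Ys) + \<omega> (Xs @ Y # X # Ys) + \<omega> (Xs @ X # Y # Ys) + \<omega> (Xs @ Y # Y # Ys)"
    using VF by (simp add: lin lin' VF_add add_ac)
  also have "\<dots> = \<omega> (Xs @ Y # X # Ys) + \<omega> (Xs @ X # Y # Ys)"
    using alt VF by simp
  finally show ?thesis by (simp add: eq_neg_iff_add_eq_0 add.commute)
qed

text \<open>Only equal neighbours have to be checked: neighbouring arguments anticommute by
  polarisation, and swaps bring two equal arguments together.\<close>

lemma formsI:
  assumes van: "\<And>Xs. \<not> set Xs \<subseteq> VF \<Longrightarrow> \<omega> Xs = 0"
    and sm: "\<And>Xs. set Xs \<subseteq> VF \<Longrightarrow> \<omega> Xs \<in> SF"
    and lin: "\<And>Xs X Y Ys f h. set Xs \<subseteq> VF \<Longrightarrow> X \<in> VF \<Longrightarrow> Y \<in> VF \<Longrightarrow> set Ys \<subseteq> VF \<Longrightarrow> f \<in> SF \<Longrightarrow> h \<in> SF \<Longrightarrow>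
      \<omega> (Xs @ (\<lambda>p. f p *\<^sub>R X p + h p *\<^sub>R Y p) # Ys) =
        (\<lambda>p. f p * \<omega> (Xs @ X # Ys) p + h p * \<omega> (Xs @ Y # Ys) p)"
    and alt: "\<And>Xs X Zs. set Xs \<subseteq> VF \<Longrightarrow> X \<in> VF \<Longrightarrow> set Zs \<subseteq> VF \<Longrightarrow> \<omega> (Xs @ X # X # Zs) = 0"
  shows "\<omega> \<in> \<Omega>"
proof -
  have add: "\<omega> (Xs @ (X + Y) # Ys) = \<omega> (Xs @ X # Ys) + \<omega> (Xs @ Y # Ys)"
    if "X \<in> VF" "Y \<in> VF" "set Xs \<subseteq> VF" "set Ys \<subseteq> VF" for X Y Xs Ys
    using lin[OF that(3,1,2,4) SF_const SF_const, of 1 1] by (simp add: plus_fun_def)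
  have swap: "\<omega> (Xs @ X # Y # Ys) = - \<omega> (Xs @ Y # X # Ys)"
    if "X \<in> VF" "Y \<in> VF" "set Xs \<subseteq> VF" "set Ys \<subseteq> VF" for X Y Xs Ys
  proof (rule adjacent_alternating_swap[OF _ _ _ that])
    show "\<omega> (Xs @ X # (Y + Z) # Ys) = \<omega> (Xs @ X # Y # Ys) + \<omega> (Xs @ X # Z # Ys)"
      if "X \<in> VF" "Y \<in> VF" "Z \<in> VF" "set Xs \<subseteq> VF" "set Ys \<subseteq> VF" for X Y Z
      using add[of Y Z "Xs @ [X]" Ys] that by simp
    show "\<omega> (Xs @ (X + Y) # Z # Ys) = \<omega> (Xs @ X # Z # Ys) + \<omega> (Xs @ Y # Z # Ys)"
      if "X \<in> VF" "Y \<in> VF" "Z \<in> VF" "set Xs \<subseteq> VF" "set Ys \<subseteq> VF" for X Y Z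
      using add[of X Y Xs "Z # Ys"] that by simp
  qed (use alt in auto)
  have alt': "\<omega> (Xs @ X # Ys @ X # Zs) = 0"
    if "set Xs \<subseteq> VF" "X \<in> VF" "set Ys \<subseteq> VF" "set Zs \<subseteq> VF" for Xs X Ys Zs
    using that
  proof (induction Ys arbitrary: Xs)
    case Nil
    then show ?case using alt by simp
  next
    case (Cons Y Ys)
    have "\<omega> (Xs @ X # Y # Ys @ X # Zs) = - \<omega> (Xs @ Y # X # Ys @ X # Zs)"
      by (rule swap) (use Cons.prems in auto)
    also have "\<omega> (Xs @ Y # X # Ys @ X # Zs) = 0"
      using Cons.IH[of "Xs @ [Y]"] Cons.prems by (simp add: fun_eq_iff)
    finally show ?case by (simp add: fun_eq_iff)
  qed
  show ?thesis
    unfolding forms_def using van sm lin alt' by simp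
qed

lemma form_add: "\<omega> \<in> \<Omega> \<Longrightarrow> X \<in> VF \<Longrightarrow> Y \<in> VF \<Longrightarrow> set Xs \<subseteq> VF \<Longrightarrow> set Ys \<subseteq> VF \<Longrightarrow>
    \<omega> (Xs @ (X + Y) # Ys) = \<omega> (Xs @ X # Ys) + \<omega> (Xs @ Y # Ys)"
  using form_lincomb[of \<omega> Xs X Y Ys "\<lambda>_. 1" "\<lambda>_. 1"] by (simp add: plus_fun_def)

lemma form_swap:
  assumes \<omega>: "\<omega> \<in> \<Omega>" and "X \<in> VF" "Y \<in> VF" "set Ys \<subseteq> VF"
  shows "\<omega> (X # Y # Ys) = - \<omega> (Y # X # Ys)"
proof -
  have "\<omega> ([] @ X # Y # Ys) = - \<omega> ([] @ Y # X # Ys)"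
  proof (rule adjacent_alternating_swap)
    show "\<omega> ([] @ X # (Y + Z) # Ys) = \<omega> ([] @ X # Y # Ys) + \<omega> ([] @ X # Z # Ys)"
      if "X \<in> VF" "Y \<in> VF" "Z \<in> VF" "set [] \<subseteq> VF" "set Ys \<subseteq> VF" for X Y Z
      using form_add[OF \<omega>, of Y Z "[X]" Ys] that by simp
    show "\<omega> ([] @ (X + Y) # Z # Ys) = \<omega> ([] @ X # Z # Ys) + \<omega> ([] @ Y # Z # Ys)"
      if "X \<in> VF" "Y \<in> VF" "Z \<in> VF" "set [] \<subseteq> VF" "set Ys \<subseteq> VF" for X Y Z
      using form_add[OF \<omega>, of X Y "[]" "Z # Ys"] that by simp
    show "\<omega> ([] @ X # X # Ys) = 0" if "X \<in> VF" "set [] \<subseteq> VF" "set Ys \<subseteq> VF" for X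
      using form_alternating[OF \<omega>, of "[]" X "[]" Ys] that by simp
  qed (use assms in auto)
  then show ?thesis by simp
qed

lemma contraction_forms:
  assumes "\<omega> \<in> \<Omega>" "X \<in> VF"
  shows "contraction X \<omega> \<in> \<Omega>"
proof (rule formsI)
  show "contraction X \<omega> Xs = 0" if "\<not> set Xs \<subseteq> VF" for Xs
    using form_vanish[OF assms(1), of "X # Xs"] that by (simp add: contraction_apply fun_eq_iff)
  show "contraction X \<omega> Xs \<in> SF" if "set Xs \<subseteq> VF" for Xs
    unfolding contraction_apply using form_smooth[OF assms(1), of "X # Xs"] that assms(2) by simp
  show "contraction X \<omega> (Xs @ (\<lambda>p. f p *\<^sub>R Y p + h p *\<^sub>R Z p) # Ys) =
        (\<lambda>p. f p * contraction X \<omega> (Xs @ Y # Ys) p + h p * contraction X \<omega> (Xs @ Z # Ys) p)"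
    if "set Xs \<subseteq> VF" "Y \<in> VF" "Z \<in> VF" "set Ys \<subseteq> VF" "f \<in> SF" "h \<in> SF" for Xs Y Z Ys f h
    using form_lincomb[OF assms(1), of "X # Xs" Y Z Ys f h] that assms by (simp add: contraction_apply fun_eq_iff)
  show "contraction X \<omega> (Xs @ Y # Y # Zs) = 0" if "set Xs \<subseteq> VF" "Y \<in> VF" "set Zs \<subseteq> VF" for Xs Y Zs
    using form_alternating[OF assms(1), of "X # Xs" Y "[]" Zs] that assms by (simp add: contraction_apply fun_eq_iff)
qed

lemma forms_add:
  assumes "a \<in> \<Omega>" "b \<in> \<Omega>"
  shows "a + b \<in> \<Omega>"
proof (rule formsI)
  show "(a + b) Xs = 0" if "\<not> set Xs \<subseteq> VF" for Xs
    using form_vanish[OF assms(1) that] form_vanish[OF assms(2) that] by simp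
  show "(a + b) Xs \<in> SF" if "set Xs \<subseteq> VF" for Xs
    using SF_add[OF form_smooth[OF assms(1) that] form_smooth[OF assms(2) that]] by (simp add: plus_fun_def)
  show "(a + b) (Xs @ (\<lambda>p. f p *\<^sub>R Y p + h p *\<^sub>R Z p) # Ys) =
        (\<lambda>p. f p * (a + b) (Xs @ Y # Ys) p + h p * (a + b) (Xs @ Z # Ys) p)"
    if "set Xs \<subseteq> VF" "Y \<in> VF" "Z \<in> VF" "set Ys \<subseteq> VF" "f \<in> SF" "h \<in> SF" for Xs Y Z Ys f h
    using form_lincomb[OF assms(1), of Xs Y Z Ys f h] form_lincomb[OF assms(2), of Xs Y Z Ys f h] that
    by (simp add: fun_eq_iff algebra_simps)
  show "(a + b) (Xs @ Y # Y # Zs) = 0" if "set Xs \<subseteq> VF" "Y \<in> VF" "set Zs \<subseteq> VF" for Xs Y Zs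
    using form_alternating[OF assms(1), of Xs Y "[]" Zs] form_alternating[OF assms(2), of Xs Y "[]" Zs] that
    by simp
qed

lemma parity_forms:
  assumes "a \<in> \<Omega>"
  shows "parity a \<in> \<Omega>"
proof (rule formsI)
  show "parity a Xs = 0" if "\<not> set Xs \<subseteq> VF" for Xs
    using form_vanish[OF assms(1) that] by (simp add: fun_eq_iff parity_apply)
  show "parity a Xs \<in> SF" if "set Xs \<subseteq> VF" for Xs
    unfolding parity_def by (rule SF_mult[OF SF_const form_smooth[OF assms that]])
  show "parity a (Xs @ (\<lambda>p. f p *\<^sub>R Y p + h p *\<^sub>R Z p) # Ys) =
        (\<lambda>p. f p * parity a (Xs @ Y # Ys) p + h p * parity a (Xs @ Z # Ys) p)"
    if "set Xs \<subseteq> VF" "Y \<in> VF" "Z \<in> VF" "set Ys \<subseteq> VF" "f \<in> SF" "h \<in> SF" for Xs Y Z Ys f h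
    using form_lincomb[OF assms(1), of Xs Y Z Ys f h] that
    by (simp add: fun_eq_iff parity_apply algebra_simps)
  show "parity a (Xs @ Y # Y # Zs) = 0" if "set Xs \<subseteq> VF" "Y \<in> VF" "set Zs \<subseteq> VF" for Xs Y Zs
    using form_alternating[OF assms(1), of Xs Y "[]" Zs] that
    by (simp add: fun_eq_iff parity_apply)
qed

text \<open>The point p is fixed throughout, so c and d can be the values at p of coefficient
  functions.\<close>

lemma wedge_lincomb:
  assumes "\<And>Zs. a Zs p = c * a1 Zs p + d * a2 Zs p"
  shows "wedge a b Xs p = c * wedge a1 b Xs p + d * wedge a2 b Xs p"
    "wedge b a Xs p = c * wedge b a1 Xs p + d * wedge b a2 Xs p"
  by (simp_all add: wedge_with_def assms algebra_simps sum.distrib sum_distrib_left)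

text \<open>For arbitrary functions that vanish off vector fields, since it is also applied to
  \<open>lie_derivative\<close> and \<open>ext_deriv\<close> of forms.\<close>

lemma wedge_vanish:
  assumes "\<And>Xs. \<not> set Xs \<subseteq> VF \<Longrightarrow> a Xs = 0" "\<And>Xs. \<not> set Xs \<subseteq> VF \<Longrightarrow> b Xs = 0" "\<not> set Xs \<subseteq> VF"
  shows "wedge a b Xs p = 0"
  using assms
proof (induction Xs arbitrary: a b)
  case (Cons X Xs)
  show ?case
  proof (cases "X \<in> VF")
    case True
    then have n: "\<not> set Xs \<subseteq> VF" using Cons.prems(3) by simp
    have "wedge (contraction X a) b Xs p = 0"
      by (rule Cons.IH[OF _ _ n]) (use Cons.prems True in \<open>auto simp: contraction_apply\<close>)
    moreover have "wedge (parity a) (contraction X b) Xs p = 0"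
      by (rule Cons.IH[OF _ _ n])
        (use Cons.prems True in \<open>auto simp: contraction_apply parity_apply fun_eq_iff\<close>)
    ultimately show ?thesis by (simp add: wedge_Cons)
  next
    case False
    then have "contraction X a = 0" "contraction X b = 0"
      using Cons.prems(1,2)[of "X # Ys" for Ys] by (auto simp: fun_eq_iff contraction_apply)
    then show ?thesis by (simp add: wedge_Cons)
  qed
qed simp

text \<open>Linearity and alternation are proved by stripping arguments with
  \<open>wedge_Cons\<close>, for all pairs of forms at once, until the altered or repeated argument
  is in front.\<close>

lemma wedge_forms:
  assumes "a \<in> \<Omega>" "b \<in> \<Omega>"
  shows "wedge a b \<in> \<Omega>"
proof (rule formsI)
  show "wedge a b Xs = 0" if "\<not> set Xs \<subseteq> VF" for Xs
    using wedge_vanish[OF form_vanish[OF assms(1)] form_vanish[OF assms(2)] that] by (simp add: fun_eq_iff)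
  show "wedge a b Xs \<in> SF" if "set Xs \<subseteq> VF" for Xs
    using assms that
  proof (induction Xs arbitrary: a b)
    case Nil
    have "wedge a b [] = (\<lambda>p. a [] p * b [] p)" by (simp add: fun_eq_iff wedge_Nil)
    then show ?case using SF_mult form_smooth[OF Nil.prems(1)] form_smooth[OF Nil.prems(2)] by simp
  next
    case (Cons X Xs)
    have "wedge a b (X # Xs) = (\<lambda>p. wedge (contraction X a) b Xs p + wedge (parity a) (contraction X b) Xs p)"
      by (simp add: fun_eq_iff wedge_Cons)
    moreover have "(\<lambda>p. wedge (contraction X a) b Xs p + wedge (parity a) (contraction X b) Xs p) \<in> SF"
      by (intro SF_add Cons.IH contraction_forms parity_forms) (use Cons.prems in auto)
    ultimately show ?case by simp
  qed
  show "wedge a b (Xs @ (\<lambda>p. f p *\<^sub>R X p + h p *\<^sub>R Y p) # Ys) =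
        (\<lambda>p. f p * wedge a b (Xs @ X # Ys) p + h p * wedge a b (Xs @ Y # Ys) p)"
    if "set Xs \<subseteq> VF" "X \<in> VF" "Y \<in> VF" "set Ys \<subseteq> VF" "f \<in> SF" "h \<in> SF" for Xs X Y Ys f h
    using assms that
  proof (induction Xs arbitrary: a b)
    case Nil
    let ?Z = "\<lambda>p. f p *\<^sub>R X p + h p *\<^sub>R Y p"
    have Z: "?Z \<in> VF" using VF_lincomb Nil.prems by blast
    have c: "contraction ?Z w Zs p = f p * contraction X w Zs p + h p * contraction Y w Zs p"
      if "w \<in> \<Omega>" for w Zs p
    proof (cases "set Zs \<subseteq> VF")
      case True
      then show ?thesis using form_lincomb[OF that, of "[]" X Y Zs f h] Nil.prems by (simp add: contraction_apply)
    next
      case False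
      then show ?thesis using form_vanish[OF that, of "V # Zs" for V] by (simp add: contraction_apply)
    qed
    show ?case
    proof
      fix p
      note w = wedge_lincomb(1)[of "contraction ?Z a" p "f p" "contraction X a" "h p" "contraction Y a", OF c[OF Nil.prems(1)]]
        wedge_lincomb(2)[of "contraction ?Z b" p "f p" "contraction X b" "h p" "contraction Y b", OF c[OF Nil.prems(2)]]
      show "wedge a b ([] @ ?Z # Ys) p = f p * wedge a b ([] @ X # Ys) p + h p * wedge a b ([] @ Y # Ys) p"
        unfolding append_Nil wedge_Cons w by (simp add: algebra_simps)
    qed
  next
    case (Cons V Xs)
    have V: "V \<in> VF" "set Xs \<subseteq> VF" using Cons.prems by auto
    show ?case
      using Cons.IH[OF contraction_forms[OF Cons.prems(1) V(1)] Cons.prems(2) V(2) Cons.prems(4-)]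
        Cons.IH[OF parity_forms[OF Cons.prems(1)] contraction_forms[OF Cons.prems(2) V(1)] V(2) Cons.prems(4-)]
      by (simp add: fun_eq_iff wedge_Cons algebra_simps)
  qed
  show "wedge a b (Xs @ X # X # Zs) = 0" if "set Xs \<subseteq> VF" "X \<in> VF" "set Zs \<subseteq> VF" for Xs X Zs
    using assms that
  proof (induction Xs arbitrary: a b)
    case Nil
    have c: "contraction X (contraction X w) = 0" if "w \<in> \<Omega>" for w
    proof -
      have "w (X # X # Zs) = 0" for Zs
        using form_alternating[OF that, of "[]" X "[]" Zs] form_vanish[OF that, of "X # X # Zs"] Nil.prems
        by (cases "set Zs \<subseteq> VF") auto
      then show ?thesis by (simp add: fun_eq_iff contraction_apply)
    qed
    \<comment> \<open>The two mixed terms cancel because contraction anticommutes with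
      \<open>parity\<close>; the other two contain double contractions with X.\<close>
    show ?case
      by (simp add: fun_eq_iff wedge_Cons c[OF Nil.prems(1)] c[OF Nil.prems(2)] contraction_parity
          wedge_uminus_left)
  next
    case (Cons V Xs)
    have V: "V \<in> VF" "set Xs \<subseteq> VF" using Cons.prems by auto
    show ?case
      using Cons.IH[OF contraction_forms[OF Cons.prems(1) V(1)] Cons.prems(2) V(2) Cons.prems(4-)]
        Cons.IH[OF parity_forms[OF Cons.prems(1)] contraction_forms[OF Cons.prems(2) V(1)] V(2) Cons.prems(4-)]
      by (simp add: fun_eq_iff wedge_Cons)
  qed
qed

end


section \<open>Lie derivative, Cartan's formula and the Leibniz rules\<close>

subsection \<open>Cartan calculus\<close>

text \<open>Recursion on the arguments builds in the rule that the commutator of the Lie derivative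
  along X with contraction by Y is contraction by [X, Y]; the usual sum formula is
  \<open>lie_on_eq\<close>.\<close>

primrec lie_on :: "'m vfield \<Rightarrow> 'm vfield list \<Rightarrow> 'm form \<Rightarrow> 'm \<Rightarrow> real"
  where
    "lie_on X [] = (\<lambda>\<omega> p. X p (\<omega> []))"
  | "lie_on X (Y # Ys) =
      (\<lambda>\<omega> p. lie_on X Ys (contraction Y \<omega>) p - \<omega> (vf_bracket X Y # Ys) p)"

definition lie_derivative ::
    "('m::topological_space, 'e::real_normed_vector) chart set \<Rightarrow> 'm vfield \<Rightarrow> 'm form \<Rightarrow> 'm form"
  where "lie_derivative A X \<omega> = (\<lambda>Xs. if set Xs \<subseteq> vector_fields A then lie_on X Xs \<omega> else 0)"

context manifold
begin

abbreviation "\<L> \<equiv> lie_derivative A"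
abbreviation "\<d> \<equiv> ext_deriv A"

lemma lie_vanish: "\<not> set Xs \<subseteq> VF \<Longrightarrow> \<L> X \<omega> Xs = 0"
  by (simp add: lie_derivative_def)

lemma ext_deriv_vanish: "\<not> set Xs \<subseteq> VF \<Longrightarrow> \<d> \<omega> Xs p = 0"
  by (simp add: ext_deriv_def)

lemma ext_deriv_Nil: "\<d> \<omega> [] p = 0"
  by (simp add: ext_deriv_def)

text \<open>Unrolls the recursion; the signs arise when each bracket is moved to the front of the
  argument list.\<close>

lemma lie_on_eq:
  assumes X: "X \<in> VF"
  shows "\<omega> \<in> \<Omega> \<Longrightarrow> set Xs \<subseteq> VF \<Longrightarrow>
    lie_on X Xs \<omega> p = X p (\<omega> Xs) - (\<Sum>j<length Xs. (- 1) ^ j * \<omega> (vf_bracket X (Xs ! j) # nths Xs (- {j})) p)"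
proof (induction Xs arbitrary: \<omega>)
  case (Cons Y Ys)
  have VF: "Y \<in> VF" "set Ys \<subseteq> VF" using Cons.prems by auto
  have set_nths: "set (nths Ys I) \<subseteq> VF" for I by (rule order_trans[OF set_nths_subset VF(2)])
  have n0: "nths (Y # Ys) (- {0}) = Ys"
    using nths_Cons_image(2)[of Y Ys "{}"] by (simp add: nths_all)
  have nS: "nths (Y # Ys) (- {Suc j}) = Y # nths Ys (- {j})" for j
    using nths_Cons_image(4)[of Y Ys "{j}"] by simp
  have sw: "\<omega> (vf_bracket X (Ys ! j) # Y # nths Ys (- {j})) = - \<omega> (Y # vf_bracket X (Ys ! j) # nths Ys (- {j}))"
    if "j < length Ys" for j
    using that VF by (intro form_swap[OF Cons.prems(1)] VF_bracket[OF X] set_nths) auto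
  have "lie_on X (Y # Ys) \<omega> p = X p (\<omega> (Y # Ys)) -
     (\<Sum>j<length Ys. (- 1) ^ j * \<omega> (Y # vf_bracket X (Ys ! j) # nths Ys (- {j})) p) - \<omega> (vf_bracket X Y # Ys) p"
    using Cons.IH[OF contraction_forms[OF Cons.prems(1) VF(1)] VF(2)] by (simp add: contraction_def)
  also have "(\<Sum>j<length Ys. (- 1) ^ j * \<omega> (Y # vf_bracket X (Ys ! j) # nths Ys (- {j})) p) =
      (\<Sum>j<length Ys. (- 1) ^ Suc j * \<omega> (vf_bracket X ((Y # Ys) ! Suc j) # nths (Y # Ys) (- {Suc j})) p)"
    by (intro sum.cong refl) (simp add: nS sw)
  finally show ?case
    unfolding length_Cons sum.lessThan_Suc_shift by (simp add: n0)
qed simp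

text \<open>Koszul's sum splits by the role of X: the terms where X differentiates or enters a
  bracket make up the Lie derivative, the others give minus d of the contraction. Read as a
  recursion on the argument list, this drives the inductions for the rules about d below.\<close>

lemma Cartan:
  assumes \<omega>: "\<omega> \<in> \<Omega>" and X: "X \<in> VF"
  shows "\<d> \<omega> (X # Xs) p = \<L> X \<omega> Xs p - \<d> (contraction X \<omega>) Xs p"
proof (cases "set Xs \<subseteq> VF")
  case False
  then show ?thesis using lie_vanish[OF False] ext_deriv_vanish[OF False]
    by (simp add: ext_deriv_vanish)
next
  case VF: True
  let ?n = "length Xs"
  have set_nths: "set (nths Xs I) \<subseteq> VF" for I by (rule order_trans[OF set_nths_subset VF])
  have n0: "nths (X # Xs) (- {0}) = Xs"
    using nths_Cons_image(2)[of X Xs "{}"] by (simp add: nths_all)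
  have n0S: "nths (X # Xs) (- {0, Suc j}) = nths Xs (- {j})" for j
    using nths_Cons_image(2)[of X Xs "{j}"] by simp
  have nS: "nths (X # Xs) (- {Suc j}) = X # nths Xs (- {j})" for j
    using nths_Cons_image(4)[of X Xs "{j}"] by simp
  have nSS: "nths (X # Xs) (- {Suc i, Suc j}) = X # nths Xs (- {i, j})" for i j
    using nths_Cons_image(4)[of X Xs "{i, j}"] by simp
  have sw: "\<omega> (vf_bracket (Xs ! i) (Xs ! j) # X # nths Xs (- {i, j})) p =
      - \<omega> (X # vf_bracket (Xs ! i) (Xs ! j) # nths Xs (- {i, j})) p" if "j < ?n" "i < j" for i j
  proof -
    have "Xs ! i \<in> VF" "Xs ! j \<in> VF" using that VF by auto
    from form_swap[OF \<omega> VF_bracket[OF this] X set_nths] show ?thesis by simp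
  qed
  \<comment> \<open>The summand i = 0 carries the bracket of X with Xs ! j; in the others X is the
    second argument and is moved to the front at the cost of a sign.\<close>
  have inner: "(\<Sum>i<Suc j. (- 1) ^ (i + Suc j) *
        \<omega> (vf_bracket ((X # Xs) ! i) ((X # Xs) ! Suc j) # nths (X # Xs) (- {i, Suc j})) p) =
      (- 1) ^ Suc j * \<omega> (vf_bracket X (Xs ! j) # nths Xs (- {j})) p
        - (\<Sum>i<j. (- 1) ^ (i + j) * contraction X \<omega> (vf_bracket (Xs ! i) (Xs ! j) # nths Xs (- {i, j})) p)"
    if "j < ?n" for j
  proof -
    have "(\<Sum>i<j. (- 1) ^ (Suc i + Suc j) *
        \<omega> (vf_bracket ((X # Xs) ! Suc i) ((X # Xs) ! Suc j) # nths (X # Xs) (- {Suc i, Suc j})) p) =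
      (\<Sum>i<j. - ((- 1) ^ (i + j) * contraction X \<omega> (vf_bracket (Xs ! i) (Xs ! j) # nths Xs (- {i, j})) p))"
      by (intro sum.cong refl) (simp add: nSS contraction_apply sw[OF that])
    then show ?thesis
      unfolding sum.lessThan_Suc_shift by (simp add: n0S sum_negf)
  qed
  have "\<d> \<omega> (X # Xs) p =
      (\<Sum>i<Suc ?n. (- 1) ^ i * ((X # Xs) ! i) p (\<omega> (nths (X # Xs) (- {i})))) +
      (\<Sum>j<Suc ?n. \<Sum>i<j. (- 1) ^ (i + j) *
        \<omega> (vf_bracket ((X # Xs) ! i) ((X # Xs) ! j) # nths (X # Xs) (- {i, j})) p)"
    using X VF by (simp add: ext_deriv_def)
  also have "(\<Sum>i<Suc ?n. (- 1) ^ i * ((X # Xs) ! i) p (\<omega> (nths (X # Xs) (- {i})))) =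
      X p (\<omega> Xs) - (\<Sum>i<?n. (- 1) ^ i * (Xs ! i) p (contraction X \<omega> (nths Xs (- {i}))))"
    unfolding sum.lessThan_Suc_shift by (simp add: n0 nS contraction_apply sum_negf)
  also have "(\<Sum>j<Suc ?n. \<Sum>i<j. (- 1) ^ (i + j) *
        \<omega> (vf_bracket ((X # Xs) ! i) ((X # Xs) ! j) # nths (X # Xs) (- {i, j})) p) =
      (\<Sum>j<?n. (- 1) ^ Suc j * \<omega> (vf_bracket X (Xs ! j) # nths Xs (- {j})) p
        - (\<Sum>i<j. (- 1) ^ (i + j) * contraction X \<omega> (vf_bracket (Xs ! i) (Xs ! j) # nths Xs (- {i, j})) p))"
    unfolding sum.lessThan_Suc_shift[of _ ?n] using inner by simp
  also have "X p (\<omega> Xs) - (\<Sum>i<?n. (- 1) ^ i * (Xs ! i) p (contraction X \<omega> (nths Xs (- {i})))) +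
      (\<Sum>j<?n. (- 1) ^ Suc j * \<omega> (vf_bracket X (Xs ! j) # nths Xs (- {j})) p
        - (\<Sum>i<j. (- 1) ^ (i + j) * contraction X \<omega> (vf_bracket (Xs ! i) (Xs ! j) # nths Xs (- {i, j})) p)) =
      lie_on X Xs \<omega> p - \<d> (contraction X \<omega>) Xs p"
    using VF by (simp add: lie_on_eq[OF X \<omega> VF] ext_deriv_def sum_subtractf sum_negf)
  finally show ?thesis using VF by (simp add: lie_derivative_def)
qed

lemma lie_contraction:
  assumes "\<omega> \<in> \<Omega>" "Y \<in> VF"
  shows "contraction Y (\<L> X \<omega>) = \<L> X (contraction Y \<omega>) - contraction (vf_bracket X Y) \<omega>"
proof (intro ext)
  fix Xs p
  show "contraction Y (\<L> X \<omega>) Xs p = (\<L> X (contraction Y \<omega>) - contraction (vf_bracket X Y) \<omega>) Xs p"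
    using form_vanish[OF assms(1), of "vf_bracket X Y # Xs"] assms(2)
    by (cases "set Xs \<subseteq> VF") (auto simp: contraction_apply lie_derivative_def)
qed

lemma lie_on_add:
  "X \<in> VF \<Longrightarrow> a \<in> \<Omega> \<Longrightarrow> b \<in> \<Omega> \<Longrightarrow> set Xs \<subseteq> VF \<Longrightarrow>
    lie_on X Xs (a + b) p = lie_on X Xs a p + lie_on X Xs b p"
proof (induction Xs arbitrary: a b)
  case Nil
  then show ?case
    using tangent_add[OF VF_tangent form_smooth form_smooth, of X a "[]" b "[]"] by (simp add: plus_fun_def)
next
  case (Cons Y Ys)
  then have Y: "Y \<in> VF" "set Ys \<subseteq> VF" by auto
  have "lie_on X Ys (contraction Y a + contraction Y b) p =
      lie_on X Ys (contraction Y a) p + lie_on X Ys (contraction Y b) p"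
    by (rule Cons.IH) (use Cons.prems Y contraction_forms in auto)
  then show "lie_on X (Y # Ys) (a + b) p = lie_on X (Y # Ys) a p + lie_on X (Y # Ys) b p"
    by (simp add: contraction_add)
qed

lemma lie_add: "X \<in> VF \<Longrightarrow> a \<in> \<Omega> \<Longrightarrow> b \<in> \<Omega> \<Longrightarrow> \<L> X (a + b) = \<L> X a + \<L> X b"
  by (simp add: fun_eq_iff lie_derivative_def lie_on_add)

lemma lie_on_uminus:
  "X \<in> VF \<Longrightarrow> a \<in> \<Omega> \<Longrightarrow> set Xs \<subseteq> VF \<Longrightarrow> lie_on X Xs (- a) p = - lie_on X Xs a p"
proof (induction Xs arbitrary: a)
  case Nil
  then show ?case
    using tangent_uminus[OF VF_tangent form_smooth, of X a "[]"] by (simp add: fun_Compl_def)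
next
  case (Cons Y Ys)
  then have Y: "Y \<in> VF" "set Ys \<subseteq> VF" by auto
  have "lie_on X Ys (- contraction Y a) p = - lie_on X Ys (contraction Y a) p"
    by (rule Cons.IH) (use Cons.prems Y contraction_forms in auto)
  then show "lie_on X (Y # Ys) (- a) p = - lie_on X (Y # Ys) a p"
    by (simp add: contraction_uminus)
qed

lemma lie_parity:
  assumes "X \<in> VF" "a \<in> \<Omega>"
  shows "\<L> X (parity a) = parity (\<L> X a)"
proof -
  have "lie_on X Xs (parity a) p = (- 1) ^ length Xs * lie_on X Xs a p" if "set Xs \<subseteq> VF" for Xs p
    using assms that
  proof (induction Xs arbitrary: a)
    case Nil
    have "parity a [] = a []" by (simp add: fun_eq_iff parity_apply)
    then show ?case by simp
  next
    case (Cons Y Ys)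
    then have Y: "Y \<in> VF" "set Ys \<subseteq> VF" by auto
    note f = contraction_forms[OF Cons.prems(2) Y(1)]
    have "lie_on X Ys (parity (contraction Y a)) p = (- 1) ^ length Ys * lie_on X Ys (contraction Y a) p"
      by (rule Cons.IH[OF Cons.prems(1) f Y(2)])
    then show "lie_on X (Y # Ys) (parity a) p = (- 1) ^ length (Y # Ys) * lie_on X (Y # Ys) a p"
      using lie_on_uminus[OF Cons.prems(1) parity_forms[OF f] Y(2), of p]
      by (simp add: contraction_parity parity_apply algebra_simps)
  qed
  then show ?thesis by (auto simp: fun_eq_iff lie_derivative_def parity_apply)
qed

text \<open>Contraction with Y splits the product by the antiderivation rule; the contractions by
  [X, Y] that arise from passing the Lie derivative across it cancel.\<close>

lemma lie_on_wedge:
  "X \<in> VF \<Longrightarrow> a \<in> \<Omega> \<Longrightarrow> b \<in> \<Omega> \<Longrightarrow> set Xs \<subseteq> VF \<Longrightarrow>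
    lie_on X Xs (wedge a b) p = wedge (\<L> X a) b Xs p + wedge a (\<L> X b) Xs p"
proof (induction Xs arbitrary: a b)
  case Nil
  have "wedge a b [] = (\<lambda>p. a [] p * b [] p)" by (simp add: fun_eq_iff wedge_Nil)
  then show ?case
    using tangent_mult[OF VF_tangent form_smooth form_smooth, of X a "[]" b "[]" p] Nil
    by (simp add: wedge_Nil lie_derivative_def)
next
  case (Cons Y Ys)
  note X = Cons.prems(1) and a = Cons.prems(2) and b = Cons.prems(3)
  have Y: "Y \<in> VF" "set Ys \<subseteq> VF" using Cons.prems by auto
  note ca = contraction_forms[OF a Y(1)] and cb = contraction_forms[OF b Y(1)]
  let ?Z = "vf_bracket X Y"
  have IH: "lie_on X Ys (wedge u w) p = wedge (\<L> X u) w Ys p + wedge u (\<L> X w) Ys p"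
    if "u \<in> \<Omega>" "w \<in> \<Omega>" for u w by (rule Cons.IH[OF X that Y(2)])
  have "lie_on X (Y # Ys) (wedge a b) p =
      lie_on X Ys (wedge (contraction Y a) b) p + lie_on X Ys (wedge (parity a) (contraction Y b)) p
      - wedge (contraction ?Z a) b Ys p - wedge (parity a) (contraction ?Z b) Ys p"
    by (simp add: contraction_wedge lie_on_add X wedge_forms ca cb b parity_forms a Y wedge_Cons)
  also have "\<dots> = wedge (\<L> X (contraction Y a)) b Ys p + wedge (contraction Y a) (\<L> X b) Ys p
      + wedge (\<L> X (parity a)) (contraction Y b) Ys p + wedge (parity a) (\<L> X (contraction Y b)) Ys p
      - wedge (contraction ?Z a) b Ys p - wedge (parity a) (contraction ?Z b) Ys p"
    using IH[OF ca b] IH[OF parity_forms[OF a] cb] by simp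
  also have "\<dots> = wedge (\<L> X a) b (Y # Ys) p + wedge a (\<L> X b) (Y # Ys) p"
  proof -
    have la: "\<L> X (contraction Y a) = contraction Y (\<L> X a) + contraction ?Z a"
      "\<L> X (contraction Y b) = contraction Y (\<L> X b) + contraction ?Z b"
      using lie_contraction[OF a Y(1), of X] lie_contraction[OF b Y(1), of X] by simp_all
    show ?thesis
      unfolding la lie_parity[OF X a] by (simp add: wedge_Cons wedge_add_left wedge_add_right)
  qed
  finally show ?case .
qed

lemma lie_wedge:
  assumes "X \<in> VF" "a \<in> \<Omega>" "b \<in> \<Omega>"
  shows "\<L> X (wedge a b) = wedge (\<L> X a) b + wedge a (\<L> X b)"
proof (intro ext)
  fix Xs p
  show "\<L> X (wedge a b) Xs p = (wedge (\<L> X a) b + wedge a (\<L> X b)) Xs p"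
  proof (cases "set Xs \<subseteq> VF")
    case True
    then show ?thesis using lie_on_wedge[OF assms True] by (simp add: lie_derivative_def[of _ _ "wedge a b"])
  next
    case False
    have "wedge (\<L> X a) b Xs p = 0"
      by (rule wedge_vanish[OF lie_vanish form_vanish[OF assms(3)] False])
    moreover have "wedge a (\<L> X b) Xs p = 0"
      by (rule wedge_vanish[OF form_vanish[OF assms(2)] lie_vanish False])
    ultimately show ?thesis using lie_vanish[OF False] by simp
  qed
qed

lemma ext_deriv_add:
  assumes "a \<in> \<Omega>" "b \<in> \<Omega>"
  shows "\<d> (a + b) = \<d> a + \<d> b"
proof -
  have "\<d> (a + b) Xs p = \<d> a Xs p + \<d> b Xs p" for Xs p
    using assms
  proof (induction Xs arbitrary: a b)
    case (Cons X Xs)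
    show ?case
    proof (cases "X \<in> VF")
      case True
      have "\<d> (contraction X a + contraction X b) Xs p = \<d> (contraction X a) Xs p + \<d> (contraction X b) Xs p"
        by (rule Cons.IH[OF contraction_forms[OF Cons.prems(1) True] contraction_forms[OF Cons.prems(2) True]])
      then show "\<d> (a + b) (X # Xs) p = \<d> a (X # Xs) p + \<d> b (X # Xs) p"
        by (simp add: Cartan True forms_add Cons.prems contraction_add lie_add)
    qed (simp add: ext_deriv_vanish)
  qed (simp add: ext_deriv_Nil)
  then show ?thesis by (simp add: fun_eq_iff)
qed

lemma forms_uminus:
  assumes "a \<in> \<Omega>"
  shows "- a \<in> \<Omega>"
proof (rule formsI)
  show "(- a) Xs = 0" if "\<not> set Xs \<subseteq> VF" for Xs
    using form_vanish[OF assms(1) that] by (simp add: fun_eq_iff)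
  show "(- a) Xs \<in> SF" if "set Xs \<subseteq> VF" for Xs
    using SF_uminus[OF form_smooth[OF assms that]] by (simp add: fun_Compl_def)
  show "(- a) (Xs @ (\<lambda>p. f p *\<^sub>R Y p + h p *\<^sub>R Z p) # Ys) =
        (\<lambda>p. f p * (- a) (Xs @ Y # Ys) p + h p * (- a) (Xs @ Z # Ys) p)"
    if "set Xs \<subseteq> VF" "Y \<in> VF" "Z \<in> VF" "set Ys \<subseteq> VF" "f \<in> SF" "h \<in> SF" for Xs Y Z Ys f h
    using form_lincomb[OF assms(1), of Xs Y Z Ys f h] that by (simp add: fun_eq_iff)
  show "(- a) (Xs @ Y # Y # Zs) = 0" if "set Xs \<subseteq> VF" "Y \<in> VF" "set Zs \<subseteq> VF" for Xs Y Zs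
    using form_alternating[OF assms(1), of Xs Y "[]" Zs] that by (simp add: fun_eq_iff)
qed

lemma ext_deriv_uminus:
  assumes "a \<in> \<Omega>"
  shows "\<d> (- a) = - \<d> a"
proof -
  have "\<d> (a + - a) = \<d> a + \<d> (- a)" by (rule ext_deriv_add[OF assms forms_uminus[OF assms]])
  moreover have "\<d> (0 + 0) = \<d> 0 + \<d> 0"
    using ext_deriv_add[of "a + - a" "a + - a"] forms_add[OF assms forms_uminus[OF assms]] by simp
  ultimately show ?thesis by (simp add: eq_neg_iff_add_eq_0 add.commute)
qed

lemma ext_deriv_parity:
  assumes "a \<in> \<Omega>"
  shows "\<d> (parity a) = - parity (\<d> a)"
proof -
  have "\<d> (parity a) Xs p = - parity (\<d> a) Xs p" for Xs p
    using assms
  proof (induction Xs arbitrary: a)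
    case (Cons X Xs)
    show ?case
    proof (cases "X \<in> VF")
      case True
      note c = contraction_forms[OF Cons.prems(1) True]
      have "\<d> (parity (contraction X a)) Xs p = - parity (\<d> (contraction X a)) Xs p"
        by (rule Cons.IH[OF c])
      then show "\<d> (parity a) (X # Xs) p = - parity (\<d> a) (X # Xs) p"
        by (simp add: Cartan True parity_forms Cons.prems contraction_parity ext_deriv_uminus c
            lie_parity parity_apply algebra_simps)
    qed (simp add: ext_deriv_vanish parity_apply)
  qed (simp add: ext_deriv_Nil parity_apply)
  then show ?thesis by (simp add: fun_eq_iff)
qed

lemma contraction_ext_deriv:
  assumes "a \<in> \<Omega>" "X \<in> VF"
  shows "contraction X (\<d> a) = \<L> X a - \<d> (contraction X a)"
  by (simp add: fun_eq_iff contraction_apply Cartan assms)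

text \<open>By Cartan's formula, contraction with X reduces the claim to the Leibniz rule of the Lie
  derivative and to the claim on shorter lists.\<close>

lemma ext_deriv_wedge:
  assumes "a \<in> \<Omega>" "b \<in> \<Omega>"
  shows "\<d> (wedge a b) = wedge (\<d> a) b + wedge (parity a) (\<d> b)"
proof -
  have "\<d> (wedge a b) Xs p = wedge (\<d> a) b Xs p + wedge (parity a) (\<d> b) Xs p" for Xs p
    using assms
  proof (induction Xs arbitrary: a b)
    case Nil
    then show ?case by (simp add: ext_deriv_Nil wedge_Nil)
  next
    case (Cons X Xs)
    note a = Cons.prems(1) and b = Cons.prems(2)
    have IH: "\<d> (wedge u w) Xs p = wedge (\<d> u) w Xs p + wedge (parity u) (\<d> w) Xs p"
      if "u \<in> \<Omega>" "w \<in> \<Omega>" for u w by (rule Cons.IH[OF that])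
    have van: "\<not> set Xs \<subseteq> VF \<Longrightarrow> \<d> c Xs = 0" for Xs and c :: "'m form"
      by (simp add: fun_eq_iff ext_deriv_vanish)
    show ?case
    proof (cases "X \<in> VF")
      case True
      note ca = contraction_forms[OF a True] and cb = contraction_forms[OF b True]
      have "\<d> (wedge a b) (X # Xs) p = \<L> X (wedge a b) Xs p
          - (\<d> (wedge (contraction X a) b) Xs p + \<d> (wedge (parity a) (contraction X b)) Xs p)"
        by (simp add: Cartan wedge_forms a b True contraction_wedge ext_deriv_add ca cb parity_forms)
      also have "\<dots> = wedge (\<L> X a) b Xs p + wedge a (\<L> X b) Xs p
          - (wedge (\<d> (contraction X a)) b Xs p + wedge (parity (contraction X a)) (\<d> b) Xs p
            + (wedge (\<d> (parity a)) (contraction X b) Xs p + wedge a (\<d> (contraction X b)) Xs p))"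
        using IH[OF ca b] IH[OF parity_forms[OF a] cb] by (simp add: lie_wedge True a b)
      also have "\<dots> = wedge (\<d> a) b (X # Xs) p + wedge (parity a) (\<d> b) (X # Xs) p"
      proof -
        have l: "\<L> X a = contraction X (\<d> a) + \<d> (contraction X a)"
          "\<L> X b = contraction X (\<d> b) + \<d> (contraction X b)"
          using contraction_ext_deriv[OF a True] contraction_ext_deriv[OF b True] by simp_all
        show ?thesis
          unfolding l ext_deriv_parity[OF a]
          by (simp add: wedge_Cons wedge_add_left wedge_add_right wedge_uminus_left contraction_parity)
      qed
      finally show ?thesis .
    next
      case False
      then have n: "\<not> set (X # Xs) \<subseteq> VF" by simp
      have "wedge (\<d> a) b (X # Xs) p = 0"
        by (rule wedge_vanish[OF van form_vanish[OF b] n])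
      moreover have "wedge (parity a) (\<d> b) (X # Xs) p = 0"
        by (rule wedge_vanish[OF form_vanish[OF parity_forms[OF a]] van n])
      ultimately show ?thesis using ext_deriv_vanish[OF n] by simp
    qed
  qed
  then show ?thesis by (simp add: fun_eq_iff)
qed

lemma homogeneous_lie:
  assumes "X \<in> VF" "homogeneous k a" "a \<in> \<Omega>"
  shows "homogeneous k (\<L> X a)"
proof -
  have "lie_on X Xs a p = 0" if "length Xs \<noteq> k" "set Xs \<subseteq> VF" for Xs p
    using assms that
  proof (induction Xs arbitrary: a k)
    case Nil
    then show ?case using tangent_const[OF VF_tangent[OF assms(1)], of p 0]
      by (simp add: homogeneous_def zero_fun_def)
  next
    case (Cons Y Ys)
    then have Y: "Y \<in> VF" "set Ys \<subseteq> VF" by auto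
    have "a (vf_bracket X Y # Ys) = 0" using Cons.prems by (intro homogeneousD[of k]) auto
    moreover have "lie_on X Ys (contraction Y a) p = 0"
    proof (cases k)
      case 0
      then have c: "contraction Y a = 0" using Cons.prems contraction_homogeneous_0 by blast
      have "lie_on X Ys 0 p = lie_on X Ys 0 p + lie_on X Ys 0 p"
        using lie_on_add[OF assms(1) contraction_forms[OF Cons.prems(3) Y(1)]
            contraction_forms[OF Cons.prems(3) Y(1)] Y(2), of p] unfolding c by simp
      then show ?thesis unfolding c by simp
    next
      case (Suc j)
      then show ?thesis
        using Cons.IH[OF assms(1) homogeneous_contraction[of j a Y] contraction_forms[OF Cons.prems(3) Y(1)] _ Y(2)]
          Cons.prems by auto
    qed
    ultimately show ?case by simp
  qed
  then show ?thesis unfolding homogeneous_def lie_derivative_def by (auto simp: fun_eq_iff)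
qed

lemma homogeneous_ext_deriv:
  assumes "homogeneous k a"
  shows "homogeneous (Suc k) (\<d> a)"
  unfolding homogeneous_def
proof (intro allI impI ext)
  fix Xs :: "'m vfield list" and p assume len: "length Xs \<noteq> Suc k"
  show "\<d> a Xs p = 0 p"
  proof (cases "set Xs \<subseteq> VF")
    case True
    have zero: "X \<in> VF \<Longrightarrow> X p 0 = 0" for X :: "'m vfield"
      using tangent_const[OF VF_tangent, of X p 0] by (simp add: zero_fun_def)
    have l1: "length (nths Xs (- {i})) = length Xs - 1" if "i < length Xs" for i
    proof -
      have "{j. j < length Xs \<and> j \<in> - {i}} = {..<length Xs} - {i}" by auto
      then show ?thesis using that by (simp add: length_nths)
    qed
    have l2: "length (nths Xs (- {i, j})) = length Xs - 2" if "i < j" "j < length Xs" for i j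
    proof -
      have "{l. l < length Xs \<and> l \<in> - {i, j}} = {..<length Xs} - {i, j}" by auto
      then show ?thesis using that by (simp add: length_nths card_Diff_subset)
    qed
    have "(\<Sum>i<length Xs. (- 1) ^ i * (Xs ! i) p (a (nths Xs (- {i})))) = 0"
    proof (intro sum.neutral ballI)
      fix i assume "i \<in> {..<length Xs}"
      then have "a (nths Xs (- {i})) = 0" "Xs ! i \<in> VF"
        using homogeneousD[OF assms] l1[of i] len True by auto
      then show "(- 1) ^ i * (Xs ! i) p (a (nths Xs (- {i}))) = 0" using zero by simp
    qed
    moreover have "(\<Sum>j<length Xs. \<Sum>i<j. (- 1) ^ (i + j) *
          a (vf_bracket (Xs ! i) (Xs ! j) # nths Xs (- {i, j})) p) = 0"
    proof (intro sum.neutral ballI)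
      fix j i assume "j \<in> {..<length Xs}" "i \<in> {..<j}"
      then have "a (vf_bracket (Xs ! i) (Xs ! j) # nths Xs (- {i, j})) = 0"
        using homogeneousD[OF assms] l2[of i j] len by auto
      then show "(- 1) ^ (i + j) * a (vf_bracket (Xs ! i) (Xs ! j) # nths Xs (- {i, j})) p = 0" by simp
    qed
    ultimately show ?thesis by (simp add: ext_deriv_def)
  qed (simp add: ext_deriv_vanish)
qed

end


subsection \<open>The twisted Courant bracket as a derived bracket\<close>

lemma wedge_diff_left: "wedge (a - b) c = wedge a c - wedge b c"
  using wedge_add_left[of a "- b" c] by (simp add: wedge_uminus_left)

lemma clifford_action_Pair: "clifford_action (v, \<alpha>) \<omega> = wedge \<alpha> \<omega> + contraction v \<omega>"
  by (simp add: clifford_action_def)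

lemma clifford_action_uminus: "clifford_action x (- a) = - clifford_action x a"
  by (cases x) (simp add: clifford_action_Pair wedge_uminus_right contraction_uminus)

context manifold
begin

abbreviation "\<Gamma> \<equiv> gsections A"

lemma k_forms_iff: "\<omega> \<in> k_forms A k \<longleftrightarrow> \<omega> \<in> \<Omega> \<and> homogeneous k \<omega>"
  by (auto simp: k_forms_def homogeneous_def)

lemma gsectionsD:
  assumes "(v, \<alpha>) \<in> \<Gamma>"
  shows "v \<in> VF" "\<alpha> \<in> \<Omega>" "homogeneous 1 \<alpha>"
  using assms by (auto simp: gsections_def k_forms_iff)

definition one_form :: "('m vfield \<Rightarrow> 'm \<Rightarrow> real) \<Rightarrow> 'm form"
  where "one_form \<theta> Xs = (if length Xs = 1 \<and> set Xs \<subseteq> VF then \<theta> (hd Xs) else 0)"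

lemma one_form_k_forms:
  assumes sm: "\<And>X. X \<in> VF \<Longrightarrow> \<theta> X \<in> SF"
    and lin: "\<And>X Y f h. X \<in> VF \<Longrightarrow> Y \<in> VF \<Longrightarrow> f \<in> SF \<Longrightarrow> h \<in> SF \<Longrightarrow>
      \<theta> (\<lambda>p. f p *\<^sub>R X p + h p *\<^sub>R Y p) = (\<lambda>p. f p * \<theta> X p + h p * \<theta> Y p)"
  shows "one_form \<theta> \<in> k_forms A 1"
  unfolding k_forms_iff
proof
  show "homogeneous 1 (one_form \<theta>)" by (simp add: homogeneous_def one_form_def)
  show "one_form \<theta> \<in> \<Omega>"
  proof (rule formsI)
    show "one_form \<theta> Xs \<in> SF" if "set Xs \<subseteq> VF" for Xs
    proof (cases "length Xs = 1")
      case True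
      then have "hd Xs \<in> VF" using that hd_in_set[of Xs] by (metis length_0_conv subsetD zero_neq_one)
      then show ?thesis using sm True that by (simp add: one_form_def)
    next
      case False
      then have "one_form \<theta> Xs = (\<lambda>p. 0)" by (simp add: one_form_def fun_eq_iff)
      then show ?thesis by simp
    qed
    show "one_form \<theta> (Xs @ (\<lambda>p. f p *\<^sub>R X p + h p *\<^sub>R Y p) # Ys) =
        (\<lambda>p. f p * one_form \<theta> (Xs @ X # Ys) p + h p * one_form \<theta> (Xs @ Y # Ys) p)"
      if "set Xs \<subseteq> VF" "X \<in> VF" "Y \<in> VF" "set Ys \<subseteq> VF" "f \<in> SF" "h \<in> SF" for Xs X Y Ys f h
    proof (cases "Xs = [] \<and> Ys = []")
      case True
      then show ?thesis
        using lin[OF that(2,3,5,6)] VF_lincomb[OF that(2,3,5,6)] that by (simp add: one_form_def)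
    next
      case False
      then have "length (Xs @ Z # Ys) \<noteq> 1" for Z by auto
      then show ?thesis unfolding one_form_def by (auto simp: fun_eq_iff)
    qed
  qed (auto simp: one_form_def)
qed

lemma differential_k_forms:
  assumes "f \<in> SF"
  shows "one_form (\<lambda>X p. X p f) \<in> k_forms A 1"
  by (rule one_form_k_forms) (use assms VF_smooth in auto)

text \<open>This form is the constant function 1. Evaluating operators on it recovers the one-form
  of a section and the multiplier in \<open>Upsilon\<close>.\<close>

lemma const_form:
  "(\<lambda>Xs p. if Xs = [] then 1 else 0) \<in> \<Omega>" "homogeneous 0 (\<lambda>Xs p. if Xs = [] then 1 else 0)"
proof -
  let ?w = "\<lambda>Xs p. if Xs = [] then 1 else (0::real)"
  show "?w \<in> \<Omega>"
  proof (rule formsI)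
    show "?w Xs = 0" if "\<not> set Xs \<subseteq> VF" for Xs
      using that by (auto simp: fun_eq_iff)
    show "?w Xs \<in> SF" for Xs by (cases "Xs = []") simp_all
  qed (auto simp: fun_eq_iff)
  show "homogeneous 0 ?w" by (auto simp: homogeneous_def fun_eq_iff)
qed

lemma clifford_action_inject:
  assumes x: "x \<in> \<Gamma>" and y: "y \<in> \<Gamma>"
    and eq: "\<And>\<omega>. \<omega> \<in> \<Omega> \<Longrightarrow> clifford_action x \<omega> = clifford_action y \<omega>"
  shows "x = y"
proof -
  obtain v \<alpha> w \<beta> where xy: "x = (v, \<alpha>)" "y = (w, \<beta>)" by (cases x, cases y) auto
  note X = gsectionsD[OF x[unfolded xy(1)]] and Y = gsectionsD[OF y[unfolded xy(2)]]
  let ?o = "\<lambda>Xs p. if Xs = [] then 1 else (0::real)"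
  have "clifford_action (u, \<gamma>) ?o = \<gamma>" for u and \<gamma> :: "'m form"
    by (simp add: clifford_action_Pair contraction_homogeneous_0[OF const_form(2)] fun_eq_iff
        wedge_homogeneous_0[OF const_form(2)])
  from this[of v \<alpha>] this[of w \<beta>] have ab: "\<alpha> = \<beta>"
    using eq[OF const_form(1)] unfolding xy by metis
  have "v p f = w p f" for p f
  proof (cases "f \<in> SF")
    case True
    let ?d = "one_form (\<lambda>X p. X p f)"
    have d: "?d \<in> \<Omega>" using differential_k_forms[OF True] by (simp add: k_forms_iff)
    have "clifford_action (v, \<alpha>) ?d [] p = clifford_action (w, \<alpha>) ?d [] p"
      using eq[OF d] unfolding xy ab by simp
    then show ?thesis
      using X(1) Y(1) by (simp add: clifford_action_Pair contraction_apply one_form_def)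
  next
    case False
    then show ?thesis using VF_not_smooth X(1) Y(1) by metis
  qed
  then show ?thesis using ab xy by (auto simp: fun_eq_iff)
qed

lemma clifford_action_forms: "x \<in> \<Gamma> \<Longrightarrow> \<omega> \<in> \<Omega> \<Longrightarrow> clifford_action x \<omega> \<in> \<Omega>"
  by (cases x) (auto simp: clifford_action_Pair intro!: forms_add wedge_forms contraction_forms
      dest: gsectionsD)

text \<open>Wedge products with one-forms anticommute among themselves, and so do contractions; the
  mixed terms leave \<alpha> [w] + \<beta> [v].\<close>

lemma clifford_relation:
  assumes x: "x \<in> \<Gamma>" and y: "y \<in> \<Gamma>" and \<omega>: "\<omega> \<in> \<Omega>"
  shows "clifford_action x (clifford_action y \<omega>) + clifford_action y (clifford_action x \<omega>) =
    (\<lambda>Xs p. pairing x y p * \<omega> Xs p)"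
proof -
  obtain v \<alpha> w \<beta> where xy: "x = (v, \<alpha>)" "y = (w, \<beta>)" by (cases x, cases y) auto
  note X = gsectionsD[OF x[unfolded xy(1)]] and Y = gsectionsD[OF y[unfolded xy(2)]]
  have ww: "wedge \<alpha> (wedge \<beta> \<omega>) = - wedge \<beta> (wedge \<alpha> \<omega>)"
    using wedge_commute_1_homogeneous[OF X(3) Y(3)] by (simp add: fun_eq_iff)
  have c: "contraction u (wedge \<gamma> \<omega>) Xs p = \<gamma> [u] p * \<omega> Xs p - wedge \<gamma> (contraction u \<omega>) Xs p"
    if "homogeneous 1 \<gamma>" for u \<gamma> Xs p
  proof -
    have h: "homogeneous 0 (contraction u \<gamma>)" using that by (simp add: homogeneous_contraction)
    have p: "parity \<gamma> = - \<gamma>" using parity_homogeneous[OF that] by simp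
    show ?thesis
      unfolding contraction_wedge p
      by (simp add: wedge_homogeneous_0[OF h] wedge_uminus_left contraction_apply)
  qed
  have cc: "contraction v (contraction w \<omega>) Xs p = - contraction w (contraction v \<omega>) Xs p" for Xs p
  proof (cases "set Xs \<subseteq> VF")
    case True
    then show ?thesis using form_swap[OF \<omega> Y(1) X(1) True] by (simp add: contraction_apply)
  next
    case False
    then show ?thesis
      using form_vanish[OF \<omega>, of "w # v # Xs"] form_vanish[OF \<omega>, of "v # w # Xs"]
      by (simp add: contraction_apply)
  qed
  show ?thesis
  proof (intro ext)
    fix Xs p
    have "(clifford_action x (clifford_action y \<omega>) + clifford_action y (clifford_action x \<omega>)) Xs p =
      wedge \<alpha> (wedge \<beta> \<omega>) Xs p + wedge \<alpha> (contraction w \<omega>) Xs p + contraction v (wedge \<beta> \<omega>) Xs p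
      + contraction v (contraction w \<omega>) Xs p
      + (wedge \<beta> (wedge \<alpha> \<omega>) Xs p + wedge \<beta> (contraction v \<omega>) Xs p + contraction w (wedge \<alpha> \<omega>) Xs p
      + contraction w (contraction v \<omega>) Xs p)"
      unfolding xy clifford_action_Pair wedge_add_right contraction_add by simp
    also have "\<dots> = pairing x y p * \<omega> Xs p"
      unfolding c[OF X(3)] c[OF Y(3)] cc[of Xs p] ww by (simp add: pairing_def xy algebra_simps)
    finally show "(clifford_action x (clifford_action y \<omega>) + clifford_action y (clifford_action x \<omega>)) Xs p =
      pairing x y p * \<omega> Xs p" .
  qed
qed

text \<open>Moving \<alpha> past d leaves d\<alpha>, moving it past \<eta> leaves nothing, moving
  the contraction past \<eta> leaves the contraction of \<eta>, and d with the contraction makes the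
  Lie derivative.\<close>

lemma twisted_d_commutator:
  assumes x: "(v, \<alpha>) \<in> \<Gamma>" and \<eta>: "\<eta> \<in> k_forms A 3" and \<omega>: "\<omega> \<in> \<Omega>"
  shows "graded_commutator 1 1 (twisted_d A \<eta>) (clifford_action (v, \<alpha>)) \<omega> =
    \<L> v \<omega> + wedge (\<d> \<alpha> + contraction v \<eta>) \<omega>"
proof -
  note X = gsectionsD[OF x]
  have h: "\<eta> \<in> \<Omega>" "homogeneous 3 \<eta>" using \<eta> by (auto simp: k_forms_iff)
  have pa: "parity \<alpha> = - \<alpha>" "parity \<eta> = - \<eta>"
    using parity_homogeneous[OF X(3)] parity_homogeneous[OF h(2)] by simp_all
  have comm: "wedge \<alpha> (wedge \<eta> \<omega>) = - wedge \<eta> (wedge \<alpha> \<omega>)"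
    using wedge_commute_1_homogeneous[OF X(3) h(2)] by (simp add: fun_eq_iff)
  have d: "\<d> (wedge \<alpha> \<omega> + contraction v \<omega>) = wedge (\<d> \<alpha>) \<omega> - wedge \<alpha> (\<d> \<omega>) + \<d> (contraction v \<omega>)"
    by (simp add: ext_deriv_add wedge_forms contraction_forms X \<omega> ext_deriv_wedge pa wedge_uminus_left)
  have "graded_commutator 1 1 (twisted_d A \<eta>) (clifford_action (v, \<alpha>)) \<omega> =
    \<d> (wedge \<alpha> \<omega> + contraction v \<omega>) + wedge \<eta> (wedge \<alpha> \<omega> + contraction v \<omega>)
    + (wedge \<alpha> (\<d> \<omega> + wedge \<eta> \<omega>) + contraction v (\<d> \<omega> + wedge \<eta> \<omega>))"
    by (simp add: graded_commutator_def twisted_d_def clifford_action_Pair)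
  also have "\<dots> = \<L> v \<omega> + wedge (\<d> \<alpha> + contraction v \<eta>) \<omega>"
    unfolding d wedge_add_right wedge_add_left contraction_add contraction_wedge pa comm
      contraction_ext_deriv[OF \<omega> X(1)] wedge_uminus_left by simp
  finally show ?thesis .
qed

lemma courant_commutator:
  assumes x: "(v, \<alpha>) \<in> \<Gamma>" and y: "(w, \<beta>) \<in> \<Gamma>" and \<eta>: "\<eta> \<in> k_forms A 3" and \<omega>: "\<omega> \<in> \<Omega>"
  shows "graded_commutator 0 1 (graded_commutator 1 1 (twisted_d A \<eta>) (clifford_action (v, \<alpha>)))
      (clifford_action (w, \<beta>)) \<omega> =
    clifford_action (vf_bracket v w, \<L> v \<beta> - contraction w (\<d> \<alpha> + contraction v \<eta>)) \<omega>"
proof -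
  note X = gsectionsD[OF x] and Y = gsectionsD[OF y]
  have h: "\<eta> \<in> \<Omega>" "homogeneous 3 \<eta>" using \<eta> by (auto simp: k_forms_iff)
  \<comment> \<open>The two-form \<gamma> is even and commutes with \<beta>, so that only its
    contraction with w survives in the outer commutator.\<close>
  define \<gamma> where "\<gamma> = \<d> \<alpha> + contraction v \<eta>"
  have h2: "homogeneous 2 \<gamma>"
    unfolding \<gamma>_def using homogeneous_ext_deriv[OF X(3)] homogeneous_contraction[of 2 \<eta> v] h(2)
    by (intro homogeneous_add) (simp_all add: numeral_2_eq_2 numeral_3_eq_3)
  have pg: "parity \<gamma> = \<gamma>" using parity_homogeneous[OF h2] by simp
  have comm: "wedge \<beta> (wedge \<gamma> \<omega>) = wedge \<gamma> (wedge \<beta> \<omega>)"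
    using wedge_commute_1_homogeneous[OF Y(3) h2] by simp
  have lw: "\<L> v (contraction w \<omega>) = contraction w (\<L> v \<omega>) + contraction (vf_bracket v w) \<omega>"
    using lie_contraction[OF \<omega> Y(1), of v] by simp
  have "graded_commutator 0 1 (graded_commutator 1 1 (twisted_d A \<eta>) (clifford_action (v, \<alpha>)))
      (clifford_action (w, \<beta>)) \<omega> =
    \<L> v (wedge \<beta> \<omega> + contraction w \<omega>) + wedge \<gamma> (wedge \<beta> \<omega> + contraction w \<omega>)
    - (wedge \<beta> (\<L> v \<omega> + wedge \<gamma> \<omega>) + contraction w (\<L> v \<omega> + wedge \<gamma> \<omega>))"
    unfolding graded_commutator_def[of 0] twisted_d_commutator[OF x \<eta> \<omega>]
      twisted_d_commutator[OF x \<eta> clifford_action_forms[OF y \<omega>]] \<gamma>_def[symmetric]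
    unfolding clifford_action_Pair by simp
  also have "\<dots> = clifford_action (vf_bracket v w, \<L> v \<beta> - contraction w \<gamma>) \<omega>"
    unfolding lie_add[OF X(1) wedge_forms[OF Y(2) \<omega>] contraction_forms[OF \<omega> Y(1)]] lie_wedge[OF X(1) Y(2) \<omega>]
      clifford_action_Pair wedge_add_right wedge_diff_left contraction_add contraction_wedge pg comm lw
    by simp
  finally show ?thesis unfolding \<gamma>_def .
qed

text \<open>The form component of the bracket of \<open>(v, \<alpha>)\<close> and \<open>(w, \<beta>)\<close>, evaluated on \<open>Z\<close>.\<close>

definition courant_form :: "'m form \<Rightarrow> 'm gsection \<Rightarrow> 'm gsection \<Rightarrow> 'm vfield \<Rightarrow> 'm \<Rightarrow> real"
  where "courant_form \<eta> = (\<lambda>(v, \<alpha>) (w, \<beta>) Z p.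
    v p (\<beta> [Z]) - \<beta> [vf_bracket v Z] p - w p (\<alpha> [Z]) + Z p (\<alpha> [w]) + \<alpha> [vf_bracket w Z] p - \<eta> [v, w, Z] p)"

text \<open>Cartan's formula, applied twice, evaluates d\<alpha> on the pair w, Z.\<close>

lemma courant_form_eq:
  assumes x: "(v, \<alpha>) \<in> \<Gamma>" and y: "(w, \<beta>) \<in> \<Gamma>" and \<eta>: "\<eta> \<in> k_forms A 3" and Z: "Z \<in> VF"
  shows "(\<L> v \<beta> - contraction w (\<d> \<alpha> + contraction v \<eta>)) [Z] p = courant_form \<eta> (v, \<alpha>) (w, \<beta>) Z p"
proof -
  note X = gsectionsD[OF x] and Y = gsectionsD[OF y]
  have c: "contraction w \<alpha> \<in> \<Omega>" "contraction Z (contraction w \<alpha>) \<in> \<Omega>"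
    by (intro contraction_forms X Y Z)+
  have "\<d> \<alpha> [w, Z] p = \<L> w \<alpha> [Z] p - \<L> Z (contraction w \<alpha>) [] p"
    using Cartan[OF X(2) Y(1), of "[Z]" p] Cartan[OF c(1) Z, of "[]" p] by (simp add: ext_deriv_Nil)
  then show ?thesis
    using Z by (simp add: courant_form_def lie_derivative_def contraction_apply)
qed

text \<open>On lists of a length other than 1, or containing something that is no vector field, both
  form components vanish, so values on single fields decide. The operator identity is kept as a
  second conclusion because \<open>Upsilon\<close> is defined by operators and not by the
  bracket.\<close>

theorem courant_bracket_eqI:
  assumes x: "(v, \<alpha>) \<in> \<Gamma>" and y: "(w, \<beta>) \<in> \<Gamma>" and z: "(vf_bracket v w, \<gamma>) \<in> \<Gamma>" and \<eta>: "\<eta> \<in> k_forms A 3"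
    and eq: "\<And>Z p. Z \<in> VF \<Longrightarrow> \<gamma> [Z] p = courant_form \<eta> (v, \<alpha>) (w, \<beta>) Z p"
  shows "courant_bracket A \<eta> (v, \<alpha>) (w, \<beta>) = (vf_bracket v w, \<gamma>)"
    and "\<omega> \<in> \<Omega> \<Longrightarrow> graded_commutator 0 1 (graded_commutator 1 1 (twisted_d A \<eta>) (clifford_action (v, \<alpha>)))
      (clifford_action (w, \<beta>)) \<omega> = clifford_action (vf_bracket v w, \<gamma>) \<omega>"
proof -
  note X = gsectionsD[OF x] and Y = gsectionsD[OF y] and Z = gsectionsD[OF z]
  let ?\<gamma> = "\<L> v \<beta> - contraction w (\<d> \<alpha> + contraction v \<eta>)"
  have h: "\<eta> \<in> \<Omega>" "homogeneous 3 \<eta>" using \<eta> by (auto simp: k_forms_iff)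
  have "?\<gamma> Xs p = \<gamma> Xs p" for Xs p
  proof (cases "length Xs = 1 \<and> set Xs \<subseteq> VF")
    case True
    then obtain U where "Xs = [U]" "U \<in> VF" by (cases Xs) auto
    then show ?thesis using courant_form_eq[OF x y \<eta>] eq by simp
  next
    case False
    have "?\<gamma> Xs p = 0"
    proof (cases "set Xs \<subseteq> VF")
      case True
      then have len: "length Xs \<noteq> 1" using False by simp
      have "\<L> v \<beta> Xs = 0" using homogeneousD[OF homogeneous_lie[OF X(1) Y(3,2)] len] .
      moreover have "\<d> \<alpha> (w # Xs) = 0"
        by (rule homogeneousD[OF homogeneous_ext_deriv[OF X(3)]]) (use len in simp)
      moreover have "\<eta> (v # w # Xs) = 0"
        by (rule homogeneousD[OF h(2)]) (use len in simp)
      ultimately show ?thesis by (simp add: contraction_apply)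
    next
      case F: False
      then have n: "\<not> set (w # Xs) \<subseteq> VF" "\<not> set (v # w # Xs) \<subseteq> VF" by auto
      show ?thesis
        using lie_vanish[OF F] ext_deriv_vanish[OF n(1)] form_vanish[OF h(1) n(2)] by (simp add: contraction_apply)
    qed
    moreover have "\<gamma> Xs p = 0"
      using False homogeneousD[OF Z(3)] form_vanish[OF Z(2)] by (cases "length Xs = 1") auto
    ultimately show ?thesis by simp
  qed
  then have g: "?\<gamma> = \<gamma>" by (intro ext)
  show op: "graded_commutator 0 1 (graded_commutator 1 1 (twisted_d A \<eta>) (clifford_action (v, \<alpha>)))
      (clifford_action (w, \<beta>)) \<omega> = clifford_action (vf_bracket v w, \<gamma>) \<omega>" if "\<omega> \<in> \<Omega>" for \<omega>
    using courant_commutator[OF x y \<eta> that] unfolding g .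
  show "courant_bracket A \<eta> (v, \<alpha>) (w, \<beta>) = (vf_bracket v w, \<gamma>)"
    unfolding courant_bracket_def
  proof (rule the_equality)
    show "u = (vf_bracket v w, \<gamma>)"
      if "u \<in> \<Gamma> \<and> (\<forall>\<omega>\<in>\<Omega>. clifford_action u \<omega> = graded_commutator 0 1
        (graded_commutator 1 1 (twisted_d A \<eta>) (clifford_action (v, \<alpha>))) (clifford_action (w, \<beta>)) \<omega>)" for u
      by (rule clifford_action_inject[OF _ z]) (use that op in auto)
  qed (use z op in auto)
qed

text \<open>The inner two commutators amount to minus the Clifford action of u, the bracket of z and
  y in this order, and the Clifford relation turns the commutator with x into the pairing with u.
  Evaluation on the constant form 1 gives uniqueness.\<close>

theorem Upsilon_eqI:
  assumes x: "x \<in> \<Gamma>" and y: "y \<in> \<Gamma>" and z: "z \<in> \<Gamma>" and u: "u \<in> \<Gamma>"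
    and op: "\<And>\<omega>. \<omega> \<in> \<Omega> \<Longrightarrow> graded_commutator 0 1
        (graded_commutator 1 1 (twisted_d A \<eta>) (clifford_action z)) (clifford_action y) \<omega> = clifford_action u \<omega>"
    and f: "f \<in> SF" "\<And>p. pairing x u p = - f p"
  shows "Upsilon A \<eta> x y z = f"
  unfolding Upsilon_def
proof (rule the_equality)
  let ?Q = "graded_commutator 1 1 (clifford_action z) (twisted_d A \<eta>)"
  let ?R = "graded_commutator 1 0 (clifford_action y) ?Q"
  \<comment> \<open>The commutator of two odd operators is symmetric; that of an odd and an even one
    is antisymmetric, whence the minus sign in \<open>R\<close>.\<close>
  have Q: "?Q = graded_commutator 1 1 (twisted_d A \<eta>) (clifford_action z)"
    by (simp add: graded_commutator_def fun_eq_iff)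
  have R: "?R \<omega> = - clifford_action u \<omega>" if "\<omega> \<in> \<Omega>" for \<omega>
    unfolding op[OF that, symmetric] Q by (simp add: graded_commutator_def fun_eq_iff)
  have main: "graded_commutator 1 1 (clifford_action x) ?R \<omega> = (\<lambda>Xs p. f p * \<omega> Xs p)" if \<omega>: "\<omega> \<in> \<Omega>" for \<omega>
  proof -
    have "graded_commutator 1 1 (clifford_action x) ?R \<omega> = clifford_action x (?R \<omega>) + ?R (clifford_action x \<omega>)"
      unfolding graded_commutator_def[of 1 1 "clifford_action x" ?R] by simp
    also have "\<dots> = - (clifford_action x (clifford_action u \<omega>) + clifford_action u (clifford_action x \<omega>))"
      unfolding R[OF \<omega>] R[OF clifford_action_forms[OF x \<omega>]] clifford_action_uminus by simp
    also have "\<dots> = (\<lambda>Xs p. f p * \<omega> Xs p)"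
      unfolding clifford_relation[OF x u \<omega>] by (simp add: fun_eq_iff f(2))
    finally show ?thesis .
  qed
  then show "f \<in> SF \<and> (\<forall>\<omega>\<in>\<Omega>. graded_commutator 1 1 (clifford_action x) ?R \<omega> = (\<lambda>Xs p. f p * \<omega> Xs p))"
    using f(1) by blast
  let ?o = "\<lambda>(Xs :: 'm vfield list) (p :: 'm). if Xs = [] then 1 else (0::real)"
  fix g assume "g \<in> SF \<and> (\<forall>\<omega>\<in>\<Omega>. graded_commutator 1 1 (clifford_action x) ?R \<omega> = (\<lambda>Xs p. g p * \<omega> Xs p))"
  from bspec[OF conjunct2[OF this] const_form(1)]
  have "graded_commutator 1 1 (clifford_action x) ?R ?o = (\<lambda>Xs p. g p * ?o Xs p)" .
  from trans[OF main[OF const_form(1), symmetric] this]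
  have "(\<lambda>Xs p. f p * ?o Xs p) = (\<lambda>Xs p. g p * ?o Xs p)" .
  from fun_cong[OF this, of "[]"] show "g = f" by (simp add: fun_eq_iff)
qed

lemma vf_bracket_uminus:
  assumes "X \<in> VF" "Y \<in> VF"
  shows "vf_bracket (- X) Y = - vf_bracket X Y" "vf_bracket X (- Y) = - vf_bracket X Y"
proof -
  have *: "vf_bracket X (- Y) = - vf_bracket X Y" if "X \<in> VF" "Y \<in> VF" for X Y
  proof (intro ext)
    fix p f
    show "vf_bracket X (- Y) p f = (- vf_bracket X Y) p f"
    proof (cases "f \<in> SF")
      case True
      show ?thesis
        using tangent_uminus[OF VF_tangent[OF that(1)] VF_smooth[OF that(2) True], of p]
        by (simp add: vf_bracket_def)
    next
      case False
      then show ?thesis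
        using VF_not_smooth[OF VF_bracket[OF that(1) VF_uminus[OF that(2)]]] VF_not_smooth[OF VF_bracket[OF that]] by simp
    qed
  qed
  then show "vf_bracket X (- Y) = - vf_bracket X Y" using assms by simp
  show "vf_bracket (- X) Y = - vf_bracket X Y"
    using *[OF assms(2,1)] vf_bracket_uminus_swap[of "- X" Y] vf_bracket_uminus_swap[of X Y] by simp
qed

lemma vf_bracket_add:
  assumes "X \<in> VF" "Y \<in> VF" "Z \<in> VF"
  shows "vf_bracket X (Y + Z) = vf_bracket X Y + vf_bracket X Z" "vf_bracket (Y + Z) X = vf_bracket Y X + vf_bracket Z X"
proof -
  show *: "vf_bracket X (Y + Z) = vf_bracket X Y + vf_bracket X Z"
    using vf_bracket_lincomb[OF assms SF_const SF_const, of 1 1] tangent_const[OF VF_tangent[OF assms(1)]]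
    by (simp add: plus_fun_def)
  show "vf_bracket (Y + Z) X = vf_bracket Y X + vf_bracket Z X"
    using * vf_bracket_uminus_swap[of "Y + Z" X] vf_bracket_uminus_swap[of Y X] vf_bracket_uminus_swap[of Z X]
    by simp
qed

lemma gsections_add: "x \<in> \<Gamma> \<Longrightarrow> y \<in> \<Gamma> \<Longrightarrow> x + y \<in> \<Gamma>"
  by (cases x; cases y) (auto simp: gsections_def k_forms_iff VF_add forms_add homogeneous_add)

lemma one_form_add: "\<alpha> \<in> \<Omega> \<Longrightarrow> X \<in> VF \<Longrightarrow> Y \<in> VF \<Longrightarrow> \<alpha> [X + Y] = \<alpha> [X] + \<alpha> [Y]"
  using form_add[of \<alpha> X Y "[]" "[]"] by simp

lemma one_form_uminus: "\<alpha> \<in> \<Omega> \<Longrightarrow> X \<in> VF \<Longrightarrow> \<alpha> [- X] = - \<alpha> [X]"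
  using form_lincomb[of \<alpha> "[]" X X "[]" "\<lambda>_. -1" "\<lambda>_. 0"] by (simp add: fun_Compl_def)

lemma pairing_add:
  assumes "x \<in> \<Gamma>" "x' \<in> \<Gamma>" "y \<in> \<Gamma>"
  shows "pairing (x + x') y p = pairing x y p + pairing x' y p"
    "pairing y (x + x') p = pairing y x p + pairing y x' p"
proof -
  obtain v \<alpha> v' \<alpha>' w \<beta> where xy: "x = (v, \<alpha>)" "x' = (v', \<alpha>')" "y = (w, \<beta>)"
    by (cases x; cases x'; cases y) auto
  note g = gsectionsD[OF assms(1)[unfolded xy]] gsectionsD[OF assms(2)[unfolded xy]] gsectionsD[OF assms(3)[unfolded xy]]
  show "pairing (x + x') y p = pairing x y p + pairing x' y p"
    "pairing y (x + x') p = pairing y x p + pairing y x' p"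
    by (simp_all add: xy pairing_def one_form_add g)
qed

lemma courant_form_add:
  assumes "x \<in> \<Gamma>" "x' \<in> \<Gamma>" "y \<in> \<Gamma>" and \<eta>: "\<eta> \<in> k_forms A 3" and Z: "Z \<in> VF"
  shows "courant_form \<eta> (x + x') y Z p = courant_form \<eta> x y Z p + courant_form \<eta> x' y Z p"
    "courant_form \<eta> y (x + x') Z p = courant_form \<eta> y x Z p + courant_form \<eta> y x' Z p"
proof -
  obtain v \<alpha> v' \<alpha>' w \<beta> where xy: "x = (v, \<alpha>)" "x' = (v', \<alpha>')" "y = (w, \<beta>)"
    by (cases x; cases x'; cases y) auto
  note g = gsectionsD[OF assms(1)[unfolded xy(1)]] and g' = gsectionsD[OF assms(2)[unfolded xy(2)]]
    and h = gsectionsD[OF assms(3)[unfolded xy(3)]]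
  have \<eta>: "\<eta> \<in> \<Omega>" using \<eta> by (simp add: k_forms_iff)
  have e: "\<eta> [v + v', w, Z] = \<eta> [v, w, Z] + \<eta> [v', w, Z]" "\<eta> [w, v + v', Z] = \<eta> [w, v, Z] + \<eta> [w, v', Z]"
    using form_add[OF \<eta> g(1) g'(1), of "[]" "[w, Z]"] form_add[OF \<eta> g(1) g'(1), of "[w]" "[Z]"] h(1) Z by simp_all
  have sm: "\<gamma> [V] \<in> SF" if "\<gamma> \<in> \<Omega>" "V \<in> VF" for \<gamma> V using form_smooth[OF that(1), of "[V]"] that by simp
  have t: "U p (a + b) = U p a + U p b" if "U \<in> VF" "a \<in> SF" "b \<in> SF" for U a b
    using tangent_add[OF VF_tangent[OF that(1)] that(2,3)] by (simp add: plus_fun_def)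
  note br = VF_bracket[OF g(1) Z] VF_bracket[OF g'(1) Z]
    and t' = tangent_add[OF VF_tangent[OF Z] sm[OF h(2) g(1)] sm[OF h(2) g'(1)]]
  show "courant_form \<eta> (x + x') y Z p = courant_form \<eta> x y Z p + courant_form \<eta> x' y Z p"
    by (simp add: xy courant_form_def e vf_bracket_add(2)[OF Z g(1) g'(1)] one_form_add g g' h br Z t t' sm)
  show "courant_form \<eta> y (x + x') Z p = courant_form \<eta> y x Z p + courant_form \<eta> y x' Z p"
    by (simp add: xy courant_form_def e vf_bracket_add(2)[OF Z g(1) g'(1)] one_form_add g g' h br Z t t' sm)
qed

lemma courant_form_swap:
  assumes "x \<in> \<Gamma>" "y \<in> \<Gamma>" and \<eta>: "\<eta> \<in> k_forms A 3" and Z: "Z \<in> VF"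
  shows "courant_form \<eta> x y Z p + courant_form \<eta> y x Z p = Z p (pairing x y)"
proof -
  obtain v \<alpha> w \<beta> where xy: "x = (v, \<alpha>)" "y = (w, \<beta>)"
    by (cases x; cases y) auto
  note g = gsectionsD[OF assms(1)[unfolded xy(1)]] and h = gsectionsD[OF assms(2)[unfolded xy(2)]]
  have \<eta>: "\<eta> \<in> \<Omega>" using \<eta> by (simp add: k_forms_iff)
  have e: "\<eta> [v, w, Z] = - \<eta> [w, v, Z]"
    using form_swap[OF \<eta> g(1) h(1), of "[Z]"] Z by simp
  have sm: "\<gamma> [V] \<in> SF" if "\<gamma> \<in> \<Omega>" "V \<in> VF" for \<gamma> V using form_smooth[OF that(1), of "[V]"] that by simp
  have "Z p (pairing x y) = Z p (\<alpha> [w]) + Z p (\<beta> [v])"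
    using tangent_add[OF VF_tangent[OF Z] sm[OF g(2) h(1)] sm[OF h(2) g(1)]]
    by (simp add: xy pairing_def plus_fun_def)
  then show ?thesis by (simp add: xy courant_form_def e)
qed

text \<open>The summands are not function-linear one by one: v (\<beta> [Z]) and the value of
  \<beta> on the bracket of v and Z both produce the derivative of the coefficient along v, and
  these cancel. The same happens for w and \<alpha>.\<close>

lemma courant_form_lincomb:
  assumes "x \<in> \<Gamma>" "y \<in> \<Gamma>" and \<eta>: "\<eta> \<in> k_forms A 3" and Z: "X \<in> VF" "Y \<in> VF" "f \<in> SF" "h \<in> SF"
  shows "courant_form \<eta> x y (\<lambda>p. f p *\<^sub>R X p + h p *\<^sub>R Y p) p =
    f p * courant_form \<eta> x y X p + h p * courant_form \<eta> x y Y p"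
proof -
  obtain v \<alpha> w \<beta> where xy: "x = (v, \<alpha>)" "y = (w, \<beta>)"
    by (cases x; cases y) auto
  note a = gsectionsD[OF assms(1)[unfolded xy(1)]] and b = gsectionsD[OF assms(2)[unfolded xy(2)]]
  have \<eta>: "\<eta> \<in> \<Omega>" using \<eta> by (simp add: k_forms_iff)
  let ?Z = "\<lambda>p. f p *\<^sub>R X p + h p *\<^sub>R Y p"
  have sm: "\<gamma> [V] \<in> SF" if "\<gamma> \<in> \<Omega>" "V \<in> VF" for \<gamma> V using form_smooth[OF that(1), of "[V]"] that by simp
  have lin: "\<gamma> [\<lambda>p. k p *\<^sub>R U p + l p *\<^sub>R V p] q = k q * \<gamma> [U] q + l q * \<gamma> [V] q"
    if "\<gamma> \<in> \<Omega>" "U \<in> VF" "V \<in> VF" "k \<in> SF" "l \<in> SF" for \<gamma> U V k l q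
    using form_lincomb[OF that(1), of "[]" U V "[]" k l] that by simp
  have der: "u p (\<gamma> [?Z]) = f p * u p (\<gamma> [X]) + \<gamma> [X] p * u p f + (h p * u p (\<gamma> [Y]) + \<gamma> [Y] p * u p h)"
    if u: "u \<in> VF" and \<gamma>: "\<gamma> \<in> \<Omega>" for u \<gamma>
  proof -
    have "\<gamma> [?Z] = (\<lambda>q. f q * \<gamma> [X] q + h q * \<gamma> [Y] q)" using lin[OF \<gamma> Z] by (intro ext)
    then show ?thesis
      using tangent_add[OF VF_tangent[OF u] SF_mult[OF Z(3) sm[OF \<gamma> Z(1)]] SF_mult[OF Z(4) sm[OF \<gamma> Z(2)]], of p]
        tangent_mult[OF VF_tangent[OF u] Z(3) sm[OF \<gamma> Z(1)], of p] tangent_mult[OF VF_tangent[OF u] Z(4) sm[OF \<gamma> Z(2)], of p]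
      by simp
  qed
  have br: "\<gamma> [vf_bracket u ?Z] p = f p * \<gamma> [vf_bracket u X] p + h p * \<gamma> [vf_bracket u Y] p
      + (u p f * \<gamma> [X] p + u p h * \<gamma> [Y] p)" if u: "u \<in> VF" and \<gamma>: "\<gamma> \<in> \<Omega>" for u \<gamma>
  proof -
    note bu = VF_bracket[OF u Z(1)] VF_bracket[OF u Z(2)] and du = VF_smooth[OF u Z(3)] VF_smooth[OF u Z(4)]
    show ?thesis
      unfolding vf_bracket_lincomb[OF u Z]
      using lin[OF \<gamma> VF_lincomb[OF bu Z(3,4)] VF_lincomb[OF Z(1,2) du] SF_const SF_const, of 1 1 p]
        lin[OF \<gamma> bu Z(3,4), of p] lin[OF \<gamma> Z(1,2) du, of p] by simp
  qed
  have e: "\<eta> [v, w, ?Z] p = f p * \<eta> [v, w, X] p + h p * \<eta> [v, w, Y] p"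
    using form_lincomb[OF \<eta>, of "[v, w]" X Y "[]" f h] Z a(1) b(1) by simp
  show ?thesis
    unfolding xy courant_form_def split der[OF a(1) b(2)] der[OF b(1) a(2)] br[OF a(1) b(2)] br[OF b(1) a(2)] e
    by (simp add: algebra_simps)
qed

end


section \<open>Push-forward along diffeomorphisms, then the group structure\<close>

section \<open>Lie groups\<close>

context manifold
begin

lemma push_tvec_apply: "f \<in> SF \<Longrightarrow> push_tvec A \<phi> v f = v (\<lambda>x. f (\<phi> x))"
  by (simp add: push_tvec_def comp_def)

lemma push_tvec_not_smooth: "f \<notin> SF \<Longrightarrow> push_tvec A \<phi> v f = 0"
  by (simp add: push_tvec_def)

lemma push_tvec_tangent:
  assumes \<phi>: "smooth_map A A \<phi>" and v: "v \<in> T p"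
  shows "push_tvec A \<phi> v \<in> T (\<phi> p)"
  unfolding tangent_space_def
proof (intro CollectI conjI allI ballI impI)
  fix f h assume fh: "f \<in> SF" "h \<in> SF"
  note c = SF_compose[OF \<phi> fh(1)] SF_compose[OF \<phi> fh(2)]
  show "push_tvec A \<phi> v (\<lambda>x. a * f x + b * h x) = a * push_tvec A \<phi> v f + b * push_tvec A \<phi> v h" for a b
    using tangent_lincomb[OF v c] fh by (simp add: push_tvec_apply SF_add SF_mult)
  show "push_tvec A \<phi> v (\<lambda>x. f x * h x) = f (\<phi> p) * push_tvec A \<phi> v h + h (\<phi> p) * push_tvec A \<phi> v f"
    using tangent_mult[OF v c] fh by (simp add: push_tvec_apply SF_mult)
qed (simp add: push_tvec_not_smooth)

lemma push_tvec_compose: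
  assumes "smooth_map A A \<phi>"
  shows "push_tvec A \<phi> (push_tvec A \<psi> v) = push_tvec A (\<lambda>x. \<phi> (\<psi> x)) v"
proof
  fix f
  show "push_tvec A \<phi> (push_tvec A \<psi> v) f = push_tvec A (\<lambda>x. \<phi> (\<psi> x)) v f"
    using SF_compose[OF assms, of f] by (cases "f \<in> SF") (simp_all add: push_tvec_apply push_tvec_not_smooth)
qed

lemma push_tvec_id:
  assumes "v \<in> T p"
  shows "push_tvec A (\<lambda>x. x) v = v"
proof
  fix f
  show "push_tvec A (\<lambda>x. x) v f = v f"
    using tangent_not_smooth[OF assms, of f] by (cases "f \<in> SF") (simp_all add: push_tvec_apply push_tvec_not_smooth)
qed

lemma push_tvec_lincomb:
  "push_tvec A \<phi> (a *\<^sub>R v + b *\<^sub>R w) = a *\<^sub>R push_tvec A \<phi> v + b *\<^sub>R push_tvec A \<phi> w"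
proof
  fix f
  show "push_tvec A \<phi> (a *\<^sub>R v + b *\<^sub>R w) f = (a *\<^sub>R push_tvec A \<phi> v + b *\<^sub>R push_tvec A \<phi> w) f"
    by (cases "f \<in> SF") (simp_all add: push_tvec_apply push_tvec_not_smooth)
qed

text \<open>The inverse is an explicit argument, so that push-forwards can be computed with a
  formula in place of \<open>the_inv\<close>.\<close>

definition diffeomorphism :: "('m \<Rightarrow> 'm) \<Rightarrow> ('m \<Rightarrow> 'm) \<Rightarrow> bool"
  where "diffeomorphism \<phi> \<psi> \<longleftrightarrow> smooth_map A A \<phi> \<and> smooth_map A A \<psi> \<and> (\<forall>x. \<psi> (\<phi> x) = x) \<and> (\<forall>x. \<phi> (\<psi> x) = x)"

lemma diffeomorphismD:
  assumes "diffeomorphism \<phi> \<psi>"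
  shows "smooth_map A A \<phi>" "smooth_map A A \<psi>" "\<psi> (\<phi> x) = x" "\<phi> (\<psi> x) = x" "the_inv \<phi> = \<psi>"
proof -
  show *: "smooth_map A A \<phi>" "smooth_map A A \<psi>" "\<psi> (\<phi> x) = x" "\<phi> (\<psi> x) = x" for x
    using assms unfolding diffeomorphism_def by auto
  have "inj \<phi>" by (metis injI *(3))
  then have "the_inv \<phi> y = \<psi> y" for y using the_inv_f_f[of \<phi> "\<psi> y"] *(4) by simp
  then show "the_inv \<phi> = \<psi>" ..
qed

lemma push_vf_apply: "diffeomorphism \<phi> \<psi> \<Longrightarrow> push_vf A \<phi> X q = push_tvec A \<phi> (X (\<psi> q))"
  by (simp add: push_vf_def diffeomorphismD(5))

lemma push_vf_VF:
  assumes \<phi>: "diffeomorphism \<phi> \<psi>" and X: "X \<in> VF"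
  shows "push_vf A \<phi> X \<in> VF"
  unfolding vector_fields_def
proof (intro CollectI conjI allI ballI)
  note d = diffeomorphismD[OF \<phi>]
  show "push_vf A \<phi> X q \<in> T q" for q
    using push_tvec_tangent[OF d(1) VF_tangent[OF X], of "\<psi> q"] by (simp add: push_vf_apply[OF \<phi>] d)
  fix f assume f: "f \<in> SF"
  have "(\<lambda>q. X (\<psi> q) (\<lambda>x. f (\<phi> x))) \<in> SF"
    using SF_compose[OF d(2) VF_smooth[OF X SF_compose[OF d(1) f]]] .
  then show "(\<lambda>q. push_vf A \<phi> X q f) \<in> SF" by (simp add: push_vf_apply[OF \<phi>] push_tvec_apply f)
qed

lemma push_vf_bracket:
  assumes \<phi>: "diffeomorphism \<phi> \<psi>" and X: "X \<in> VF" and Y: "Y \<in> VF"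
  shows "push_vf A \<phi> (vf_bracket X Y) = vf_bracket (push_vf A \<phi> X) (push_vf A \<phi> Y)"
proof (intro ext)
  fix q f
  note d = diffeomorphismD[OF \<phi>]
  note p = push_vf_VF[OF \<phi> X] push_vf_VF[OF \<phi> Y]
  show "push_vf A \<phi> (vf_bracket X Y) q f = vf_bracket (push_vf A \<phi> X) (push_vf A \<phi> Y) q f"
  proof (cases "f \<in> SF")
    case True
    have "push_vf A \<phi> X q (\<lambda>q. push_vf A \<phi> Y q f) = X (\<psi> q) (\<lambda>p. Y p (\<lambda>x. f (\<phi> x)))"
      using VF_smooth[OF p(2) True] by (simp add: push_vf_apply[OF \<phi>] push_tvec_apply True d)
    moreover have "push_vf A \<phi> Y q (\<lambda>q. push_vf A \<phi> X q f) = Y (\<psi> q) (\<lambda>p. X p (\<lambda>x. f (\<phi> x)))"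
      using VF_smooth[OF p(1) True] by (simp add: push_vf_apply[OF \<phi>] push_tvec_apply True d)
    ultimately show ?thesis
      using True by (simp add: vf_bracket_def push_vf_apply[OF \<phi>, of "\<lambda>p f. X p (\<lambda>q. Y q f) - Y p (\<lambda>q. X q f)"] push_tvec_apply)
  next
    case False
    then show ?thesis
      using VF_not_smooth[OF VF_bracket[OF p]] by (simp add: push_vf_apply[OF \<phi>, of "vf_bracket X Y"] push_tvec_not_smooth)
  qed
qed

end

locale liegroup =
  fixes G :: "('g::{t2_space, second_countable_topology}, 'e::real_inner) lie_data" (structure)
  assumes lie_group: "lie_group G"

sublocale liegroup \<subseteq> manifold "charts G"
  using lie_group by unfold_locales (auto simp: lie_group_def findim_def)

context liegroup
begin

abbreviation "\<gg> \<equiv> lie_algebra G"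

lemma carrier [simp]: "x \<in> carrier G"
  using lie_group by (simp add: lie_group_def)

lemma group: "group G"
  using lie_group by (simp add: lie_group_def)

lemma mult_assoc: "x \<otimes> y \<otimes> z = x \<otimes> (y \<otimes> z)"
  using group by (simp add: group.is_monoid monoid.m_assoc)

lemma mult_simps [simp]:
  "\<one> \<otimes> x = x" "x \<otimes> \<one> = x" "inv x \<otimes> x = \<one>" "x \<otimes> inv x = \<one>" "inv x \<otimes> (x \<otimes> y) = y" "x \<otimes> (inv x \<otimes> y) = y"
  "inv (inv x) = x" "inv (x \<otimes> y) = inv y \<otimes> inv x" "inv \<one> = \<one>"
proof -
  show *: "\<one> \<otimes> x = x" "x \<otimes> \<one> = x" "inv x \<otimes> x = \<one>" "x \<otimes> inv x = \<one>" for x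
    using group by (simp_all add: group.is_monoid group.l_inv group.r_inv monoid.l_one monoid.r_one)
  show "inv x \<otimes> (x \<otimes> y) = y" "x \<otimes> (inv x \<otimes> y) = y"
    by (simp_all add: mult_assoc[symmetric] *)
  show "inv (inv x) = x" "inv (x \<otimes> y) = inv y \<otimes> inv x" "inv \<one> = \<one>"
    using group by (simp_all add: group.inv_inv group.inv_mult_group monoid.inv_one group.is_monoid)
qed

lemma mult_one_fun [simp]: "(\<otimes>) \<one> = (\<lambda>x. x)"
  by (simp add: fun_eq_iff)

lemma smooth_mult:
  assumes "smooth_map B (charts G) a" "smooth_map B (charts G) b" "topological_atlas B"
  shows "smooth_map B (charts G) (\<lambda>x. a x \<otimes> b x)"
proof -
  have "smooth_map (product_atlas (charts G) (charts G)) (charts G) (\<lambda>(g, h). g \<otimes> h)"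
    using lie_group by (simp add: lie_group_def)
  from smooth_map_compose[OF assms(3) topological2 findim_prod[OF fd fd] topological
      smooth_map_Pair[OF assms(3) topological topological assms(1,2)] this]
  show ?thesis by simp
qed

lemma smooth_inv:
  assumes "smooth_map B (charts G) a" "topological_atlas B"
  shows "smooth_map B (charts G) (\<lambda>x. inv (a x))"
proof -
  have "smooth_map (charts G) (charts G) (\<lambda>g. inv g)"
    using lie_group by (simp add: lie_group_def)
  from smooth_map_compose[OF assms(2) topological fd topological assms(1) this] show ?thesis .
qed

lemma smooth_left: "smooth_map (charts G) (charts G) (\<lambda>g. a \<otimes> g)"
  by (intro smooth_mult smooth_map_const smooth_map_id topological atlas)

lemma smooth_right: "smooth_map (charts G) (charts G) (\<lambda>g. g \<otimes> a)"
  by (intro smooth_mult smooth_map_const smooth_map_id topological atlas)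

lemma diffeomorphism_left: "diffeomorphism (\<lambda>g. a \<otimes> g) (\<lambda>g. inv a \<otimes> g)"
  by (simp add: diffeomorphism_def smooth_left)

lemmas push_left = push_vf_apply[OF diffeomorphism_left]

lemma smooth_fst: "smooth_map (product_atlas (charts G) (charts G)) (charts G) fst"
  by (rule smooth_map_fst[OF atlas fd topological])

lemma smooth_snd: "smooth_map (product_atlas (charts G) (charts G)) (charts G) snd"
  by (rule smooth_map_snd[OF topological atlas fd])

lemma smooth_const2: "smooth_map (product_atlas (charts G) (charts G)) (charts G) (\<lambda>z. c)"
  by (rule smooth_map_const[OF topological2])

lemma SF2_compose:
  "f \<in> SF \<Longrightarrow> smooth_map (product_atlas (charts G) (charts G)) (charts G) a \<Longrightarrow> (\<lambda>z. f (a z)) \<in> SF2"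
  by (rule smooth_functions_compose[OF topological2 topological fd])

lemma lie_algebra_iff: "\<xi> \<in> \<gg> \<longleftrightarrow> \<xi> \<in> T \<one>"
  by (simp add: lie_algebra_def)

lemma lie_algebra_lincomb: "\<xi> \<in> \<gg> \<Longrightarrow> \<zeta> \<in> \<gg> \<Longrightarrow> a *\<^sub>R \<xi> + b *\<^sub>R \<zeta> \<in> \<gg>"
  unfolding lie_algebra_iff by (rule tangent_space_lincomb)

lemma lie_algebra_0: "0 \<in> \<gg>"
  unfolding lie_algebra_iff by (rule tangent_space_0)


subsection \<open>Invariant vector fields\<close>

text \<open>On a fixed smooth f the value is the derivative along \<xi> of (g, h) \<mapsto> f (g h)
  in h, at the unit; \<open>tangent_family_const\<close> makes it smooth in g.\<close>

lemma push_translate_VF: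
  assumes \<xi>: "\<xi> \<in> \<gg>"
  shows "(\<lambda>g. push_tvec (charts G) (\<lambda>h. g \<otimes> h) \<xi>) \<in> VF"
  unfolding vector_fields_def
proof (intro CollectI conjI allI ballI)
  fix g show "push_tvec (charts G) (\<lambda>h. g \<otimes> h) \<xi> \<in> T g"
    using push_tvec_tangent[OF smooth_left \<xi>[unfolded lie_algebra_iff], of g] by simp
next
  fix f assume f: "f \<in> SF"
  have "(\<lambda>z. f (fst z \<otimes> snd z)) \<in> SF2"
    by (intro SF2_compose f smooth_mult smooth_fst smooth_snd topological2)
  from tangent_family_const(1)[OF this \<xi>[unfolded lie_algebra_iff]]
  show "(\<lambda>g. push_tvec (charts G) (\<lambda>h. g \<otimes> h) \<xi> f) \<in> SF"
    using f by (simp add: push_tvec_apply)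
qed

text \<open>An invariant field is fixed by its value at the unit; this is the uniqueness behind the
  definite description \<open>left_field\<close>.\<close>

lemma left_field_eqI:
  assumes X: "X \<in> VF" and inv: "\<And>a. push_vf (charts G) (\<lambda>g. a \<otimes> g) X = X"
  shows "left_field G (X \<one>) = X"
  unfolding left_field_def
proof (rule the_equality)
  show "X \<in> VF \<and> (\<forall>a\<in>carrier G. push_vf (charts G) ((\<otimes>) a) X = X) \<and> X \<one> = X \<one>"
    using X inv by simp
  fix Y assume Y: "Y \<in> VF \<and> (\<forall>a\<in>carrier G. push_vf (charts G) ((\<otimes>) a) Y = Y) \<and> Y \<one> = X \<one>"
  have "Y a = X a" for a
  proof -
    have "Y a = push_vf (charts G) ((\<otimes>) a) Y a" using Y by simp
    also have "\<dots> = push_vf (charts G) ((\<otimes>) a) X a" unfolding push_left using Y by simp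
    finally show ?thesis using inv[of a] by simp
  qed
  then show "Y = X" ..
qed

lemma left_field_eq:
  assumes \<xi>: "\<xi> \<in> \<gg>"
  shows "left_field G \<xi> = (\<lambda>g. push_tvec (charts G) (\<lambda>h. g \<otimes> h) \<xi>)" (is "_ = ?X")
proof -
  have "left_field G (?X \<one>) = ?X"
  proof (rule left_field_eqI[OF push_translate_VF[OF \<xi>]])
    show "push_vf (charts G) (\<lambda>g. a \<otimes> g) ?X = ?X" for a
      by (intro ext) (simp add: push_left push_tvec_compose[OF smooth_left] mult_assoc[symmetric])
  qed
  then show ?thesis using push_tvec_id \<xi> by (simp add: lie_algebra_iff)
qed

lemma left_field_VF: "\<xi> \<in> \<gg> \<Longrightarrow> left_field G \<xi> \<in> VF"
  using push_translate_VF left_field_eq by simp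

lemma left_field_one: "\<xi> \<in> \<gg> \<Longrightarrow> left_field G \<xi> \<one> = \<xi>"
  using push_tvec_id by (simp add: left_field_eq lie_algebra_iff)

lemma left_field_apply: "\<xi> \<in> \<gg> \<Longrightarrow> f \<in> SF \<Longrightarrow> left_field G \<xi> g f = \<xi> (\<lambda>h. f (g \<otimes> h))"
  by (simp add: left_field_eq push_tvec_apply)

lemma push_left_field:
  assumes "\<xi> \<in> \<gg>"
  shows "push_vf (charts G) (\<lambda>g. a \<otimes> g) (left_field G \<xi>) = left_field G \<xi>"
  by (intro ext) (simp add: left_field_eq[OF assms] push_left push_tvec_compose[OF smooth_left] mult_assoc[symmetric])

lemma left_field_lincomb:
  "\<xi> \<in> \<gg> \<Longrightarrow> \<zeta> \<in> \<gg> \<Longrightarrow>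
    left_field G (a *\<^sub>R \<xi> + b *\<^sub>R \<zeta>) = (\<lambda>g. a *\<^sub>R left_field G \<xi> g + b *\<^sub>R left_field G \<zeta> g)"
  by (simp add: left_field_eq lie_algebra_lincomb push_tvec_lincomb)

lemma lie_bracket_mem: "\<xi> \<in> \<gg> \<Longrightarrow> \<zeta> \<in> \<gg> \<Longrightarrow> lie_bracket G \<xi> \<zeta> \<in> \<gg>"
  unfolding lie_bracket_def lie_algebra_iff by (intro VF_tangent VF_bracket left_field_VF) (simp_all add: lie_algebra_iff)

text \<open>Push-forward by left translations preserves brackets, so the bracket of invariant fields
  is invariant and is the field of its value at the unit.\<close>

lemma left_field_bracket:
  assumes "\<xi> \<in> \<gg>" "\<zeta> \<in> \<gg>"
  shows "vf_bracket (left_field G \<xi>) (left_field G \<zeta>) = left_field G (lie_bracket G \<xi> \<zeta>)"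
  unfolding lie_bracket_def
  by (rule left_field_eqI[symmetric])
    (use assms in \<open>simp_all add: VF_bracket left_field_VF push_vf_bracket[OF diffeomorphism_left] push_left_field\<close>)

lemma lie_bracket_antisym: "lie_bracket G \<xi> \<zeta> = - lie_bracket G \<zeta> \<xi>"
  unfolding lie_bracket_def by (subst vf_bracket_uminus_swap) simp

lemma lie_bracket_self: "lie_bracket G \<xi> \<xi> = 0"
  by (simp add: lie_bracket_def vf_bracket_self)

lemma lie_bracket_lincomb_right:
  assumes "\<xi> \<in> \<gg>" "\<zeta> \<in> \<gg>" "\<zeta>' \<in> \<gg>"
  shows "lie_bracket G \<xi> (a *\<^sub>R \<zeta> + b *\<^sub>R \<zeta>') = a *\<^sub>R lie_bracket G \<xi> \<zeta> + b *\<^sub>R lie_bracket G \<xi> \<zeta>'"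
  unfolding lie_bracket_def left_field_lincomb[OF assms(2,3)]
    vf_bracket_lincomb[OF left_field_VF[OF assms(1)] left_field_VF[OF assms(2)] left_field_VF[OF assms(3)] SF_const SF_const]
  using tangent_const[OF VF_tangent[OF left_field_VF[OF assms(1)]]] by simp

lemma lie_bracket_lincomb_left:
  assumes "\<xi> \<in> \<gg>" "\<zeta> \<in> \<gg>" "\<zeta>' \<in> \<gg>"
  shows "lie_bracket G (a *\<^sub>R \<zeta> + b *\<^sub>R \<zeta>') \<xi> = a *\<^sub>R lie_bracket G \<zeta> \<xi> + b *\<^sub>R lie_bracket G \<zeta>' \<xi>"
  using lie_bracket_lincomb_right[OF assms, of a b]
    lie_bracket_antisym[of "a *\<^sub>R \<zeta> + b *\<^sub>R \<zeta>'" \<xi>] lie_bracket_antisym[of \<zeta> \<xi>] lie_bracket_antisym[of \<zeta>' \<xi>]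
  by simp


subsection \<open>Maurer--Cartan forms\<close>

text \<open>Left translation by inv g inverts the passage from \<xi> to its field at g, so the
  definite description in \<open>MC_left\<close> has this explicit value.\<close>

lemma MC_left_eq:
  assumes X: "X \<in> VF"
  shows "MC_left G [X] g = push_tvec (charts G) (\<lambda>h. inv g \<otimes> h) (X g)"
    "MC_left G [X] g \<in> \<gg>" "left_field G (MC_left G [X] g) g = X g"
proof -
  let ?\<xi> = "push_tvec (charts G) (\<lambda>h. inv g \<otimes> h) (X g)"
  have mem: "?\<xi> \<in> \<gg>"
    using push_tvec_tangent[OF smooth_left VF_tangent[OF X], of "inv g" g] by (simp add: lie_algebra_iff)
  have eq: "left_field G ?\<xi> g = X g"
    using push_tvec_id[OF VF_tangent[OF X]] by (simp add: left_field_eq[OF mem] push_tvec_compose[OF smooth_left])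
  have "(THE \<xi>. \<xi> \<in> \<gg> \<and> left_field G \<xi> g = X g) = ?\<xi>"
  proof (rule the_equality)
    fix \<xi> assume \<xi>: "\<xi> \<in> \<gg> \<and> left_field G \<xi> g = X g"
    then have "X g = push_tvec (charts G) (\<lambda>h. g \<otimes> h) \<xi>" using left_field_eq[of \<xi>] by auto
    then have "?\<xi> = push_tvec (charts G) (\<lambda>h. inv g \<otimes> h) (push_tvec (charts G) (\<lambda>h. g \<otimes> h) \<xi>)"
      by simp
    also have "\<dots> = \<xi>"
      using \<xi> push_tvec_id[of \<xi> \<one>] by (simp add: push_tvec_compose[OF smooth_left] lie_algebra_iff)
    finally show "\<xi> = ?\<xi>" ..
  qed (use mem eq in simp)
  then show *: "MC_left G [X] g = ?\<xi>" using X by (simp add: MC_left_def)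
  show "MC_left G [X] g \<in> \<gg>" "left_field G (MC_left G [X] g) g = X g" using mem eq by (simp_all add: *)
qed

lemma MC_left_left_field:
  assumes "\<xi> \<in> \<gg>"
  shows "MC_left G [left_field G \<xi>] g = \<xi>"
  unfolding MC_left_eq(1)[OF left_field_VF[OF assms]]
  using push_tvec_id[of \<xi> \<one>] assms
  by (simp add: left_field_eq push_tvec_compose[OF smooth_left] lie_algebra_iff)

lemma MC_left_lincomb:
  "X \<in> VF \<Longrightarrow> Y \<in> VF \<Longrightarrow> f \<in> SF \<Longrightarrow> h \<in> SF \<Longrightarrow>
    MC_left G [\<lambda>p. f p *\<^sub>R X p + h p *\<^sub>R Y p] g = f g *\<^sub>R MC_left G [X] g + h g *\<^sub>R MC_left G [Y] g"
  by (simp add: MC_left_eq(1) VF_lincomb push_tvec_lincomb)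

text \<open>The function (g, h) \<mapsto> u (inv g h) is differentiated in h at the moving point h =
  g, the case of \<open>tangent_family\<close> with the identity as a.\<close>

lemma MC_left_smooth:
  assumes X: "X \<in> VF" and u: "u \<in> SF"
  shows "(\<lambda>g. MC_left G [X] g u) \<in> SF"
proof -
  have "(\<lambda>z. u (inv (fst z) \<otimes> snd z)) \<in> SF2"
    by (intro SF2_compose u smooth_mult smooth_inv smooth_fst smooth_snd topological2)
  from tangent_family[OF this smooth_map_id[OF atlas] VF_tangent[OF X] VF_smooth[OF X]]
  show ?thesis using u by (simp add: MC_left_eq(1)[OF X] push_tvec_apply)
qed

definition tensorial :: "('g vfield \<Rightarrow> 'g \<Rightarrow> real) \<Rightarrow> bool"
  where "tensorial \<Phi> \<longleftrightarrow> (\<forall>X\<in>VF. \<forall>Y\<in>VF. \<forall>f\<in>SF. \<forall>h\<in>SF. \<forall>p.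
    \<Phi> (\<lambda>p. f p *\<^sub>R X p + h p *\<^sub>R Y p) p = f p * \<Phi> X p + h p * \<Phi> Y p)"

lemma tensorialI:
  "(\<And>X Y f h p. X \<in> VF \<Longrightarrow> Y \<in> VF \<Longrightarrow> f \<in> SF \<Longrightarrow> h \<in> SF \<Longrightarrow>
    \<Phi> (\<lambda>p. f p *\<^sub>R X p + h p *\<^sub>R Y p) p = f p * \<Phi> X p + h p * \<Phi> Y p) \<Longrightarrow> tensorial \<Phi>"
  unfolding tensorial_def by blast

lemma tensorialD:
  "tensorial \<Phi> \<Longrightarrow> X \<in> VF \<Longrightarrow> Y \<in> VF \<Longrightarrow> f \<in> SF \<Longrightarrow> h \<in> SF \<Longrightarrow>
    \<Phi> (\<lambda>p. f p *\<^sub>R X p + h p *\<^sub>R Y p) p = f p * \<Phi> X p + h p * \<Phi> Y p"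
  unfolding tensorial_def by blast

text \<open>The left-invariant fields form a global frame, with smooth coefficients given by the
  Maurer--Cartan form.\<close>

lemma tensorial_zero:
  assumes \<Phi>: "tensorial \<Phi>" and zero: "\<And>\<xi> p. \<xi> \<in> \<gg> \<Longrightarrow> \<Phi> (left_field G \<xi>) p = 0" and X: "X \<in> VF"
  shows "\<Phi> X p = 0"
proof -
  obtain E :: "'e set" and u e where E: "finite E" "\<And>b. u b \<in> SF" "\<And>b. e b \<in> T \<one>"
    "\<And>v. v \<in> T \<one> \<Longrightarrow> v = (\<Sum>b\<in>E. v (u b) *\<^sub>R e b)"
    using tangent_dual_basis by blast
  have e: "e b \<in> \<gg>" for b using E(3) by (simp add: lie_algebra_iff)
  \<comment> \<open>The coefficients of X in the frame of the fields of e b: the Maurer-Cartan value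
    lies in the Lie algebra, where its coordinates are its values on the functions u b.\<close>
  define c where "c b g = MC_left G [X] g (u b)" for b g
  have c: "c b \<in> SF" for b
    unfolding c_def by (rule MC_left_smooth[OF X E(2)])
  define S where "S F = (\<lambda>g. \<Sum>b\<in>F. c b g *\<^sub>R left_field G (e b) g)" for F
  \<comment> \<open>The coefficient 1 stays explicit to match the two-term pattern of
    \<open>tensorial\<close> and \<open>VF_lincomb\<close>.\<close>
  have S_insert: "S (insert b F) = (\<lambda>g. c b g *\<^sub>R left_field G (e b) g + (\<lambda>_. 1) g *\<^sub>R S F g)"
    if "finite F" "b \<notin> F" for b F
    unfolding S_def using that by (intro ext) simp
  have "S F \<in> VF \<and> \<Phi> (S F) p = 0" if "finite F" for F
    using that
  proof (induction F rule: finite_induct)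
    case empty
    have S0: "S {} = 0" by (simp add: S_def fun_eq_iff)
    have "(\<lambda>p. (\<lambda>_. 0) p *\<^sub>R (0 :: 'g vfield) p + (\<lambda>_. 0) p *\<^sub>R (0 :: 'g vfield) p) = 0"
      by (simp add: fun_eq_iff)
    then have "\<Phi> 0 p = 0" using tensorialD[OF \<Phi> VF_0 VF_0 SF_const[of 0] SF_const[of 0], of p] by simp
    then show "S {} \<in> VF \<and> \<Phi> (S {}) p = 0" unfolding S0 using VF_0 by blast
  next
    case (insert b F)
    note i = S_insert[OF insert.hyps]
    show "S (insert b F) \<in> VF \<and> \<Phi> (S (insert b F)) p = 0"
      unfolding i
      using insert.IH tensorialD[OF \<Phi> left_field_VF[OF e] _ c SF_const, of "S F" b b 1 p]
        VF_lincomb[OF left_field_VF[OF e] _ c SF_const, of "S F" b b 1] zero[OF e] by simp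
  qed
  moreover have "X = S E"
  proof
    fix g
    have push_sum: "push_tvec (charts G) \<phi> (\<Sum>b\<in>F. k b *\<^sub>R e b) = (\<Sum>b\<in>F. k b *\<^sub>R push_tvec (charts G) \<phi> (e b))"
      if "finite F" for F k \<phi>
      using that
    proof (induction F rule: finite_induct)
      case empty
      have "push_tvec (charts G) \<phi> 0 = 0" by (intro ext) (simp add: push_tvec_def)
      then show "push_tvec (charts G) \<phi> (\<Sum>b\<in>{}. k b *\<^sub>R e b) = (\<Sum>b\<in>{}. k b *\<^sub>R push_tvec (charts G) \<phi> (e b))"
        by (simp only: sum.empty)
    next
      case (insert b F)
      have "push_tvec (charts G) \<phi> (k b *\<^sub>R e b + 1 *\<^sub>R (\<Sum>b\<in>F. k b *\<^sub>R e b)) =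
        k b *\<^sub>R push_tvec (charts G) \<phi> (e b) + 1 *\<^sub>R push_tvec (charts G) \<phi> (\<Sum>b\<in>F. k b *\<^sub>R e b)"
        by (rule push_tvec_lincomb)
      then show ?case by (simp only: sum.insert[OF insert.hyps] scaleR_one insert.IH)
    qed
    note m = MC_left_eq(2)[OF X, of g]
    have "X g = push_tvec (charts G) (\<lambda>h. g \<otimes> h) (MC_left G [X] g)"
      using MC_left_eq(3)[OF X, of g] unfolding left_field_eq[OF m] by simp
    also have "MC_left G [X] g = (\<Sum>b\<in>E. c b g *\<^sub>R e b)"
      unfolding c_def by (rule E(4)[OF m[unfolded lie_algebra_iff]])
    also have "push_tvec (charts G) (\<lambda>h. g \<otimes> h) (\<Sum>b\<in>E. c b g *\<^sub>R e b) = S E g"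
      unfolding push_sum[OF E(1)] S_def by (simp add: left_field_eq[OF e])
    finally show "X g = S E g" .
  qed
  ultimately show ?thesis using E(1) by simp
qed

text \<open>Smoothness of P and Q is tested on smooth functions u. Expansion at the unit turns
  finitely many of these tests into coordinates, and m contributes the constants m (e b) (e
  c).\<close>

lemma smooth_bilinear:
  fixes m :: "'g tvec \<Rightarrow> 'g tvec \<Rightarrow> real"
  assumes l: "\<And>x y z a b. x \<in> \<gg> \<Longrightarrow> y \<in> \<gg> \<Longrightarrow> z \<in> \<gg> \<Longrightarrow> m (a *\<^sub>R x + b *\<^sub>R y) z = a * m x z + b * m y z"
    and r: "\<And>x y z a b. x \<in> \<gg> \<Longrightarrow> y \<in> \<gg> \<Longrightarrow> z \<in> \<gg> \<Longrightarrow> m z (a *\<^sub>R x + b *\<^sub>R y) = a * m z x + b * m z y"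
    and P: "\<And>g. P g \<in> \<gg>" "\<And>u. u \<in> SF \<Longrightarrow> (\<lambda>g. P g u) \<in> SF"
    and Q: "\<And>g. Q g \<in> \<gg>" "\<And>u. u \<in> SF \<Longrightarrow> (\<lambda>g. Q g u) \<in> SF"
  shows "(\<lambda>g. m (P g) (Q g)) \<in> SF"
proof -
  obtain E :: "'e set" and u e where E: "finite E" "\<And>b. u b \<in> SF" "\<And>b. e b \<in> T \<one>"
    "\<And>v. v \<in> T \<one> \<Longrightarrow> v = (\<Sum>b\<in>E. v (u b) *\<^sub>R e b)"
    using tangent_dual_basis by blast
  have e: "e b \<in> \<gg>" for b using E(3) by (simp add: lie_algebra_iff)
  have mem: "(\<Sum>b\<in>F. k b *\<^sub>R e b) \<in> \<gg>" for F k
    unfolding lie_algebra_iff by (rule tangent_space_sum) (rule E(3))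
  have suml: "m (\<Sum>b\<in>F. k b *\<^sub>R e b) z = (\<Sum>b\<in>F. k b * m (e b) z)" if "finite F" "z \<in> \<gg>" for F k z
    using that
  proof (induction F rule: finite_induct)
    case empty
    have "m 0 z = 0" using l[OF lie_algebra_0 lie_algebra_0 empty, of 0 0] by simp
    then show "m (\<Sum>b\<in>{}. k b *\<^sub>R e b) z = (\<Sum>b\<in>{}. k b * m (e b) z)" by (simp only: sum.empty)
  next
    case (insert b F)
    have "m (k b *\<^sub>R e b + 1 *\<^sub>R (\<Sum>b\<in>F. k b *\<^sub>R e b)) z = k b * m (e b) z + 1 * m (\<Sum>b\<in>F. k b *\<^sub>R e b) z"
      by (rule l[OF e mem insert.prems])
    then show ?case by (simp only: sum.insert[OF insert.hyps] scaleR_one insert.IH[OF insert.prems] mult_1)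
  qed
  have sumr: "m z (\<Sum>b\<in>F. k b *\<^sub>R e b) = (\<Sum>b\<in>F. k b * m z (e b))" if "finite F" "z \<in> \<gg>" for F k z
    using that
  proof (induction F rule: finite_induct)
    case empty
    have "m z 0 = 0" using r[OF lie_algebra_0 lie_algebra_0 empty, of 0 0] by simp
    then show "m z (\<Sum>b\<in>{}. k b *\<^sub>R e b) = (\<Sum>b\<in>{}. k b * m z (e b))" by (simp only: sum.empty)
  next
    case (insert b F)
    have "m z (k b *\<^sub>R e b + 1 *\<^sub>R (\<Sum>b\<in>F. k b *\<^sub>R e b)) = k b * m z (e b) + 1 * m z (\<Sum>b\<in>F. k b *\<^sub>R e b)"
      by (rule r[OF e mem insert.prems])
    then show ?case by (simp only: sum.insert[OF insert.hyps] scaleR_one insert.IH[OF insert.prems] mult_1)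
  qed
  have "m (P g) (Q g) = (\<Sum>b\<in>E. P g (u b) * (\<Sum>c\<in>E. Q g (u c) * m (e b) (e c)))" for g
  proof -
    have "m (P g) (Q g) = m (\<Sum>b\<in>E. P g (u b) *\<^sub>R e b) (Q g)"
      using E(4)[OF P(1)[unfolded lie_algebra_iff]] by (rule arg_cong)
    also have "\<dots> = (\<Sum>b\<in>E. P g (u b) * m (e b) (Q g))" by (rule suml[OF E(1) Q(1)])
    also have "\<dots> = (\<Sum>b\<in>E. P g (u b) * (\<Sum>c\<in>E. Q g (u c) * m (e b) (e c)))"
    proof (rule sum.cong[OF refl])
      fix b
      have "m (e b) (Q g) = m (e b) (\<Sum>c\<in>E. Q g (u c) *\<^sub>R e c)"
        using E(4)[OF Q(1)[unfolded lie_algebra_iff]] by (rule arg_cong)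
      then show "P g (u b) * m (e b) (Q g) = P g (u b) * (\<Sum>c\<in>E. Q g (u c) * m (e b) (e c))"
        using sumr[OF E(1) e] by simp
    qed
    finally show ?thesis .
  qed
  moreover have "(\<lambda>g. \<Sum>b\<in>E. P g (u b) * (\<Sum>c\<in>E. Q g (u c) * m (e b) (e c))) \<in> SF"
    by (intro SF_sum SF_mult P(2) Q(2) E(2) SF_const)
  ultimately show ?thesis by simp
qed

end


subsection \<open>The opposite group\<close>

text \<open>Right-invariant objects on \<open>G\<close> are left-invariant objects on the opposite group.\<close>

definition opposite :: "('g, 'e) lie_data \<Rightarrow> ('g, 'e) lie_data"
  where "opposite G = G\<lparr>mult := \<lambda>x y. y \<otimes>\<^bsub>G\<^esub> x\<rparr>"

lemma opposite_simps [simp]: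
  "x \<otimes>\<^bsub>opposite G\<^esub> y = y \<otimes>\<^bsub>G\<^esub> x" "\<one>\<^bsub>opposite G\<^esub> = \<one>\<^bsub>G\<^esub>" "carrier (opposite G) = carrier G"
  "charts (opposite G) = charts G"
  by (simp_all add: opposite_def)

lemma lie_algebra_opposite [simp]: "lie_algebra (opposite G) = lie_algebra G"
  by (simp add: lie_algebra_def)

lemma inv_opposite [simp]: "inv\<^bsub>opposite G\<^esub> x = inv\<^bsub>G\<^esub> x"
  by (simp add: m_inv_def conj_commute)

lemma right_field_opposite: "right_field G = left_field (opposite G)"
  by (simp add: fun_eq_iff right_field_def left_field_def)

lemma MC_right_opposite: "MC_right G = MC_left (opposite G)"
  unfolding MC_right_def MC_left_def right_field_opposite opposite_simps lie_algebra_opposite ..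

context liegroup
begin

lemma opposite: "liegroup (opposite G)"
proof
  have "group (opposite G)"
  proof (rule groupI)
    show "\<exists>y\<in>carrier (opposite G). y \<otimes>\<^bsub>opposite G\<^esub> x = \<one>\<^bsub>opposite G\<^esub>" for x
      by (intro bexI[of _ "inv x"]) simp_all
  qed (simp_all add: mult_assoc)
  moreover have "smooth_map (product_atlas (charts G) (charts G)) (charts G) (\<lambda>(g, h). h \<otimes> g)"
    using smooth_mult[OF smooth_snd smooth_fst topological2] by (simp add: case_prod_beta')
  ultimately show "lie_group (opposite G)"
    using lie_group by (simp add: lie_group_def)
qed

lemmas right_field_eq = liegroup.left_field_eq[OF opposite, folded right_field_opposite, simplified]
lemmas right_field_VF = liegroup.left_field_VF[OF opposite, folded right_field_opposite, simplified]
lemmas right_field_one = liegroup.left_field_one[OF opposite, folded right_field_opposite, simplified]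
lemmas right_field_lincomb = liegroup.left_field_lincomb[OF opposite, folded right_field_opposite, simplified]
lemmas MC_right_eq = liegroup.MC_left_eq[OF opposite, folded right_field_opposite MC_right_opposite, simplified]
lemmas MC_right_right_field =
  liegroup.MC_left_left_field[OF opposite, folded right_field_opposite MC_right_opposite, simplified]

text \<open>Both iterated derivatives are mixed derivatives at the unit of (h, k) \<mapsto> f (k g
  h): left fields differentiate in the right-hand factor h, right fields in the left-hand factor
  k.\<close>

lemma left_right_commute:
  assumes \<xi>: "\<xi> \<in> \<gg>" and \<zeta>: "\<zeta> \<in> \<gg>"
  shows "vf_bracket (left_field G \<xi>) (right_field G \<zeta>) = 0"
proof (intro ext)
  fix g f
  note L = left_field_VF[OF \<xi>] and R = right_field_VF[OF \<zeta>]
  show "vf_bracket (left_field G \<xi>) (right_field G \<zeta>) g f = 0 g f"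
  proof (cases "f \<in> SF")
    case True
    have right_apply: "right_field G \<zeta> g f = \<zeta> (\<lambda>k. f (k \<otimes> g))" if "f \<in> SF" for g f
      using that by (simp add: right_field_eq[OF \<zeta>] push_tvec_apply)
    have F: "(\<lambda>z. f (snd z \<otimes> (g \<otimes> fst z))) \<in> SF2"
      by (intro SF2_compose True smooth_mult smooth_fst smooth_snd smooth_const2 topological2)
    have "left_field G \<xi> g (\<lambda>q. right_field G \<zeta> q f) = \<xi> (\<lambda>h. \<zeta> (\<lambda>k. f (k \<otimes> (g \<otimes> h))))"
      using VF_smooth[OF R True] by (simp add: left_field_apply[OF \<xi>] right_apply True)
    also have "\<dots> = \<zeta> (\<lambda>k. \<xi> (\<lambda>h. f (k \<otimes> (g \<otimes> h))))"
      using tangent_commute[OF F \<xi>[unfolded lie_algebra_iff] \<zeta>[unfolded lie_algebra_iff]] by simp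
    also have "\<dots> = right_field G \<zeta> g (\<lambda>q. left_field G \<xi> q f)"
      using VF_smooth[OF L True] by (simp add: left_field_apply[OF \<xi>] right_apply True mult_assoc)
    finally show ?thesis by (simp add: vf_bracket_def)
  next
    case False
    then show ?thesis using VF_not_smooth[OF VF_bracket[OF L R]] by simp
  qed
qed

text \<open>At the unit the left and right fields of an element coincide. Commuting left with right
  fields therefore exchanges the two orders of differentiation, which reverses the bracket.\<close>

lemma lie_bracket_opposite:
  assumes \<xi>: "\<xi> \<in> \<gg>" and \<zeta>: "\<zeta> \<in> \<gg>"
  shows "lie_bracket (opposite G) \<xi> \<zeta> = - lie_bracket G \<xi> \<zeta>"
proof
  fix f
  have sw: "left_field G \<xi> \<one> (\<lambda>q. right_field G \<zeta> q f) = right_field G \<zeta> \<one> (\<lambda>q. left_field G \<xi> q f)"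
    if "\<xi> \<in> \<gg>" "\<zeta> \<in> \<gg>" for \<xi> \<zeta>
    using fun_cong[OF fun_cong[OF left_right_commute[OF that]], of \<one> f] by (simp add: vf_bracket_def)
  show "lie_bracket (opposite G) \<xi> \<zeta> f = (- lie_bracket G \<xi> \<zeta>) f"
    using sw[OF \<xi> \<zeta>] sw[OF \<zeta> \<xi>] assms
    by (simp add: lie_bracket_def right_field_opposite[symmetric] vf_bracket_def left_field_one right_field_one)
qed

lemma right_field_uminus:
  assumes "\<xi> \<in> \<gg>"
  shows "right_field G (- \<xi>) = - right_field G \<xi>"
  using right_field_lincomb[OF assms assms, of "-1" 0] by (simp add: fun_Compl_def)

lemma right_field_bracket:
  assumes "\<xi> \<in> \<gg>" "\<zeta> \<in> \<gg>"
  shows "vf_bracket (right_field G \<xi>) (right_field G \<zeta>) = - right_field G (lie_bracket G \<xi> \<zeta>)"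
  using liegroup.left_field_bracket[OF opposite, of \<xi> \<zeta>] assms
  by (simp add: right_field_opposite[symmetric] lie_bracket_opposite right_field_uminus lie_bracket_mem)

lemma smooth_conjugate: "smooth_map (charts G) (charts G) (\<lambda>g. a \<otimes> g \<otimes> inv a)"
  by (intro smooth_mult smooth_map_const smooth_map_id topological atlas)

lemma Ad_mem: "\<xi> \<in> \<gg> \<Longrightarrow> Ad G a \<xi> \<in> \<gg>"
  using push_tvec_tangent[OF smooth_conjugate, of \<xi> \<one> a] by (simp add: Ad_def lie_algebra_iff)

lemma Ad_inv: "\<xi> \<in> \<gg> \<Longrightarrow> Ad G a (Ad G (inv a) \<xi>) = \<xi>"
  unfolding Ad_def push_tvec_compose[OF smooth_conjugate]
  using push_tvec_id[of \<xi> \<one>] by (simp add: mult_assoc lie_algebra_iff)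

lemma MC_left_right_field:
  assumes "\<xi> \<in> \<gg>"
  shows "MC_left G [right_field G \<xi>] g = Ad G (inv g) \<xi>"
  unfolding MC_left_eq(1)[OF right_field_VF[OF assms]]
  by (simp add: right_field_eq[OF assms] push_tvec_compose[OF smooth_left] Ad_def mult_assoc)

lemma MC_right_left_field:
  assumes "\<xi> \<in> \<gg>"
  shows "MC_right G [left_field G \<xi>] g = Ad G g \<xi>"
  unfolding MC_right_eq(1)[OF left_field_VF[OF assms]]
  by (simp add: left_field_eq[OF assms] push_tvec_compose[OF smooth_right] Ad_def)

lemma diffeomorphism_act: "diffeomorphism (\<lambda>g. b \<otimes> g \<otimes> inv a) (\<lambda>g. inv b \<otimes> g \<otimes> a)"
  unfolding diffeomorphism_def
  by (intro conjI allI smooth_mult smooth_map_const smooth_map_id topological atlas) (simp_all add: mult_assoc)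

text \<open>A left field is preserved by left translation with b, while right translation by inv a
  changes \<xi> to Ad a \<xi>. For right fields the roles of the two translations are
  exchanged.\<close>

lemma push_act_left_field:
  assumes "\<xi> \<in> \<gg>"
  shows "push_vf (charts G) (\<lambda>g. b \<otimes> g \<otimes> inv a) (left_field G \<xi>) = left_field G (Ad G a \<xi>)"
proof
  note d = diffeomorphism_act[of b a]
  fix g
  show "push_vf (charts G) (\<lambda>g. b \<otimes> g \<otimes> inv a) (left_field G \<xi>) g = left_field G (Ad G a \<xi>) g"
    unfolding push_vf_apply[OF d] left_field_eq[OF assms] left_field_eq[OF Ad_mem[OF assms]]
    unfolding push_tvec_compose[OF diffeomorphismD(1)[OF d]] push_tvec_compose[OF smooth_left] Ad_def
    by (simp add: mult_assoc)
qed

lemma push_act_right_field: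
  assumes "\<xi> \<in> \<gg>"
  shows "push_vf (charts G) (\<lambda>g. b \<otimes> g \<otimes> inv a) (right_field G \<xi>) = right_field G (Ad G b \<xi>)"
proof
  note d = diffeomorphism_act[of b a]
  fix g
  show "push_vf (charts G) (\<lambda>g. b \<otimes> g \<otimes> inv a) (right_field G \<xi>) g = right_field G (Ad G b \<xi>) g"
    unfolding push_vf_apply[OF d] right_field_eq[OF assms] right_field_eq[OF Ad_mem[OF assms]]
    unfolding push_tvec_compose[OF diffeomorphismD(1)[OF d]] push_tvec_compose[OF smooth_right] Ad_def
    by (simp add: mult_assoc)
qed

text \<open>Conjugation is the case b = a of the action, and push-forward preserves brackets of
  fields.\<close>

lemma Ad_bracket:
  assumes "\<xi> \<in> \<gg>" "\<zeta> \<in> \<gg>"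
  shows "Ad G a (lie_bracket G \<xi> \<zeta>) = lie_bracket G (Ad G a \<xi>) (Ad G a \<zeta>)"
proof -
  note d = diffeomorphism_act[of a a]
  have "lie_bracket G (Ad G a \<xi>) (Ad G a \<zeta>) =
      push_vf (charts G) (\<lambda>g. a \<otimes> g \<otimes> inv a) (vf_bracket (left_field G \<xi>) (left_field G \<zeta>)) \<one>"
    unfolding lie_bracket_def push_vf_bracket[OF d left_field_VF[OF assms(1)] left_field_VF[OF assms(2)]]
      push_act_left_field[OF assms(1)] push_act_left_field[OF assms(2)] ..
  then show ?thesis by (simp add: push_vf_apply[OF d] Ad_def lie_bracket_def)
qed

lemma Ad_opposite: "Ad (opposite G) a = Ad G (inv a)"
  by (simp add: Ad_def mult_assoc)

lemma MC_left_0: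
  "length Xs \<noteq> 1 \<Longrightarrow> MC_left G Xs g = 0" "\<not> set Xs \<subseteq> VF \<Longrightarrow> MC_left G Xs g = 0"
  by (auto simp: MC_left_def split: list.splits)

lemma MC_left_mem: "MC_left G Xs g \<in> \<gg>"
proof (cases "\<exists>X. Xs = [X] \<and> X \<in> VF")
  case True
  then show ?thesis using MC_left_eq(2) by auto
next
  case False
  then have "length Xs \<noteq> 1 \<or> \<not> set Xs \<subseteq> VF" by (auto simp: length_Suc_conv)
  then have "MC_left G Xs g = 0" using MC_left_0 by metis
  then show ?thesis using lie_algebra_0 by simp
qed

lemma MC_left_zero: "MC_left G [0] g = 0"
  unfolding MC_left_eq(1)[OF VF_0] by (simp add: fun_eq_iff push_tvec_def)

lemma lie_bracket_0: "\<xi> \<in> \<gg> \<Longrightarrow> lie_bracket G \<xi> 0 = 0" "\<xi> \<in> \<gg> \<Longrightarrow> lie_bracket G 0 \<xi> = 0"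
  using lie_bracket_lincomb_right[of \<xi> \<xi> \<xi> 0 0] lie_bracket_lincomb_left[of \<xi> \<xi> \<xi> 0 0] by simp_all

end


subsection \<open>The invariant inner product\<close>

locale metric_liegroup = liegroup G
  for G :: "('g::{t2_space, second_countable_topology}, 'e::real_inner) lie_data" (structure) +
  fixes B :: "'g tvec \<Rightarrow> 'g tvec \<Rightarrow> real"
  assumes invariant: "invariant_inner_product G B"
begin

lemma B_lincomb_left: "\<xi> \<in> \<gg> \<Longrightarrow> \<xi>' \<in> \<gg> \<Longrightarrow> \<zeta> \<in> \<gg> \<Longrightarrow> B (a *\<^sub>R \<xi> + b *\<^sub>R \<xi>') \<zeta> = a * B \<xi> \<zeta> + b * B \<xi>' \<zeta>"
  using invariant[unfolded invariant_inner_product_def, THEN conjunct1] by simp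

lemma B_sym: "\<xi> \<in> \<gg> \<Longrightarrow> \<zeta> \<in> \<gg> \<Longrightarrow> B \<xi> \<zeta> = B \<zeta> \<xi>"
  using invariant[unfolded invariant_inner_product_def, THEN conjunct2, THEN conjunct1] by simp

lemma B_Ad: "\<xi> \<in> \<gg> \<Longrightarrow> \<zeta> \<in> \<gg> \<Longrightarrow> B (Ad G a \<xi>) (Ad G a \<zeta>) = B \<xi> \<zeta>"
  using invariant[unfolded invariant_inner_product_def, THEN conjunct2, THEN conjunct2, THEN conjunct2] by simp

lemma B_lincomb_right:
  assumes "\<xi> \<in> \<gg>" "\<xi>' \<in> \<gg>" "\<zeta> \<in> \<gg>"
  shows "B \<zeta> (a *\<^sub>R \<xi> + b *\<^sub>R \<xi>') = a * B \<zeta> \<xi> + b * B \<zeta> \<xi>'"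
  using B_lincomb_left[OF assms] B_sym[OF assms(3) lie_algebra_lincomb[OF assms(1,2)]]
    B_sym[OF assms(3,1)] B_sym[OF assms(3,2)] by simp

lemma B_0: "\<xi> \<in> \<gg> \<Longrightarrow> B 0 \<xi> = 0" "\<xi> \<in> \<gg> \<Longrightarrow> B \<xi> 0 = 0"
  using B_lincomb_left[of \<xi> \<xi> \<xi> 0 0] B_lincomb_right[of \<xi> \<xi> \<xi> 0 0] by simp_all

lemma B_uminus: "\<xi> \<in> \<gg> \<Longrightarrow> \<zeta> \<in> \<gg> \<Longrightarrow> B (- \<xi>) \<zeta> = - B \<xi> \<zeta>" "\<xi> \<in> \<gg> \<Longrightarrow> \<zeta> \<in> \<gg> \<Longrightarrow> B \<zeta> (- \<xi>) = - B \<zeta> \<xi>"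
  using B_lincomb_left[of \<xi> \<xi> \<zeta> "-1" 0] B_lincomb_right[of \<xi> \<xi> \<zeta> "-1" 0] by simp_all

lemma B_Ad_inv: "\<xi> \<in> \<gg> \<Longrightarrow> \<zeta> \<in> \<gg> \<Longrightarrow> B (Ad G (inv a) \<xi>) \<zeta> = B \<xi> (Ad G a \<zeta>)"
  using B_Ad[OF Ad_mem, of \<xi> \<zeta> a "inv a"] by (simp add: Ad_inv)

lemma opposite_metric: "metric_liegroup (opposite G) B"
  unfolding metric_liegroup_def metric_liegroup_axioms_def
  using opposite invariant by (auto simp: invariant_inner_product_def Ad_opposite)

lemma B_MC_smooth:
  assumes "X \<in> VF" "\<zeta> \<in> \<gg>"
  shows "(\<lambda>g. B (MC_left G [X] g) \<zeta>) \<in> SF"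
  by (rule smooth_bilinear[of B, OF B_lincomb_left B_lincomb_right MC_left_mem MC_left_smooth[OF assms(1)] assms(2)])
    auto

lemma B_MC_lincomb:
  assumes "X \<in> VF" "Y \<in> VF" "f \<in> SF" "h \<in> SF" "\<zeta> \<in> \<gg>"
  shows "B (MC_left G [\<lambda>p. f p *\<^sub>R X p + h p *\<^sub>R Y p] g) \<zeta> =
    f g * B (MC_left G [X] g) \<zeta> + h g * B (MC_left G [Y] g) \<zeta>"
  by (simp add: MC_left_lincomb assms B_lincomb_left MC_left_mem)

text \<open>Behind it is the Lie derivative - [Z, \<theta>] of the Maurer-Cartan form along the left
  field of Z. The difference of the two sides is function-linear in X; on left fields it vanishes
  because \<theta> is constant there.\<close>

lemma derivative_B_MC:
  assumes Z: "Z \<in> \<gg>" and \<zeta>: "\<zeta> \<in> \<gg>" and X: "X \<in> VF"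
  shows "left_field G Z g (\<lambda>q. B (MC_left G [X] q) \<zeta>) =
    B (MC_left G [vf_bracket (left_field G Z) X] g) \<zeta> - B (lie_bracket G Z (MC_left G [X] g)) \<zeta>"
proof -
  let ?Z = "left_field G Z"
  let ?\<alpha> = "\<lambda>X q. B (MC_left G [X] q) \<zeta>"
  let ?\<Phi> = "\<lambda>X g. ?Z g (?\<alpha> X) - ?\<alpha> (vf_bracket ?Z X) g + B (lie_bracket G Z (MC_left G [X] g)) \<zeta>"
  note ZV = left_field_VF[OF Z]
  have "tensorial ?\<Phi>"
  proof (rule tensorialI)
    fix X Y f h p assume a: "X \<in> VF" "Y \<in> VF" "f \<in> SF" "h \<in> SF"
    note sm = B_MC_smooth[OF a(1) \<zeta>] B_MC_smooth[OF a(2) \<zeta>]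
    note br = VF_bracket[OF ZV a(1)] VF_bracket[OF ZV a(2)]
    note df = VF_smooth[OF ZV a(3)] VF_smooth[OF ZV a(4)]
    note t = VF_tangent[OF ZV, of p]
    have "?\<alpha> (\<lambda>p. f p *\<^sub>R X p + h p *\<^sub>R Y p) = (\<lambda>q. f q * ?\<alpha> X q + h q * ?\<alpha> Y q)"
      by (intro ext) (rule B_MC_lincomb[OF a \<zeta>])
    then have 1: "?Z p (?\<alpha> (\<lambda>p. f p *\<^sub>R X p + h p *\<^sub>R Y p)) =
        f p * ?Z p (?\<alpha> X) + ?\<alpha> X p * ?Z p f + (h p * ?Z p (?\<alpha> Y) + ?\<alpha> Y p * ?Z p h)"
      using tangent_add[OF t SF_mult[OF a(3) sm(1)] SF_mult[OF a(4) sm(2)]]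
        tangent_mult[OF t a(3) sm(1)] tangent_mult[OF t a(4) sm(2)] by simp
    have 2: "?\<alpha> (vf_bracket ?Z (\<lambda>p. f p *\<^sub>R X p + h p *\<^sub>R Y p)) p =
        f p * ?\<alpha> (vf_bracket ?Z X) p + h p * ?\<alpha> (vf_bracket ?Z Y) p + (?Z p f * ?\<alpha> X p + ?Z p h * ?\<alpha> Y p)"
      unfolding vf_bracket_lincomb[OF ZV a]
      using B_MC_lincomb[OF VF_lincomb[OF br a(3,4)] VF_lincomb[OF a(1,2) df] SF_const SF_const \<zeta>, of 1 1 p]
        B_MC_lincomb[OF br a(3,4) \<zeta>, of p] B_MC_lincomb[OF a(1,2) df \<zeta>, of p] by simp
    have 3: "B (lie_bracket G Z (MC_left G [\<lambda>p. f p *\<^sub>R X p + h p *\<^sub>R Y p] p)) \<zeta> =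
        f p * B (lie_bracket G Z (MC_left G [X] p)) \<zeta> + h p * B (lie_bracket G Z (MC_left G [Y] p)) \<zeta>"
      by (simp add: MC_left_lincomb a lie_bracket_lincomb_right Z MC_left_mem B_lincomb_left \<zeta> lie_bracket_mem)
    show "?\<Phi> (\<lambda>p. f p *\<^sub>R X p + h p *\<^sub>R Y p) p = f p * ?\<Phi> X p + h p * ?\<Phi> Y p"
      unfolding 1 2 3 by (simp add: algebra_simps)
  qed
  moreover have "?\<Phi> (left_field G \<xi>) p = 0" if \<xi>: "\<xi> \<in> \<gg>" for \<xi> p
    by (simp add: MC_left_left_field \<xi> left_field_bracket Z lie_bracket_mem tangent_const[OF VF_tangent[OF ZV]])
  ultimately have "?\<Phi> X g = 0" using tensorial_zero X by blast
  then show ?thesis by simp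
qed

end

text \<open>Both sides are derivatives at the unit of \<open>B (Ad\<^sub>g\<^sup>-\<^sup>1 X) Y = B X (Ad\<^sub>g Y)\<close>, in direction \<open>Z\<close>.\<close>

lemma (in metric_liegroup) B_bracket:
  assumes Z: "Z \<in> \<gg>" and X: "X \<in> \<gg>" and Y: "Y \<in> \<gg>"
  shows "B (lie_bracket G Z X) Y = - B X (lie_bracket G Z Y)"
proof -
  note m = lie_bracket_mem[OF Z X] lie_bracket_mem[OF Z Y]
  have "Ad G \<one> X = X" using push_tvec_id[of X \<one>] X by (simp add: Ad_def lie_algebra_iff)
  \<comment> \<open>The right field of X commutes with the left field of Z, so the bracket term
    drops out and \<open>derivative_B_MC\<close> yields the derivative of q \<mapsto> B (Ad (inv q)
    X) Y.\<close>
  then have 1: "left_field G Z \<one> (\<lambda>q. B (Ad G (inv q) X) Y) = - B (lie_bracket G Z X) Y"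
    using derivative_B_MC[OF Z Y right_field_VF[OF X], of \<one>]
      MC_left_right_field[OF X] left_right_commute[OF Z X]
    by (simp add: MC_left_zero B_0 Y)
  have "Ad G \<one> Y = Y" using push_tvec_id[of Y \<one>] Y by (simp add: Ad_def lie_algebra_iff)
  moreover have "vf_bracket (right_field G Z) (left_field G Y) = 0"
    using left_right_commute[OF Y Z] vf_bracket_uminus_swap[of "right_field G Z"] by simp
  \<comment> \<open>The mirror image, in the opposite group, whose Lie bracket has the opposite
    sign.\<close>
  ultimately have 2: "right_field G Z \<one> (\<lambda>q. B (Ad G q Y) X) = B (lie_bracket G Z Y) X"
    using metric_liegroup.derivative_B_MC[OF opposite_metric, of Z X "left_field G Y" \<one>]
      liegroup.MC_left_zero[OF opposite, of \<one>] Z X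
    by (simp add: right_field_opposite[symmetric] MC_right_opposite[symmetric] left_field_VF Y
        MC_right_left_field lie_bracket_opposite B_uminus m B_0)
  have "B (Ad G (inv q) X) Y = B (Ad G q Y) X" for q
    using B_Ad_inv[OF X Y] B_sym[OF X Ad_mem[OF Y]] by simp
  then have "- B (lie_bracket G Z X) Y = B (lie_bracket G Z Y) X"
    using 1 2 by (simp add: left_field_one[OF Z] right_field_one[OF Z])
  then show ?thesis using B_sym[OF X m(2)] by simp
qed


subsection \<open>The Cartan three-form\<close>

lemma shuffle_sign_singleton: "shuffle_sign {i} = (- 1) ^ i"
proof -
  have "{(k, j). k \<in> {i} \<and> j \<notin> {i} \<and> j < k} = Pair i ` {..<i}" by auto
  then show ?thesis by (simp add: shuffle_sign_def card_image inj_on_def)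
qed

lemma nths_singleton: "i < length xs \<Longrightarrow> nths xs {i} = [xs ! i]"
proof (induction xs arbitrary: i)
  case (Cons x xs)
  then show ?case
    using nths_Cons_image(1)[of x xs "{}"] nths_Cons_image(3)[of x xs "{i - 1}"] by (cases i) auto
qed simp

text \<open>A first factor concentrated in degree 1 kills all position sets but the singletons, and
  the shuffle sign of {i} counts the i positions before it.\<close>

lemma wedge_with_one_form:
  assumes deg: "\<And>Ys. length Ys \<noteq> 1 \<Longrightarrow> a Ys p = 0" and zero: "\<And>Ys. m 0 (b Ys p) = 0"
  shows "wedge_with m a b Xs p = (\<Sum>i<length Xs. (- 1) ^ i *\<^sub>R m (a [Xs ! i] p) (b (nths Xs (- {i})) p))"
proof -
  let ?t = "\<lambda>S. shuffle_sign S *\<^sub>R m (a (nths Xs S) p) (b (nths Xs (- S)) p)"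
  have "wedge_with m a b Xs p = sum ?t ((\<lambda>i. {i}) ` {..<length Xs})"
    unfolding wedge_with_def
  proof (rule sum.mono_neutral_right)
    show "\<forall>S\<in>Pow {..<length Xs} - (\<lambda>i. {i}) ` {..<length Xs}. ?t S = 0"
    proof
      fix S assume S: "S \<in> Pow {..<length Xs} - (\<lambda>i. {i}) ` {..<length Xs}"
      then have "card S \<noteq> 1" by (auto simp: card_1_singleton_iff)
      moreover have "{i. i < length Xs \<and> i \<in> S} = S" using S by auto
      ultimately have "length (nths Xs S) \<noteq> 1" by (simp add: length_nths)
      then show "?t S = 0" using deg zero by simp
    qed
  qed auto
  also have "\<dots> = (\<Sum>i<length Xs. ?t {i})"
    by (rule sum.reindex[unfolded comp_def]) (simp add: inj_on_def)
  also have "\<dots> = (\<Sum>i<length Xs. (- 1) ^ i *\<^sub>R m (a [Xs ! i] p) (b (nths Xs (- {i})) p))"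
    by (intro sum.cong refl) (simp add: shuffle_sign_singleton nths_singleton)
  finally show ?thesis .
qed

lemma length_nths_remove: "i < length Xs \<Longrightarrow> length (nths Xs (- {i})) = length Xs - 1"
proof -
  assume "i < length Xs"
  moreover have "{j. j < length Xs \<and> j \<in> - {i}} = {..<length Xs} - {i}" by auto
  ultimately show ?thesis by (simp add: length_nths)
qed

context metric_liegroup
begin

abbreviation "\<theta> X g \<equiv> MC_left G [X] g"
abbreviation "\<eta> \<equiv> eta_form G B"

text \<open>The factor 2 comes from the two shuffles, which contribute equally by antisymmetry of
  the bracket.\<close>

lemma MC_wedge_MC:
  "wedge_with (lie_bracket G) (MC_left G) (MC_left G) Xs g =
    (if length Xs = 2 then 2 *\<^sub>R lie_bracket G (\<theta> (Xs ! 0) g) (\<theta> (Xs ! 1) g) else 0)"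
proof -
  have "wedge_with (lie_bracket G) (MC_left G) (MC_left G) Xs g =
      (\<Sum>i<length Xs. (- 1) ^ i *\<^sub>R lie_bracket G (\<theta> (Xs ! i) g) (MC_left G (nths Xs (- {i})) g))"
    by (rule wedge_with_one_form) (simp_all add: MC_left_0(1) lie_bracket_0 MC_left_mem)
  also have "\<dots> = (if length Xs = 2 then 2 *\<^sub>R lie_bracket G (\<theta> (Xs ! 0) g) (\<theta> (Xs ! 1) g) else 0)"
  proof (cases "length Xs = 2")
    case True
    then obtain X Y where Xs: "Xs = [X, Y]" by (auto simp: numeral_2_eq_2 length_Suc_conv)
    show ?thesis
      unfolding Xs using lie_bracket_antisym[of "\<theta> Y g" "\<theta> X g"]
      by (simp add: numeral_2_eq_2 nths_Cons scaleR_2)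
  next
    case False
    have "MC_left G (nths Xs (- {i})) g = 0" if "i < length Xs" for i
      using length_nths_remove[OF that] that False by (intro MC_left_0(1)) auto
    then show ?thesis using False by (simp add: lie_bracket_0 MC_left_mem)
  qed
  finally show ?thesis .
qed

text \<open>The wedge product has one term for each choice of the argument of its first factor, all
  three equal by antisymmetry and invariance of B. With the factor 2 of the bracket form, 1/12 turns
  into 2 * 3 / 12 = 1/2.\<close>

lemma eta_apply:
  "\<eta> Xs g = (if length Xs = 3
    then 1 / 2 * B (\<theta> (Xs ! 0) g) (lie_bracket G (\<theta> (Xs ! 1) g) (\<theta> (Xs ! 2) g)) else 0)"
proof -
  let ?W = "wedge_with (lie_bracket G) (MC_left G) (MC_left G)"
  have Wmem: "?W Ys g \<in> \<gg>" for Ys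
  proof -
    have "2 *\<^sub>R lie_bracket G (\<theta> (Ys ! 0) g) (\<theta> (Ys ! 1) g) + 0 *\<^sub>R lie_bracket G (\<theta> (Ys ! 0) g) (\<theta> (Ys ! 1) g) \<in> \<gg>"
      by (intro lie_algebra_lincomb lie_bracket_mem MC_left_mem)
    then show ?thesis unfolding MC_wedge_MC using lie_algebra_0 by simp
  qed
  have eq: "wedge_with B (MC_left G) ?W Xs g =
      (\<Sum>i<length Xs. (- 1) ^ i *\<^sub>R B (\<theta> (Xs ! i) g) (?W (nths Xs (- {i})) g))"
    by (rule wedge_with_one_form) (rule MC_left_0(1), assumption, rule B_0(1)[OF Wmem])
  show ?thesis
  proof (cases "length Xs = 3")
    case True
    then obtain X Y Z where Xs: "Xs = [X, Y, Z]" by (auto simp: numeral_3_eq_3 length_Suc_conv)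
    let ?b = "lie_bracket G"
    let ?x = "\<theta> X g" and ?y = "\<theta> Y g" and ?z = "\<theta> Z g"
    note m = MC_left_mem[of _ g] lie_bracket_mem[OF MC_left_mem[of _ g] MC_left_mem[of _ g]]
    have B2: "B u (2 *\<^sub>R w) = 2 * B u w" if "u \<in> \<gg>" "w \<in> \<gg>" for u w
      using B_lincomb_right[OF that(2,2,1), of 2 0] by simp
    have n: "nths [X, Y, Z] (- {0}) = [Y, Z]" "nths [X, Y, Z] (- {Suc 0}) = [X, Z]"
      "nths [X, Y, Z] (- {Suc (Suc 0)}) = [X, Y]"
      by (simp_all add: nths_Cons)
    have "wedge_with B (MC_left G) ?W Xs g = 2 * B ?x (?b ?y ?z) - 2 * B ?y (?b ?x ?z) + 2 * B ?z (?b ?x ?y)"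
      unfolding eq unfolding Xs
      by (simp add: numeral_3_eq_3 n MC_wedge_MC B2 m)
    moreover have b1: "B ?y (?b ?x ?z) = - B ?x (?b ?y ?z)"
    proof -
      have "B ?y (?b ?x ?z) = - B (?b ?x ?y) ?z" using B_bracket[of ?x ?y ?z] m by simp
      also have "B (?b ?x ?y) ?z = - B (?b ?y ?x) ?z"
        using lie_bracket_antisym[of ?x ?y] B_uminus(1)[of "?b ?y ?x" ?z] m by simp
      also have "B (?b ?y ?x) ?z = - B ?x (?b ?y ?z)" using B_bracket[of ?y ?x ?z] m by simp
      finally show ?thesis by simp
    qed
    moreover have "B ?z (?b ?x ?y) = B ?x (?b ?y ?z)"
    proof -
      have "B ?z (?b ?x ?y) = B (?b ?x ?y) ?z" by (rule B_sym) (simp_all add: m)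
      also have "\<dots> = - B ?y (?b ?x ?z)" using B_bracket[of ?x ?y ?z] m by simp
      finally show ?thesis using b1 by simp
    qed
    ultimately show ?thesis using True Xs by (simp add: eta_form_def)
  next
    case False
    have "?W (nths Xs (- {i})) g = 0" if "i < length Xs" for i
      unfolding MC_wedge_MC using length_nths_remove[OF that] that False by auto
    then show ?thesis using False by (simp add: eta_form_def eq B_0 MC_left_mem)
  qed
qed

lemma eta_apply3: "\<eta> [X, Y, Z] g = 1 / 2 * B (\<theta> X g) (lie_bracket G (\<theta> Y g) (\<theta> Z g))"
  by (simp add: eta_apply numeral_3_eq_3)

lemma eta_k_forms: "\<eta> \<in> k_forms (charts G) 3"
  unfolding k_forms_iff
proof
  show "homogeneous 3 \<eta>" by (simp add: homogeneous_def fun_eq_iff eta_apply)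
  note m = MC_left_mem lie_bracket_mem[OF MC_left_mem MC_left_mem]
  have len3: "\<exists>X Y Z. Xs = [X, Y, Z]" if "length Xs = 3" for Xs :: "'g vfield list"
    using that by (auto simp: numeral_3_eq_3 length_Suc_conv)
  have zero: "\<eta> Xs = 0" if "length Xs \<noteq> 3" for Xs
    using that by (simp add: fun_eq_iff eta_apply)
  show "\<eta> \<in> \<Omega>"
  proof (rule formsI)
    fix Xs assume "\<not> set Xs \<subseteq> VF"
    show "\<eta> Xs = 0"
    proof (cases "length Xs = 3")
      case True
      then obtain X Y Z where Xs: "Xs = [X, Y, Z]" using len3 by blast
      have z: "\<theta> V g = 0" if "V \<notin> VF" for V g using that by (intro MC_left_0(2)) simp
      show ?thesis
      proof
        fix g
        consider "X \<notin> VF" | "Y \<notin> VF" | "Z \<notin> VF" using \<open>\<not> set Xs \<subseteq> VF\<close> unfolding Xs by auto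
        then show "\<eta> Xs g = 0 g"
          unfolding Xs by cases (simp_all add: eta_apply3 z B_0 lie_bracket_0 m)
      qed
    qed (rule zero)
  next
    fix Xs assume VF: "set Xs \<subseteq> VF"
    show "\<eta> Xs \<in> SF"
    proof (cases "length Xs = 3")
      case True
      then obtain X Y Z where Xs: "Xs = [X, Y, Z]" using len3 by blast
      \<comment> \<open>The bracket is vector-valued, so its smoothness is tested on a function u
        before it can enter B.\<close>
      have br: "(\<lambda>g. lie_bracket G (\<theta> Y g) (\<theta> Z g) u) \<in> SF" if u: "u \<in> SF" for u
        by (rule smooth_bilinear[of "\<lambda>x y. lie_bracket G x y u"])
          (use VF Xs u in \<open>simp_all add: lie_bracket_lincomb_left lie_bracket_lincomb_right MC_left_mem MC_left_smooth\<close>)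
      have "(\<lambda>g. B (\<theta> X g) (lie_bracket G (\<theta> Y g) (\<theta> Z g))) \<in> SF"
        by (rule smooth_bilinear[of B])
          (use VF Xs br in \<open>simp_all add: B_lincomb_left B_lincomb_right m MC_left_smooth\<close>)
      from SF_mult[OF SF_const[of "1/2"] this] show ?thesis unfolding Xs eta_apply3[abs_def] .
    next
      case False
      then have "\<eta> Xs = (\<lambda>g. 0)" using zero by (simp add: fun_eq_iff)
      then show ?thesis by simp
    qed
  next
    fix Xs X Y Ys f h
    assume VF: "set Xs \<subseteq> VF" "X \<in> VF" "Y \<in> VF" "set Ys \<subseteq> VF" "f \<in> SF" "h \<in> SF"
    let ?Z = "\<lambda>p. f p *\<^sub>R X p + h p *\<^sub>R Y p"
    note lin = MC_left_lincomb[OF VF(2,3,5,6)]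
    show "\<eta> (Xs @ ?Z # Ys) = (\<lambda>p. f p * \<eta> (Xs @ X # Ys) p + h p * \<eta> (Xs @ Y # Ys) p)"
    proof (cases "length Xs + length Ys = 2")
      case True
      then consider U V where "Xs = []" "Ys = [U, V]" | U V where "Xs = [U]" "Ys = [V]"
        | U V where "Xs = [U, V]" "Ys = []"
        by (cases Xs; cases "tl Xs"; cases Ys; cases "tl Ys") auto
      then show ?thesis
        by cases (simp_all add: fun_eq_iff eta_apply3 lin B_lincomb_left B_lincomb_right lie_bracket_lincomb_left
            lie_bracket_lincomb_right m algebra_simps)
    next
      case False
      then show ?thesis by (simp add: fun_eq_iff eta_apply)
    qed
  next
    fix Xs X Ys assume VF: "set Xs \<subseteq> VF" "X \<in> VF" "set Ys \<subseteq> VF"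
    \<comment> \<open>Invariance moves the bracket to [x, x] = 0. This handles equality of the first
      two arguments; for the last two the bracket itself vanishes.\<close>
    have B0: "B (\<theta> X g) (lie_bracket G (\<theta> X g) \<xi>) = 0" if "\<xi> \<in> \<gg>" for g \<xi>
      using B_bracket[OF MC_left_mem MC_left_mem that, of "[X]" g "[X]" g] lie_bracket_self B_0(1)[OF that] by simp
    show "\<eta> (Xs @ X # X # Ys) = 0"
    proof (cases "length Xs + length Ys = 1")
      case True
      then consider U where "Xs = []" "Ys = [U]" | U where "Xs = [U]" "Ys = []"
        by (cases Xs; cases Ys) auto
      then show ?thesis
        by cases (simp_all add: fun_eq_iff eta_apply3 B0 lie_bracket_self B_0 m)
    qed (auto simp: fun_eq_iff eta_apply)
  qed
qed


subsection \<open>The sections s(\<zeta>)\<close>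

definition alpha_left :: "'g tvec \<Rightarrow> 'g form"
  where "alpha_left \<xi> = (\<lambda>Xs g. 1 / 2 * B (MC_left G Xs g) \<xi>)"

lemma s_left_eq: "s_left G B \<xi> = (left_field G \<xi>, alpha_left \<xi>)"
  by (simp add: s_left_def alpha_left_def)

lemma alpha_left_k_forms:
  assumes "\<xi> \<in> \<gg>"
  shows "alpha_left \<xi> \<in> k_forms (charts G) 1"
proof -
  have "alpha_left \<xi> Xs g = one_form (\<lambda>X g. 1 / 2 * B (\<theta> X g) \<xi>) Xs g" for Xs g
  proof (cases "length Xs = 1 \<and> set Xs \<subseteq> VF")
    case True
    then show ?thesis by (auto simp: alpha_left_def one_form_def length_Suc_conv)
  next
    case False
    then have "MC_left G Xs g = 0" using MC_left_0 by metis
    then show ?thesis using False B_0[OF assms] by (auto simp: alpha_left_def one_form_def)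
  qed
  then have "alpha_left \<xi> = one_form (\<lambda>X g. 1 / 2 * B (\<theta> X g) \<xi>)" by (intro ext)
  moreover have "one_form (\<lambda>X g. 1 / 2 * B (\<theta> X g) \<xi>) \<in> k_forms (charts G) 1"
  proof (rule one_form_k_forms)
    show "(\<lambda>g. 1 / 2 * B (\<theta> X g) \<xi>) \<in> SF" if "X \<in> VF" for X
      by (rule SF_mult[OF SF_const B_MC_smooth[OF that assms]])
    show "(\<lambda>g. 1 / 2 * B (\<theta> (\<lambda>p. f p *\<^sub>R X p + h p *\<^sub>R Y p) g) \<xi>) =
        (\<lambda>p. f p * (1 / 2 * B (\<theta> X p) \<xi>) + h p * (1 / 2 * B (\<theta> Y p) \<xi>))"
      if "X \<in> VF" "Y \<in> VF" "f \<in> SF" "h \<in> SF" for X Y f h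
      by (simp add: fun_eq_iff B_MC_lincomb that assms algebra_simps)
  qed
  ultimately show ?thesis by simp
qed

end


context metric_liegroup
begin

definition alpha_right :: "'g tvec \<Rightarrow> 'g form"
  where "alpha_right \<xi> = (\<lambda>Xs g. 1 / 2 * B (MC_right G Xs g) \<xi>)"

lemma s_right_eq: "s_right G B \<xi> = (- right_field G \<xi>, alpha_right \<xi>)"
  by (simp add: s_right_def alpha_right_def)

lemma alpha_right_k_forms: "\<xi> \<in> \<gg> \<Longrightarrow> alpha_right \<xi> \<in> k_forms (charts G) 1"
  using metric_liegroup.alpha_left_k_forms[OF opposite_metric, of \<xi>]
  by (simp add: metric_liegroup.alpha_left_def[OF opposite_metric] alpha_right_def MC_right_opposite)

lemma s_left_gsections: "\<xi> \<in> \<gg> \<Longrightarrow> (left_field G \<xi>, alpha_left \<xi>) \<in> \<Gamma>"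
  using left_field_VF alpha_left_k_forms unfolding gsections_def by blast

lemma s_right_gsections: "\<xi> \<in> \<gg> \<Longrightarrow> (- right_field G \<xi>, alpha_right \<xi>) \<in> \<Gamma>"
  using VF_uminus[OF right_field_VF] alpha_right_k_forms unfolding gsections_def by blast

lemmas alpha_left_forms = gsectionsD(2)[OF s_left_gsections]
lemmas alpha_right_forms = gsectionsD(2)[OF s_right_gsections]

lemma alpha_left_left_field: "\<xi> \<in> \<gg> \<Longrightarrow> \<zeta> \<in> \<gg> \<Longrightarrow> alpha_left \<xi> [left_field G \<zeta>] p = 1 / 2 * B \<xi> \<zeta>"
  using B_sym[of \<xi> \<zeta>] by (simp add: alpha_left_def MC_left_left_field)

lemma alpha_right_right_field: "\<xi> \<in> \<gg> \<Longrightarrow> \<zeta> \<in> \<gg> \<Longrightarrow> alpha_right \<xi> [- right_field G \<zeta>] p = - 1 / 2 * B \<xi> \<zeta>"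
  using B_sym[of \<xi> \<zeta>] one_form_uminus[OF alpha_right_forms right_field_VF, of \<xi> \<zeta>]
  by (simp add: alpha_right_def MC_right_right_field)

lemma alpha_left_right_field:
  "\<xi> \<in> \<gg> \<Longrightarrow> \<zeta> \<in> \<gg> \<Longrightarrow> alpha_left \<xi> [- right_field G \<zeta>] p = - 1 / 2 * B (Ad G (inv p) \<zeta>) \<xi>"
  using one_form_uminus[OF alpha_left_forms right_field_VF, of \<xi> \<zeta>]
  by (simp add: alpha_left_def MC_left_right_field)

text \<open>Invariance of B moves Ad onto \<zeta>, so that the two mixed evaluations are multiples
  of the same function of p, with opposite signs, and cancel in
  \<open>pairing_sections\<close>.\<close>

lemma alpha_right_left_field:
  "\<xi> \<in> \<gg> \<Longrightarrow> \<zeta> \<in> \<gg> \<Longrightarrow> alpha_right \<zeta> [left_field G \<xi>] p = 1 / 2 * B (Ad G (inv p) \<zeta>) \<xi>"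
  using B_Ad_inv[of \<zeta> \<xi> p] B_sym[of "Ad G p \<xi>" \<zeta>] by (simp add: alpha_right_def MC_right_left_field Ad_mem)

lemma MC_left_uminus: "X \<in> VF \<Longrightarrow> MC_left G [- X] g = - MC_left G [X] g"
  using MC_left_lincomb[of X X "\<lambda>_. -1" "\<lambda>_. 0"] by (simp add: fun_Compl_def)

lemma lie_bracket_uminus:
  "\<xi> \<in> \<gg> \<Longrightarrow> \<zeta> \<in> \<gg> \<Longrightarrow> lie_bracket G (- \<xi>) \<zeta> = - lie_bracket G \<xi> \<zeta>"
  "\<xi> \<in> \<gg> \<Longrightarrow> \<zeta> \<in> \<gg> \<Longrightarrow> lie_bracket G \<xi> (- \<zeta>) = - lie_bracket G \<xi> \<zeta>"
  using lie_bracket_lincomb_left[of \<zeta> \<xi> \<xi> "-1" 0] lie_bracket_lincomb_right[of \<xi> \<zeta> \<zeta> "-1" 0] by simp_all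

lemma lie_algebra_uminus: "\<xi> \<in> \<gg> \<Longrightarrow> - \<xi> \<in> \<gg>"
  using lie_algebra_lincomb[of \<xi> \<xi> "-1" 0] by simp

lemma bracket_uminus_right_field:
  assumes "\<xi> \<in> \<gg>" "\<zeta> \<in> \<gg>"
  shows "vf_bracket (- right_field G \<xi>) (- right_field G \<zeta>) = - right_field G (lie_bracket G \<xi> \<zeta>)"
  using vf_bracket_uminus assms
  by (simp add: VF_uminus right_field_VF right_field_bracket)

text \<open>A frame in terms of its use: function-linear expressions are determined by their values
  on the fields F \<xi>. Left and right fields can then be treated alike, without naming
  coefficients.\<close>

definition frame :: "('g tvec \<Rightarrow> 'g vfield) \<Rightarrow> bool"
  where "frame F \<longleftrightarrow> (\<forall>\<Phi>. tensorial \<Phi> \<longrightarrow> (\<forall>\<xi>\<in>\<gg>. \<forall>p. \<Phi> (F \<xi>) p = 0) \<longrightarrow> (\<forall>X\<in>VF. \<forall>p. \<Phi> X p = 0))"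

lemma frame_left: "frame (left_field G)"
  unfolding frame_def
proof (intro allI impI)
  fix \<Phi>
  assume \<Phi>: "tensorial \<Phi>" and zero: "\<forall>\<xi>\<in>\<gg>. \<forall>p. \<Phi> (left_field G \<xi>) p = 0"
  show "\<forall>X\<in>VF. \<forall>p. \<Phi> X p = 0"
  proof (intro ballI allI)
    fix X p assume X: "X \<in> VF"
    show "\<Phi> X p = 0"
      by (rule tensorial_zero[OF \<Phi> _ X]) (use zero in blast)
  qed
qed

lemma frame_right: "frame (\<lambda>\<xi>. - right_field G \<xi>)"
  unfolding frame_def
proof (intro allI impI)
  fix \<Phi>
  assume \<Phi>: "tensorial \<Phi>" and zero: "\<forall>\<xi>\<in>\<gg>. \<forall>p. \<Phi> (- right_field G \<xi>) p = 0"
  \<comment> \<open>The condition \<open>tensorial\<close> refers to the charts alone, and the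
    opposite group has the same ones.\<close>
  have \<Phi>': "liegroup.tensorial (opposite G) \<Phi>"
    using \<Phi> by (simp add: tensorial_def liegroup.tensorial_def[OF opposite])
  have zero': "\<Phi> (left_field (opposite G) \<xi>) p = 0" if "\<xi> \<in> lie_algebra (opposite G)" for \<xi> p
  proof -
    have \<xi>: "\<xi> \<in> \<gg>" using that by simp
    \<comment> \<open>The minus sign in the frame is absorbed by replacing \<xi> with -
      \<xi>.\<close>
    have "left_field (opposite G) \<xi> = - right_field G (- \<xi>)"
      using right_field_uminus[OF \<xi>] by (simp add: right_field_opposite[symmetric])
    then show ?thesis using zero lie_algebra_uminus[OF \<xi>] by simp
  qed
  show "\<forall>X\<in>VF. \<forall>p. \<Phi> X p = 0"
  proof (intro ballI allI)
    fix X p assume X: "X \<in> VF"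
    then have "X \<in> vector_fields (charts (opposite G))" by simp
    from liegroup.tensorial_zero[OF opposite \<Phi>' zero' this] show "\<Phi> X p = 0" .
  qed
qed

text \<open>The same computation for left-invariant fields (with \<open>c = 1/2\<close>) and for right-invariant
  ones (with \<open>c = -1/2\<close>).\<close>

lemma courant_form_frame:
  assumes F: "\<And>\<xi>. \<xi> \<in> \<gg> \<Longrightarrow> (F \<xi>, \<alpha> \<xi>) \<in> \<Gamma>"
    and br: "\<And>\<xi> \<zeta>. \<xi> \<in> \<gg> \<Longrightarrow> \<zeta> \<in> \<gg> \<Longrightarrow> vf_bracket (F \<xi>) (F \<zeta>) = F (lie_bracket G \<xi> \<zeta>)"
    and pair: "\<And>\<xi> \<zeta> p. \<xi> \<in> \<gg> \<Longrightarrow> \<zeta> \<in> \<gg> \<Longrightarrow> \<alpha> \<xi> [F \<zeta>] p = c * B \<xi> \<zeta>"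
    and eta: "\<And>\<xi> \<zeta> \<kappa> p. \<xi> \<in> \<gg> \<Longrightarrow> \<zeta> \<in> \<gg> \<Longrightarrow> \<kappa> \<in> \<gg> \<Longrightarrow> \<eta> [F \<xi>, F \<zeta>, F \<kappa>] p = c * B \<xi> (lie_bracket G \<zeta> \<kappa>)"
    and frame: "frame F"
    and \<xi>: "\<xi> \<in> \<gg>" and \<zeta>: "\<zeta> \<in> \<gg>" and Z: "Z \<in> VF"
  shows "courant_form \<eta> (F \<xi>, \<alpha> \<xi>) (F \<zeta>, \<alpha> \<zeta>) Z p = \<alpha> (lie_bracket G \<xi> \<zeta>) [Z] p"
proof -
  note m = lie_bracket_mem[OF \<xi> \<zeta>]
  let ?\<Phi> = "\<lambda>Z p. courant_form \<eta> (F \<xi>, \<alpha> \<xi>) (F \<zeta>, \<alpha> \<zeta>) Z p - \<alpha> (lie_bracket G \<xi> \<zeta>) [Z] p"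
  have tens: "tensorial ?\<Phi>"
  proof (rule tensorialI)
    fix X Y f h p assume a: "X \<in> VF" "Y \<in> VF" "f \<in> SF" "h \<in> SF"
    show "?\<Phi> (\<lambda>p. f p *\<^sub>R X p + h p *\<^sub>R Y p) p = f p * ?\<Phi> X p + h p * ?\<Phi> Y p"
      using courant_form_lincomb[OF F[OF \<xi>] F[OF \<zeta>] eta_k_forms a, of p]
        form_lincomb[OF gsectionsD(2)[OF F[OF m]], of "[]" X Y "[]" f h] a by (simp add: algebra_simps)
  qed
  have "?\<Phi> (F \<kappa>) p = 0" if \<kappa>: "\<kappa> \<in> \<gg>" for \<kappa> p
  proof -
    have const: "\<alpha> \<xi> [F \<zeta>] = (\<lambda>p. c * B \<xi> \<zeta>)" if "\<xi> \<in> \<gg>" "\<zeta> \<in> \<gg>" for \<xi> \<zeta>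
      using pair[OF that] by (intro ext)
    note t = tangent_const[OF VF_tangent[OF gsectionsD(1)[OF F]]]
    \<comment> \<open>All derivatives hit constants. The value of \<eta> cancels the term c B \<xi>
      [\<zeta>, \<kappa>], and the remaining - c B \<zeta> [\<xi>, \<kappa>] equals c B
      [\<xi>, \<zeta>] \<kappa> by \<open>B_bracket\<close>.\<close>
    show ?thesis
      using B_bracket[OF \<xi> \<zeta> \<kappa>]
      by (simp add: courant_form_def const br eta lie_bracket_mem \<xi> \<zeta> \<kappa> t)
  qed
  then have zero: "\<forall>\<kappa>\<in>\<gg>. \<forall>p. ?\<Phi> (F \<kappa>) p = 0" by (intro ballI allI)
  from mp[OF mp[OF spec[OF frame[unfolded frame_def], of ?\<Phi>] tens] zero] Z
  have "?\<Phi> Z p = 0" by (elim ballE allE) auto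
  then show ?thesis by simp
qed

lemma courant_form_left_left:
  assumes "\<xi> \<in> \<gg>" "\<zeta> \<in> \<gg>" "Z \<in> VF"
  shows "courant_form \<eta> (left_field G \<xi>, alpha_left \<xi>) (left_field G \<zeta>, alpha_left \<zeta>) Z p =
    alpha_left (lie_bracket G \<xi> \<zeta>) [Z] p"
proof (rule courant_form_frame[where F = "left_field G" and \<alpha> = alpha_left and c = "1 / 2"])
  show "\<eta> [left_field G \<xi>, left_field G \<zeta>, left_field G \<kappa>] p = 1 / 2 * B \<xi> (lie_bracket G \<zeta> \<kappa>)"
    if "\<xi> \<in> \<gg>" "\<zeta> \<in> \<gg>" "\<kappa> \<in> \<gg>" for \<xi> \<zeta> \<kappa> p
    using that by (simp add: eta_apply3 MC_left_left_field)
next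
  show "(left_field G \<xi>, alpha_left \<xi>) \<in> \<Gamma>" if "\<xi> \<in> \<gg>" for \<xi>
    using that by (rule s_left_gsections)
  show "vf_bracket (left_field G \<xi>) (left_field G \<zeta>) = left_field G (lie_bracket G \<xi> \<zeta>)"
    "alpha_left \<xi> [left_field G \<zeta>] p = 1 / 2 * B \<xi> \<zeta>" if "\<xi> \<in> \<gg>" "\<zeta> \<in> \<gg>" for \<xi> \<zeta> p
    using that by (simp_all add: left_field_bracket alpha_left_left_field)
qed (use assms frame_left frame_right in simp_all)

lemma courant_form_right_right:
  assumes "\<xi> \<in> \<gg>" "\<zeta> \<in> \<gg>" "Z \<in> VF"
  shows "courant_form \<eta> (- right_field G \<xi>, alpha_right \<xi>) (- right_field G \<zeta>, alpha_right \<zeta>) Z p =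
    alpha_right (lie_bracket G \<xi> \<zeta>) [Z] p"
proof (rule courant_form_frame[where F = "\<lambda>\<xi>. - right_field G \<xi>" and \<alpha> = alpha_right and c = "- 1 / 2"])
  \<comment> \<open>On the right field of an element, \<theta> takes the value Ad (inv p) of that
    element. Ad drops out by invariance, and three minus signs turn 1/2 into -1/2.\<close>
  show "\<eta> [- right_field G \<xi>, - right_field G \<zeta>, - right_field G \<kappa>] p = - 1 / 2 * B \<xi> (lie_bracket G \<zeta> \<kappa>)"
    if "\<xi> \<in> \<gg>" "\<zeta> \<in> \<gg>" "\<kappa> \<in> \<gg>" for \<xi> \<zeta> \<kappa> p
    using that
    by (simp add: eta_apply3 MC_left_uminus right_field_VF MC_left_right_field lie_bracket_uminus Ad_mem
        lie_algebra_uminus B_uminus lie_bracket_mem Ad_bracket[symmetric] B_Ad)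
next
  show "(- right_field G \<xi>, alpha_right \<xi>) \<in> \<Gamma>" if "\<xi> \<in> \<gg>" for \<xi>
    using that by (rule s_right_gsections)
  show "vf_bracket (- right_field G \<xi>) (- right_field G \<zeta>) = - right_field G (lie_bracket G \<xi> \<zeta>)"
    "alpha_right \<xi> [- right_field G \<zeta>] p = - 1 / 2 * B \<xi> \<zeta>" if "\<xi> \<in> \<gg>" "\<zeta> \<in> \<gg>" for \<xi> \<zeta> p
    using that by (simp_all add: bracket_uminus_right_field alpha_right_right_field)
qed (use assms frame_left frame_right in simp_all)

lemma courant_form_left_right:
  assumes \<xi>: "\<xi> \<in> \<gg>" and \<zeta>: "\<zeta> \<in> \<gg>" and Z: "Z \<in> VF"
  shows "courant_form \<eta> (left_field G \<xi>, alpha_left \<xi>) (- right_field G \<zeta>, alpha_right \<zeta>) Z p = 0"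
proof (rule tensorial_zero[OF _ _ Z])
  show "tensorial (courant_form \<eta> (left_field G \<xi>, alpha_left \<xi>) (- right_field G \<zeta>, alpha_right \<zeta>))"
    by (rule tensorialI) (rule courant_form_lincomb[OF s_left_gsections[OF \<xi>] s_right_gsections[OF \<zeta>] eta_k_forms])
  fix \<kappa> p assume \<kappa>: "\<kappa> \<in> \<gg>"
  \<comment> \<open>The value of \<theta> on the right field of \<zeta>, the only ingredient that is
    not constant. Its derivative along the left field of u is - [u, D], which is what
    \<open>der\<close> says after pairing with k.\<close>
  define D where "D q = Ad G (inv q) \<zeta>" for q
  have Dm: "D q \<in> \<gg>" for q unfolding D_def by (rule Ad_mem[OF \<zeta>])
  note bm = lie_bracket_mem
  have der: "left_field G u p (\<lambda>q. B (D q) k) = - B (lie_bracket G u (D p)) k" if "u \<in> \<gg>" "k \<in> \<gg>" for u k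
    using derivative_B_MC[OF that right_field_VF[OF \<zeta>], of p]
    by (simp add: MC_left_right_field[OF \<zeta>] left_right_commute[OF that(1) \<zeta>] MC_left_zero B_0 that D_def)
  have smD: "(\<lambda>q. B (D q) k) \<in> SF" if "k \<in> \<gg>" for k
    using B_MC_smooth[OF right_field_VF[OF \<zeta>] that] by (simp add: MC_left_right_field[OF \<zeta>] D_def)
  have der': "left_field G u p (\<lambda>q. a * B (D q) k) = - a * B (lie_bracket G u (D p)) k" if "u \<in> \<gg>" "k \<in> \<gg>" for u k a
    using tangent_cmult[OF VF_tangent[OF left_field_VF[OF that(1)]] smD[OF that(2)]] der[OF that] by simp
  have f1: "alpha_right \<zeta> [left_field G \<kappa>] = (\<lambda>q. 1 / 2 * B (D q) \<kappa>)"
    using alpha_right_left_field[OF \<kappa> \<zeta>] unfolding D_def by (intro ext)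
  have f2: "alpha_left \<xi> [left_field G \<kappa>] = (\<lambda>q. 1 / 2 * B \<xi> \<kappa>)"
    using alpha_left_left_field[OF \<xi> \<kappa>] by (intro ext)
  have f3: "alpha_left \<xi> [- right_field G \<zeta>] = (\<lambda>q. (- 1 / 2) * B (D q) \<xi>)"
    using alpha_left_right_field[OF \<xi> \<zeta>] unfolding D_def by (intro ext)
  have f4: "alpha_right \<zeta> [vf_bracket (left_field G \<xi>) (left_field G \<kappa>)] p = 1 / 2 * B (D p) (lie_bracket G \<xi> \<kappa>)"
    using alpha_right_left_field[OF bm[OF \<xi> \<kappa>] \<zeta>] by (simp add: left_field_bracket \<xi> \<kappa> D_def)
  have "vf_bracket (- right_field G \<zeta>) (left_field G \<kappa>) = 0"
    using vf_bracket_uminus(1)[OF right_field_VF[OF \<zeta>] left_field_VF[OF \<kappa>]]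
      vf_bracket_uminus_swap[of "right_field G \<zeta>" "left_field G \<kappa>"] left_right_commute[OF \<kappa> \<zeta>] by simp
  then have f5: "alpha_left \<xi> [vf_bracket (- right_field G \<zeta>) (left_field G \<kappa>)] p = 0"
    by (simp add: alpha_left_def MC_left_zero B_0 \<xi>)
  have f6: "\<eta> [left_field G \<xi>, - right_field G \<zeta>, left_field G \<kappa>] p = - 1 / 2 * B \<xi> (lie_bracket G (D p) \<kappa>)"
    by (simp add: eta_apply3 MC_left_left_field \<xi> \<kappa> MC_left_uminus right_field_VF \<zeta> MC_left_right_field
        D_def[symmetric] lie_bracket_uminus Dm B_uminus bm)
  have f7: "(- right_field G \<zeta>) p (\<lambda>q. 1 / 2 * B \<xi> \<kappa>) = 0"
    by (rule tangent_const[OF VF_tangent[OF VF_uminus[OF right_field_VF[OF \<zeta>]]]])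
  \<comment> \<open>The four surviving terms cancel in pairs: the derivative along \<xi> against the
    bracket term, by this identity, and the derivative along \<kappa> against \<eta>, by the next
    one.\<close>
  have "B (lie_bracket G \<xi> (D p)) \<kappa> = - B (D p) (lie_bracket G \<xi> \<kappa>)"
    by (rule B_bracket[OF \<xi> Dm \<kappa>])
  moreover have "B (lie_bracket G \<kappa> (D p)) \<xi> = - B \<xi> (lie_bracket G (D p) \<kappa>)"
    using lie_bracket_antisym[of \<kappa> "D p"] B_uminus(1)[OF bm[OF Dm \<kappa>] \<xi>] B_sym[OF bm[OF Dm \<kappa>] \<xi>] by simp
  ultimately show "courant_form \<eta> (left_field G \<xi>, alpha_left \<xi>) (- right_field G \<zeta>, alpha_right \<zeta>) (left_field G \<kappa>) p = 0"
    unfolding courant_form_def split f1 f2 f3 f4 f5 f6 f7 der'[OF \<xi> \<kappa>] der'[OF \<kappa> \<xi>] by simp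
qed

lemma pairing_sections:
  assumes "\<xi> \<in> \<gg>" "\<zeta> \<in> \<gg>"
  shows "pairing (left_field G \<xi>, alpha_left \<xi>) (left_field G \<zeta>, alpha_left \<zeta>) p = B \<xi> \<zeta>"
    "pairing (- right_field G \<xi>, alpha_right \<xi>) (- right_field G \<zeta>, alpha_right \<zeta>) p = - B \<xi> \<zeta>"
    "pairing (left_field G \<xi>, alpha_left \<xi>) (- right_field G \<zeta>, alpha_right \<zeta>) p = 0"
    "pairing (- right_field G \<zeta>, alpha_right \<zeta>) (left_field G \<xi>, alpha_left \<xi>) p = 0"
  using assms B_sym[OF assms]
  by (simp_all add: pairing_def alpha_left_left_field alpha_right_right_field alpha_left_right_field alpha_right_left_field)

lemma courant_form_right_left:
  assumes \<xi>: "\<xi> \<in> \<gg>" and \<zeta>: "\<zeta> \<in> \<gg>" and Z: "Z \<in> VF"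
  shows "courant_form \<eta> (- right_field G \<zeta>, alpha_right \<zeta>) (left_field G \<xi>, alpha_left \<xi>) Z p = 0"
proof -
  have "pairing (left_field G \<xi>, alpha_left \<xi>) (- right_field G \<zeta>, alpha_right \<zeta>) = (\<lambda>p. 0)"
    using pairing_sections(3)[OF \<xi> \<zeta>] by (intro ext)
  then show ?thesis
    using courant_form_swap[OF s_left_gsections[OF \<xi>] s_right_gsections[OF \<zeta>] eta_k_forms Z, of p]
      courant_form_left_right[OF \<xi> \<zeta> Z, of p] tangent_const[OF VF_tangent[OF Z], of p 0] by simp
qed

abbreviation "s \<equiv> s_map G B"

lemma s_map_eq:
  "s (\<xi>, \<xi>') = (left_field G \<xi>, alpha_left \<xi>) + (- right_field G \<xi>', alpha_right \<xi>')"
  by (simp add: s_map_def s_left_eq s_right_eq)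

lemma s_map_gsections: "\<xi> \<in> \<gg> \<Longrightarrow> \<xi>' \<in> \<gg> \<Longrightarrow> s (\<xi>, \<xi>') \<in> \<Gamma>"
  unfolding s_map_eq by (intro gsections_add s_left_gsections s_right_gsections)

lemma pairing_s_map:
  assumes "\<xi> \<in> \<gg>" "\<xi>' \<in> \<gg>" "\<zeta> \<in> \<gg>" "\<zeta>' \<in> \<gg>"
  shows "pairing (s (\<xi>, \<xi>')) (s (\<zeta>, \<zeta>')) p = B \<xi> \<zeta> - B \<xi>' \<zeta>'"
proof -
  note g = s_left_gsections[OF assms(1)] s_right_gsections[OF assms(2)]
    s_left_gsections[OF assms(3)] s_right_gsections[OF assms(4)]
  show ?thesis
    unfolding s_map_eq pairing_add(1)[OF g(1,2) gsections_add[OF g(3,4)]]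
      pairing_add(2)[OF g(3,4,1)] pairing_add(2)[OF g(3,4,2)]
    by (simp add: pairing_sections assms)
qed

lemma courant_s_map:
  assumes "\<xi> \<in> \<gg>" "\<xi>' \<in> \<gg>" "\<zeta> \<in> \<gg>" "\<zeta>' \<in> \<gg>"
  shows "courant_bracket (charts G) \<eta> (s (\<xi>, \<xi>')) (s (\<zeta>, \<zeta>')) = s (lie_bracket G \<xi> \<zeta>, lie_bracket G \<xi>' \<zeta>')"
    and "\<omega> \<in> \<Omega> \<Longrightarrow> graded_commutator 0 1 (graded_commutator 1 1 (twisted_d (charts G) \<eta>)
      (clifford_action (s (\<xi>, \<xi>')))) (clifford_action (s (\<zeta>, \<zeta>'))) \<omega> =
      clifford_action (s (lie_bracket G \<xi> \<zeta>, lie_bracket G \<xi>' \<zeta>')) \<omega>"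
proof -
  note g = s_left_gsections[OF assms(1)] s_right_gsections[OF assms(2)]
    s_left_gsections[OF assms(3)] s_right_gsections[OF assms(4)]
  note L = left_field_VF[OF assms(1)] left_field_VF[OF assms(3)]
  note R = VF_uminus[OF right_field_VF[OF assms(2)]] VF_uminus[OF right_field_VF[OF assms(4)]]
  have cross: "vf_bracket (left_field G u) (- right_field G k) = 0" "vf_bracket (- right_field G k) (left_field G u) = 0"
    if "u \<in> \<gg>" "k \<in> \<gg>" for u k
    using vf_bracket_uminus left_right_commute[OF that] left_field_VF right_field_VF that
      vf_bracket_uminus_swap[of "right_field G k" "left_field G u"] by simp_all
  have br: "vf_bracket (left_field G \<xi> + - right_field G \<xi>') (left_field G \<zeta> + - right_field G \<zeta>') =
      left_field G (lie_bracket G \<xi> \<zeta>) + - right_field G (lie_bracket G \<xi>' \<zeta>')"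
    unfolding vf_bracket_add(2)[OF VF_add[OF L(2) R(2)] L(1) R(1)] vf_bracket_add(1)[OF L(1) L(2) R(2)]
      vf_bracket_add(1)[OF R(1) L(2) R(2)] cross[OF assms(1,4)] cross[OF assms(3,2)]
      left_field_bracket[OF assms(1,3)] bracket_uminus_right_field[OF assms(2,4)] by simp
  have eq: "(alpha_left (lie_bracket G \<xi> \<zeta>) + alpha_right (lie_bracket G \<xi>' \<zeta>')) [Z] p =
      courant_form \<eta> (left_field G \<xi> + - right_field G \<xi>', alpha_left \<xi> + alpha_right \<xi>')
        (left_field G \<zeta> + - right_field G \<zeta>', alpha_left \<zeta> + alpha_right \<zeta>') Z p" if Z: "Z \<in> VF" for Z p
    unfolding add_Pair[symmetric] courant_form_add(1)[OF g(1,2) gsections_add[OF g(3,4)] eta_k_forms Z]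
      courant_form_add(2)[OF g(3,4,1) eta_k_forms Z] courant_form_add(2)[OF g(3,4,2) eta_k_forms Z]
      courant_form_left_left[OF assms(1,3) Z] courant_form_right_right[OF assms(2,4) Z]
      courant_form_left_right[OF assms(1,4) Z] courant_form_right_left[OF assms(3,2) Z] by simp
  have x: "(left_field G u + - right_field G u', alpha_left u + alpha_right u') \<in> \<Gamma>" if "u \<in> \<gg>" "u' \<in> \<gg>" for u u'
    using s_map_gsections[OF that] unfolding s_map_eq add_Pair .
  \<comment> \<open>Rewriting with \<open>br\<close> turns the remaining membership premise into one
    about a value of s.\<close>
  note main = courant_bracket_eqI[OF x[OF assms(1,2)] x[OF assms(3,4)] _ eta_k_forms eq,
      unfolded br, OF x[OF lie_bracket_mem[OF assms(1,3)] lie_bracket_mem[OF assms(2,4)]]]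
  show "courant_bracket (charts G) \<eta> (s (\<xi>, \<xi>')) (s (\<zeta>, \<zeta>')) = s (lie_bracket G \<xi> \<zeta>, lie_bracket G \<xi>' \<zeta>')"
    unfolding s_map_eq add_Pair by (rule main(1))
  show "graded_commutator 0 1 (graded_commutator 1 1 (twisted_d (charts G) \<eta>)
      (clifford_action (s (\<xi>, \<xi>')))) (clifford_action (s (\<zeta>, \<zeta>'))) \<omega> =
      clifford_action (s (lie_bracket G \<xi> \<zeta>, lie_bracket G \<xi>' \<zeta>')) \<omega>" if "\<omega> \<in> \<Omega>"
    unfolding s_map_eq add_Pair by (rule main(2)[OF _ that])
qed

lemma Upsilon_s_map:
  assumes "\<xi> \<in> \<gg>" "\<xi>' \<in> \<gg>" "\<zeta> \<in> \<gg>" "\<zeta>' \<in> \<gg>" "\<kappa> \<in> \<gg>" "\<kappa>' \<in> \<gg>"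
  shows "Upsilon (charts G) \<eta> (s (\<xi>, \<xi>')) (s (\<zeta>, \<zeta>')) (s (\<kappa>, \<kappa>')) =
    (\<lambda>g. B \<xi> (lie_bracket G \<zeta> \<kappa>) - B \<xi>' (lie_bracket G \<zeta>' \<kappa>'))"
proof (rule Upsilon_eqI)
  \<comment> \<open>\<open>Upsilon\<close> brackets the third argument with the second, in this
    order; antisymmetry absorbs the minus sign of \<open>Upsilon_eqI\<close>.\<close>
  let ?u = "s (lie_bracket G \<kappa> \<zeta>, lie_bracket G \<kappa>' \<zeta>')"
  show "?u \<in> \<Gamma>" by (intro s_map_gsections lie_bracket_mem assms)
  show "graded_commutator 0 1 (graded_commutator 1 1 (twisted_d (charts G) \<eta>)
      (clifford_action (s (\<kappa>, \<kappa>')))) (clifford_action (s (\<zeta>, \<zeta>'))) \<omega> = clifford_action ?u \<omega>" if "\<omega> \<in> \<Omega>" for \<omega>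
    by (rule courant_s_map(2)[OF assms(5,6,3,4) that])
  show "pairing (s (\<xi>, \<xi>')) ?u p = - (B \<xi> (lie_bracket G \<zeta> \<kappa>) - B \<xi>' (lie_bracket G \<zeta>' \<kappa>'))" for p
    unfolding pairing_s_map[OF assms(1,2) lie_bracket_mem[OF assms(5,3)] lie_bracket_mem[OF assms(6,4)]]
    using lie_bracket_antisym[of \<kappa> \<zeta>] lie_bracket_antisym[of \<kappa>' \<zeta>']
    by (simp add: assms lie_bracket_mem B_uminus)
qed (use assms s_map_gsections in auto)

text \<open>Y is the argument that \<open>push_form\<close> hands to a form under the action of (a,
  b), evaluated at the preimage of g. For the left form, translating back to the unit swallows b and
  leaves conjugation by inv a; for the right form it swallows a and leaves conjugation by inv
  b.\<close>

lemma MC_push_act: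
  fixes a b :: 'g
  assumes X: "X \<in> VF"
  defines "Y \<equiv> push_vf (charts G) (\<lambda>g. inv b \<otimes> g \<otimes> a) X"
  shows "MC_left G [Y] (inv b \<otimes> g \<otimes> a) = Ad G (inv a) (MC_left G [X] g)"
    "MC_right G [Y] (inv b \<otimes> g \<otimes> a) = Ad G (inv b) (MC_right G [X] g)"
proof -
  note d = diffeomorphism_act[of "inv b" "inv a", simplified]
  have Y: "Y \<in> VF" unfolding Y_def by (rule push_vf_VF[OF d X])
  have Yg: "Y (inv b \<otimes> g \<otimes> a) = push_tvec (charts G) (\<lambda>g. inv b \<otimes> g \<otimes> a) (X g)"
    unfolding Y_def push_vf_apply[OF d] by (simp add: mult_assoc)
  show "MC_left G [Y] (inv b \<otimes> g \<otimes> a) = Ad G (inv a) (MC_left G [X] g)"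
    unfolding MC_left_eq(1)[OF Y] MC_left_eq(1)[OF X] Yg Ad_def push_tvec_compose[OF smooth_left]
      push_tvec_compose[OF smooth_conjugate] by (simp add: mult_assoc)
  show "MC_right G [Y] (inv b \<otimes> g \<otimes> a) = Ad G (inv b) (MC_right G [X] g)"
    unfolding MC_right_eq(1)[OF Y] MC_right_eq(1)[OF X] Yg Ad_def push_tvec_compose[OF smooth_right]
      push_tvec_compose[OF smooth_conjugate] by (simp add: mult_assoc)
qed

text \<open>Pushing a form evaluates it at the preimage, so \<open>MC_push_act\<close> produces Ad
  of the inverses, which \<open>B_Ad_inv\<close> moves over to \<xi> and \<xi>'.\<close>

lemma s_map_equivariant:
  assumes \<xi>: "\<xi> \<in> \<gg>" and \<xi>': "\<xi>' \<in> \<gg>"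
  shows "s (Ad G a \<xi>, Ad G b \<xi>') = push_gsection (charts G) (\<lambda>g. b \<otimes> g \<otimes> inv a) (s (\<xi>, \<xi>'))"
proof -
  let ?\<phi> = "\<lambda>g. b \<otimes> g \<otimes> inv a" and ?\<psi> = "\<lambda>g. inv b \<otimes> g \<otimes> a"
  note d = diffeomorphism_act[of b a]
  note inv = diffeomorphismD(5)[OF d]
  note L = left_field_VF[OF \<xi>] and R = right_field_VF[OF \<xi>']
  have vf: "push_vf (charts G) ?\<phi> (left_field G \<xi> + - right_field G \<xi>') =
      left_field G (Ad G a \<xi>) + - right_field G (Ad G b \<xi>')"
  proof
    fix g
    have "push_vf (charts G) ?\<phi> (left_field G \<xi> + - right_field G \<xi>') g =
      push_tvec (charts G) ?\<phi> (1 *\<^sub>R left_field G \<xi> (?\<psi> g) + (- 1) *\<^sub>R right_field G \<xi>' (?\<psi> g))"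
      by (simp add: push_vf_apply[OF d])
    also have "\<dots> = push_vf (charts G) ?\<phi> (left_field G \<xi>) g + - push_vf (charts G) ?\<phi> (right_field G \<xi>') g"
      unfolding push_tvec_lincomb push_vf_apply[OF d] by simp
    finally show "push_vf (charts G) ?\<phi> (left_field G \<xi> + - right_field G \<xi>') g =
        (left_field G (Ad G a \<xi>) + - right_field G (Ad G b \<xi>')) g"
      unfolding push_act_left_field[OF \<xi>] push_act_right_field[OF \<xi>'] by simp
  qed
  have "push_form (charts G) ?\<phi> (alpha_left \<xi> + alpha_right \<xi>') Xs g =
      (alpha_left (Ad G a \<xi>) + alpha_right (Ad G b \<xi>')) Xs g" for Xs g
  proof -
    note h = gsectionsD(3)[OF s_left_gsections] gsectionsD(3)[OF s_right_gsections]
    have z: "alpha_left u Ys q = 0 \<and> alpha_right u Ys q = 0"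
      if u: "u \<in> \<gg>" and Ys: "\<not> (set Ys \<subseteq> VF \<and> length Ys = 1)" for u Ys q
    proof (cases "set Ys \<subseteq> VF")
      case True
      then have "length Ys \<noteq> 1" using Ys by simp
      from homogeneousD[OF h(1)[OF u] this] homogeneousD[OF h(2)[OF u] this] show ?thesis by simp
    next
      case False
      from form_vanish[OF alpha_left_forms[OF u] this] form_vanish[OF alpha_right_forms[OF u] this]
      show ?thesis by simp
    qed
    show ?thesis
    proof (cases "set Xs \<subseteq> VF \<and> length Xs = 1")
      case True
      then obtain X where X: "Xs = [X]" "X \<in> VF" by (auto simp: length_Suc_conv)
      note mm = MC_left_eq(2)[OF X(2)] MC_right_eq(2)[OF X(2)]
      show ?thesis
        unfolding push_form_def inv using X
        by (simp add: alpha_left_def alpha_right_def MC_push_act B_Ad_inv mm \<xi> \<xi>')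
    next
      case False
      have "(alpha_left (Ad G a \<xi>) + alpha_right (Ad G b \<xi>')) Xs g = 0"
        using z[OF Ad_mem[OF \<xi>] False] z[OF Ad_mem[OF \<xi>'] False] by simp
      moreover have "push_form (charts G) ?\<phi> (alpha_left \<xi> + alpha_right \<xi>') Xs g = 0"
      proof (cases "set Xs \<subseteq> VF")
        case True
        \<comment> \<open>Pushing the arguments preserves the length of the list, so the degree
          makes the pushed form vanish.\<close>
        then have n: "\<not> (set Ys \<subseteq> VF \<and> length Ys = 1)" if "length Ys = length Xs" for Ys
          using False that by simp
        show ?thesis
          using z[OF \<xi> n] z[OF \<xi>' n] by (simp add: push_form_def)
      qed (simp add: push_form_def)
      ultimately show ?thesis by simp
    qed
  qed
  then have "push_form (charts G) ?\<phi> (alpha_left \<xi> + alpha_right \<xi>') = alpha_left (Ad G a \<xi>) + alpha_right (Ad G b \<xi>')"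
    by (intro ext)
  with vf show ?thesis by (simp add: s_map_eq push_gsection_def)
qed

end

theorem proposition3p1:
  fixes G :: "('g::{t2_space, second_countable_topology}, 'e::real_inner) lie_data"
    and B :: "'g tvec \<Rightarrow> 'g tvec \<Rightarrow> real"
  assumes "lie_group G"
    and "invariant_inner_product G B"
  shows "(\<forall>\<zeta>\<in>double_algebra G. s_map G B \<zeta> \<in> gsections (charts G)) \<and>
    (\<forall>a\<in>carrier G \<times> carrier G. \<forall>\<zeta>\<in>double_algebra G.
       s_map G B (double_Ad G a \<zeta>) = push_gsection (charts G) (double_act G a) (s_map G B \<zeta>)) \<and>
    (\<forall>\<zeta>\<^sub>1\<in>double_algebra G. \<forall>\<zeta>\<^sub>2\<in>double_algebra G.
       pairing (s_map G B \<zeta>\<^sub>1) (s_map G B \<zeta>\<^sub>2) = (\<lambda>g. double_form B \<zeta>\<^sub>1 \<zeta>\<^sub>2) \<and>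
       courant_bracket (charts G) (eta_form G B) (s_map G B \<zeta>\<^sub>1) (s_map G B \<zeta>\<^sub>2) =
         s_map G B (double_bracket G \<zeta>\<^sub>1 \<zeta>\<^sub>2)) \<and>
    (\<forall>\<zeta>\<^sub>1\<in>double_algebra G. \<forall>\<zeta>\<^sub>2\<in>double_algebra G. \<forall>\<zeta>\<^sub>3\<in>double_algebra G.
       Upsilon (charts G) (eta_form G B) (s_map G B \<zeta>\<^sub>1) (s_map G B \<zeta>\<^sub>2) (s_map G B \<zeta>\<^sub>3) =
         (\<lambda>g. double_form B \<zeta>\<^sub>1 (double_bracket G \<zeta>\<^sub>2 \<zeta>\<^sub>3)))"
proof -
  interpret metric_liegroup G B
    using assms by unfold_locales
  have act: "double_act G (a, b) = (\<lambda>g. b \<otimes>\<^bsub>G\<^esub> g \<otimes>\<^bsub>G\<^esub> inv\<^bsub>G\<^esub> a)" for a b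
    by (simp add: double_act_def)
  show ?thesis
    by (intro conjI ballI)
      (auto simp: double_algebra_def double_Ad_def act double_form_def double_bracket_def s_map_gsections
        s_map_equivariant pairing_s_map courant_s_map(1) Upsilon_s_map fun_eq_iff)
qed

end
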